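(* Let $\delta>0$ with $\delta\notin\mathbb{N}$, and let $\mathbb{T}^2_\delta=[0,2\pi\delta]\times[0,2\pi]$ with periodic boundary conditions. Consider the stationary solution $U_K(x,y)=(\sin(y),0)$ on $\mathbb{T}^2_\delta$ of the incompressible Euler equations $\partial_tU+(U\cdot\nabla)U+\nabla P=0$, $\nabla\cdot U=0$. There exists $\varepsilon_0>0$ (depending on $\delta$) such that if $U:\mathbb{T}^2_\delta\to\mathbb{R}^2$ is a stationary solution to the Euler equations with $$\|U-U_K\|_{H^3}\le\varepsilon_0,$$ then $U=U(y)$ is necessarily a shear flow.
   Context: Velocity fields are recovered from the vorticity $\Omega=\partial_xU_2-\partial_yU_1$ through a stream function: $U=\nabla^\perp\Psi=(-\partial_y\Psi,\partial_x\Psi)$, $\Delta\Psi=\Omega$. "$U=U(y)$ is a shear flow" means that the flow does not depend on the variable $x$, with velocity in the $x$-direction. *)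

theory Defs
  imports "HOL-Analysis.Analysis"
begin

text \<open>
  Functions on the torus of side lengths $2\pi\delta$ and $2\pi$ are represented by functions on
  the plane that are periodic in each variable.
\<close>

definition torus_cell :: "real \<Rightarrow> (real \<times> real) set" where
  "torus_cell \<delta> = {0..2 * pi * \<delta>} \<times> {0..2 * pi}"

definition torus_periodic :: "real \<Rightarrow> (real \<times> real \<Rightarrow> 'a) \<Rightarrow> bool" where
  "torus_periodic \<delta> f \<longleftrightarrow>
     (\<forall>x y. f (x + 2 * pi * \<delta>, y) = f (x, y) \<and> f (x, y + 2 * pi) = f (x, y))"

text \<open>The partial derivatives are meaningful only at points of differentiability.\<close>

definition dx :: "(real \<times> real \<Rightarrow> 'a::real_normed_vector) \<Rightarrow> real \<times> real \<Rightarrow> 'a" where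
  "dx f z = frechet_derivative f (at z) (1, 0)"

definition dy :: "(real \<times> real \<Rightarrow> 'a::real_normed_vector) \<Rightarrow> real \<times> real \<Rightarrow> 'a" where
  "dy f z = frechet_derivative f (at z) (0, 1)"

definition grad :: "(real \<times> real \<Rightarrow> real) \<Rightarrow> real \<times> real \<Rightarrow> real \<times> real" where
  "grad f z = (dx f z, dy f z)"

definition perp_grad :: "(real \<times> real \<Rightarrow> real) \<Rightarrow> real \<times> real \<Rightarrow> real \<times> real" where
  "perp_grad f z = (- dy f z, dx f z)"

definition divergence :: "(real \<times> real \<Rightarrow> real \<times> real) \<Rightarrow> real \<times> real \<Rightarrow> real" where
  "divergence U z = dx (fst \<circ> U) z + dy (snd \<circ> U) z"

definition vorticity :: "(real \<times> real \<Rightarrow> real \<times> real) \<Rightarrow> real \<times> real \<Rightarrow> real" where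
  "vorticity U z = dx (snd \<circ> U) z - dy (fst \<circ> U) z"

definition laplacian :: "(real \<times> real \<Rightarrow> real) \<Rightarrow> real \<times> real \<Rightarrow> real" where
  "laplacian f z = dx (dx f) z + dy (dy f) z"

definition advection ::
    "(real \<times> real \<Rightarrow> real \<times> real) \<Rightarrow> (real \<times> real \<Rightarrow> real \<times> real) \<Rightarrow> real \<times> real \<Rightarrow> real \<times> real" where
  "advection U V z = fst (U z) *\<^sub>R dx V z + snd (U z) *\<^sub>R dy V z"

text \<open>
  Classical solutions.  On the torus, $H^3$ embeds into $C^1$, so for velocities in $H^3$ the
  pointwise reading of the equations loses no stationary solution.
\<close>

definition euler_solution ::
    "real \<Rightarrow> (real \<Rightarrow> real \<times> real \<Rightarrow> real \<times> real) \<Rightarrow> (real \<Rightarrow> real \<times> real \<Rightarrow> real) \<Rightarrow> bool" where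
  "euler_solution \<delta> U P \<longleftrightarrow>
     (\<forall>t. torus_periodic \<delta> (U t) \<and> torus_periodic \<delta> (P t)) \<and>
     (\<forall>t z. (\<lambda>s. U s z) differentiable (at t) \<and>
            U t differentiable (at z) \<and> P t differentiable (at z)) \<and>
     (\<forall>t z. vector_derivative (\<lambda>s. U s z) (at t) + advection (U t) (U t) z + grad (P t) z = 0) \<and>
     (\<forall>t z. divergence (U t) z = 0)"

definition stationary_euler :: "real \<Rightarrow> (real \<times> real \<Rightarrow> real \<times> real) \<Rightarrow> bool" where
  "stationary_euler \<delta> U \<longleftrightarrow> (\<exists>P. euler_solution \<delta> (\<lambda>t. U) P)"

text \<open>
  The stream function lives on the torus, that is, it is periodic; a velocity field recovered from
  its vorticity in this way has zero mean.
\<close>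

definition stream_function ::
    "real \<Rightarrow> (real \<times> real \<Rightarrow> real) \<Rightarrow> (real \<times> real \<Rightarrow> real \<times> real) \<Rightarrow> bool" where
  "stream_function \<delta> \<Psi> U \<longleftrightarrow>
     torus_periodic \<delta> \<Psi> \<and> (\<forall>z. \<Psi> differentiable (at z)) \<and>
     U = perp_grad \<Psi> \<and> laplacian \<Psi> = vorticity U"

definition kolmogorov_flow :: "real \<times> real \<Rightarrow> real \<times> real" where
  "kolmogorov_flow = (\<lambda>(x, y). (sin y, 0))"

definition shear_flow :: "(real \<times> real \<Rightarrow> real \<times> real) \<Rightarrow> bool" where
  "shear_flow U \<longleftrightarrow> (\<exists>u. \<forall>x y. U (x, y) = (u y, 0))"

text \<open>
  Sobolev spaces on the torus through Fourier series: the frequency of the mode $(k, l)$ is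
  $(k/\delta, l)$, and the factor $4\pi^2\delta$ is the area of the torus, so that the norm of
  order $0$ is the $L^2$ norm.
\<close>

definition fourier_coeff :: "real \<Rightarrow> (real \<times> real \<Rightarrow> real) \<Rightarrow> int \<times> int \<Rightarrow> complex" where
  "fourier_coeff \<delta> f = (\<lambda>(k, l).
     (LINT z|lebesgue_on (torus_cell \<delta>).
        complex_of_real (f z) * cis (- (of_int k / \<delta> * fst z + of_int l * snd z)))
     / complex_of_real (4 * pi\<^sup>2 * \<delta>))"

definition sobolev_term :: "real \<Rightarrow> nat \<Rightarrow> (real \<times> real \<Rightarrow> real) \<Rightarrow> int \<times> int \<Rightarrow> real" where
  "sobolev_term \<delta> s f = (\<lambda>(k, l).
     (1 + (of_int k / \<delta>)\<^sup>2 + (of_int l)\<^sup>2) ^ s * (cmod (fourier_coeff \<delta> f (k, l)))\<^sup>2)"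

definition in_sobolev :: "real \<Rightarrow> nat \<Rightarrow> (real \<times> real \<Rightarrow> real) \<Rightarrow> bool" where
  "in_sobolev \<delta> s f \<longleftrightarrow>
     torus_periodic \<delta> f \<and>
     f \<in> borel_measurable (lebesgue_on (torus_cell \<delta>)) \<and>
     integrable (lebesgue_on (torus_cell \<delta>)) (\<lambda>z. (f z)\<^sup>2) \<and>
     sobolev_term \<delta> s f summable_on UNIV"

text \<open>
  The value is meaningful only under \<^const>\<open>in_sobolev\<close>, since \<^const>\<open>infsum\<close> is \<open>0\<close> for a
  divergent sum.
\<close>

definition sobolev_norm :: "real \<Rightarrow> nat \<Rightarrow> (real \<times> real \<Rightarrow> real) \<Rightarrow> real" where
  "sobolev_norm \<delta> s f = sqrt (4 * pi\<^sup>2 * \<delta> * (\<Sum>\<^sub>\<infinity>kl. sobolev_term \<delta> s f kl))"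

definition in_sobolev_vec :: "real \<Rightarrow> nat \<Rightarrow> (real \<times> real \<Rightarrow> real \<times> real) \<Rightarrow> bool" where
  "in_sobolev_vec \<delta> s V \<longleftrightarrow> in_sobolev \<delta> s (fst \<circ> V) \<and> in_sobolev \<delta> s (snd \<circ> V)"

definition sobolev_norm_vec :: "real \<Rightarrow> nat \<Rightarrow> (real \<times> real \<Rightarrow> real \<times> real) \<Rightarrow> real" where
  "sobolev_norm_vec \<delta> s V =
     sqrt ((sobolev_norm \<delta> s (fst \<circ> V))\<^sup>2 + (sobolev_norm \<delta> s (snd \<circ> V))\<^sup>2)"

lemma kolmogorov_has_derivative:
  "(kolmogorov_flow has_derivative (\<lambda>h. (cos (snd z) * snd h, 0))) (at z)"
  unfolding kolmogorov_flow_def case_prod_beta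
  by (auto intro!: derivative_eq_intros simp: fun_eq_iff)

lemma kolmogorov_stationary: "stationary_euler \<delta> kolmogorov_flow"
proof -
  have D: "frechet_derivative kolmogorov_flow (at z) = (\<lambda>h. (cos (snd z) * snd h, 0))" for z
    using frechet_derivative_at[OF kolmogorov_has_derivative, of z] by simp
  have "((fst \<circ> kolmogorov_flow) has_derivative (\<lambda>h. cos (snd z) * snd h)) (at z)"
    and "((snd \<circ> kolmogorov_flow) has_derivative (\<lambda>h. 0)) (at z)" for z
    using has_derivative_fst[OF kolmogorov_has_derivative, of z]
      has_derivative_snd[OF kolmogorov_has_derivative, of z]
    by (simp_all add: o_def)
  then have D1: "frechet_derivative (fst \<circ> kolmogorov_flow) (at z) = (\<lambda>h. cos (snd z) * snd h)"
    and D2: "frechet_derivative (snd \<circ> kolmogorov_flow) (at z) = (\<lambda>h. 0)" for z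
    by (metis frechet_derivative_at)+
  have "euler_solution \<delta> (\<lambda>t. kolmogorov_flow) (\<lambda>t z. 0)"
    unfolding euler_solution_def torus_periodic_def advection_def grad_def divergence_def dx_def
      dy_def D D1 D2
    using kolmogorov_has_derivative
    by (auto simp: differentiable_def kolmogorov_flow_def zero_prod_def frechet_derivative_const
        vector_derivative_const_at)
  then show ?thesis
    unfolding stationary_euler_def by blast
qed

end

theory Submission imports Defs
begin

text \<open>
  Let \<open>\<phi> = \<Omega> + \<Psi> = (\<Delta> + 1)\<Psi>\<close>, which vanishes for the Kolmogorov flow.  Stationarity means that \<open>U \<cdot> \<nabla>\<phi> = 0\<close>,
  that is, \<open>U\<^sub>1 \<phi>\<^sub>x = - U\<^sub>2 \<phi>\<^sub>y\<close>.  Although \<open>U\<^sub>1\<close> vanishes near \<open>sin y = 0\<close>, integration by parts gives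
  \<open>\<integral> (sin y U\<^sub>1 + cos y \<partial>\<^sub>y U\<^sub>1) \<phi>\<^sub>x\<^sup>2 = 2 \<integral> cos y \<phi>\<^sub>x \<partial>\<^sub>y(U\<^sub>1 \<phi>\<^sub>x)\<close>, where the weight on the left is close to
  \<open>sin\<^sup>2 y + cos\<^sup>2 y = 1\<close>.  Hence \<open>\<parallel>\<phi>\<^sub>x\<parallel> \<le> C \<parallel>\<partial>\<^sub>y(U\<^sub>2 \<phi>\<^sub>y)\<parallel>\<close> in \<open>L\<^sup>2\<close>.  Since \<open>\<delta> \<notin> \<nat>\<close>, the operator \<open>\<Delta> + 1\<close> is
  invertible on the modes that depend on \<open>x\<close>, so the \<open>H\<^sup>2\<close> norm of \<open>U\<^sub>2 = \<Psi>\<^sub>x\<close> is controlled by \<open>\<parallel>\<phi>\<^sub>x\<parallel>\<close>, while the \<open>H\<^sup>1\<close>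
  norm of \<open>\<phi>\<^sub>y\<close> is at most of the order of \<open>\<epsilon>\<^sub>0\<close>.  Altogether \<open>\<parallel>\<phi>\<^sub>x\<parallel> \<le> C \<epsilon>\<^sub>0 \<parallel>\<phi>\<^sub>x\<parallel>\<close>, which forces
  \<open>\<phi>\<^sub>x = 0\<close> and then \<open>\<Psi>\<^sub>x = 0\<close>.
\<close>

section \<open>Integration over the torus\<close>

text \<open>The integrations by parts cannot be carried out on \<phi> itself: a velocity in H^3 has
  vorticity in H^2, which in two dimensions is continuous but need not be C^1. Hence the calculus is
  done on Fourier truncations, and the transport equation enters only in weak form. Two truncation
  levels are needed: N for the multiplier cos y \<phi>_x and M for the equation. For fixed N the
  transport term disappears as M grows; the remaining commutator is bounded by the energy beyond N,
  uniformly in M, and disappears as N grows.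

  In the y-derivative of U_2 \<phi>_y, the product U_2 \<phi>_yy only needs a uniform bound on U_2,
  which H^2 provides. The y-derivative of U_2, however, is controlled by \<phi>_x only in H^1, which
  in two dimensions does not give a uniform bound. Its product with \<phi>_y, also taken in H^1,
  therefore calls for an inequality of Ladyzhenskaya type.

  If \<delta> were a natural number, cos x would be a function on the torus in the kernel of
  \<Delta> + 1, and \<phi>_x = 0 would no longer imply \<Psi>_x = 0.\<close>

definition torus_int :: "real \<Rightarrow> (real \<times> real \<Rightarrow> 'a::banach) \<Rightarrow> 'a" where
  "torus_int \<delta> f = integral (torus_cell \<delta>) f"

text \<open>The partial derivatives are explicit arguments, so that composing the sum and product
  rules produces the integrand in closed form; their continuity makes it integrable.\<close>

definition has_partials ::
    "real \<Rightarrow> (real \<times> real \<Rightarrow> 'a::real_normed_vector) \<Rightarrow> (real \<times> real \<Rightarrow> 'a) \<Rightarrow> (real \<times> real \<Rightarrow> 'a) \<Rightarrow> bool"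
  where
  "has_partials \<delta> f fx fy \<longleftrightarrow>
     torus_periodic \<delta> f \<and> continuous_on UNIV fx \<and> continuous_on UNIV fy \<and>
     (\<forall>z. (f has_derivative (\<lambda>h. fst h *\<^sub>R fx z + snd h *\<^sub>R fy z)) (at z))"

lemma has_partialsD:
  assumes "has_partials \<delta> f fx fy"
  shows "torus_periodic \<delta> f" "continuous_on UNIV fx" "continuous_on UNIV fy"
    "(f has_derivative (\<lambda>h. fst h *\<^sub>R fx z + snd h *\<^sub>R fy z)) (at z)"
  using assms unfolding has_partials_def by blast+

lemma torus_cell_cbox: "torus_cell \<delta> = cbox (0, 0) (2 * pi * \<delta>, 2 * pi)"
  by (simp add: torus_cell_def cbox_Pair_eq)

lemma torus_integrable:
  fixes f :: "real \<times> real \<Rightarrow> 'a::banach"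
  shows "continuous_on UNIV f \<Longrightarrow> f integrable_on torus_cell \<delta>"
  unfolding torus_cell_cbox by (rule integrable_continuous) (rule continuous_on_subset, auto)

lemma torus_int_add:
  fixes f g :: "real \<times> real \<Rightarrow> 'a::banach"
  assumes "continuous_on UNIV f" "continuous_on UNIV g"
  shows "torus_int \<delta> (\<lambda>z. f z + g z) = torus_int \<delta> f + torus_int \<delta> g"
  unfolding torus_int_def by (intro integral_add torus_integrable assms)

lemma torus_int_diff:
  fixes f g :: "real \<times> real \<Rightarrow> 'a::banach"
  assumes "continuous_on UNIV f" "continuous_on UNIV g"
  shows "torus_int \<delta> (\<lambda>z. f z - g z) = torus_int \<delta> f - torus_int \<delta> g"
  unfolding torus_int_def by (intro integral_diff torus_integrable assms)

lemma torus_int_cmult: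
  fixes f :: "real \<times> real \<Rightarrow> 'a::{real_normed_field, banach}"
  shows "torus_int \<delta> (\<lambda>z. c * f z) = c * torus_int \<delta> f"
  unfolding torus_int_def by simp

lemma torus_int_mono:
  fixes f g :: "real \<times> real \<Rightarrow> real"
  assumes "continuous_on UNIV f" "continuous_on UNIV g" "\<And>z. f z \<le> g z"
  shows "torus_int \<delta> f \<le> torus_int \<delta> g"
  unfolding torus_int_def by (intro integral_le torus_integrable assms)

lemma torus_int_nonneg:
  fixes f :: "real \<times> real \<Rightarrow> real"
  assumes "continuous_on UNIV f" "\<And>z. f z \<ge> 0"
  shows "torus_int \<delta> f \<ge> 0"
  unfolding torus_int_def by (intro integral_nonneg torus_integrable assms)

lemma torus_int_sum:
  fixes f :: "'i \<Rightarrow> real \<times> real \<Rightarrow> 'a::banach"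
  assumes "\<And>i. i \<in> I \<Longrightarrow> continuous_on UNIV (f i)"
  shows "torus_int \<delta> (\<lambda>z. \<Sum>i\<in>I. f i z) = (\<Sum>i\<in>I. torus_int \<delta> (f i))"
proof (cases "finite I")
  case True
  then show ?thesis
    unfolding torus_int_def using assms by (intro integral_sum torus_integrable)
qed (simp add: torus_int_def)

lemma torus_int_of_real:
  assumes "continuous_on UNIV f"
  shows "torus_int \<delta> (\<lambda>z. complex_of_real (f z)) = of_real (torus_int \<delta> f)"
  unfolding torus_int_def
  using integral_linear[OF torus_integrable[OF assms] bounded_linear_of_real] by (simp add: o_def)

lemma torus_int_const:
  assumes "\<delta> > 0"
  shows "torus_int \<delta> (\<lambda>z. c) = (4 * pi\<^sup>2 * \<delta>) *\<^sub>R c"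
  unfolding torus_int_def torus_cell_cbox using assms
  by (simp add: content_Pair power2_eq_square field_simps)

lemma torus_int_norm_le:
  fixes f :: "real \<times> real \<Rightarrow> 'a::banach"
  assumes "\<delta> > 0" "continuous_on UNIV f" "\<And>z. norm (f z) \<le> B"
  shows "norm (torus_int \<delta> f) \<le> 4 * pi\<^sup>2 * \<delta> * B"
proof -
  have "norm (torus_int \<delta> f) \<le> torus_int \<delta> (\<lambda>z. B)"
    unfolding torus_int_def using assms
    by (intro integral_norm_bound_integral torus_integrable) auto
  then show ?thesis
    by (simp add: torus_int_const[OF assms(1)])
qed

lemma torus_int_iterated:
  fixes f :: "real \<times> real \<Rightarrow> 'a::banach"
  assumes "continuous_on UNIV f"
  shows "torus_int \<delta> f = integral {0..2*pi*\<delta>} (\<lambda>x. integral {0..2*pi} (\<lambda>y. f (x, y)))"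
  unfolding torus_int_def torus_cell_cbox
  by (subst integral_prod_continuous[OF continuous_on_subset[OF assms]]) (auto simp: cbox_interval)

lemma torus_int_iterated_swap:
  fixes f :: "real \<times> real \<Rightarrow> 'a::banach"
  assumes "continuous_on UNIV f"
  shows "torus_int \<delta> f = integral {0..2*pi} (\<lambda>y. integral {0..2*pi*\<delta>} (\<lambda>x. f (x, y)))"
proof -
  have "continuous_on (cbox (0,0) (2*pi*\<delta>,2*pi)) (\<lambda>(x,y). f (x, y))"
    using continuous_on_subset[OF assms] by (simp add: case_prod_beta)
  from integral_swap_continuous[OF this]
  show ?thesis
    using torus_int_iterated[OF assms, of \<delta>] by (simp add: cbox_interval)
qed

lemma has_partials_continuous: "has_partials \<delta> f fx fy \<Longrightarrow> continuous_on S f"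
  by (rule has_derivative_continuous_on, rule has_derivative_at_withinI, rule has_partialsD(4))

lemma has_partials_frechet:
  assumes "has_partials \<delta> f fx fy"
  shows "frechet_derivative f (at z) = (\<lambda>h. fst h *\<^sub>R fx z + snd h *\<^sub>R fy z)"
  using frechet_derivative_at[OF has_partialsD(4)[OF assms]] by (rule sym)

lemma has_partials_dx: "has_partials \<delta> f fx fy \<Longrightarrow> dx f z = fx z"
  and has_partials_dy: "has_partials \<delta> f fx fy \<Longrightarrow> dy f z = fy z"
  unfolding dx_def dy_def by (simp_all only: has_partials_frechet) simp_all

lemma has_partials_x:
  assumes "has_partials \<delta> f fx fy"
  shows "((\<lambda>t. f (t, y)) has_vector_derivative fx (x, y)) (at x within S)"
proof -
  have "(f has_derivative (\<lambda>h. fst h *\<^sub>R fx (x,y) + snd h *\<^sub>R fy (x,y))) (at (x,y))"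
    using assms by (simp add: has_partials_def)
  moreover have "((\<lambda>t. (t, y)) has_derivative (\<lambda>h. (h, 0))) (at x within S)"
    by (auto intro!: derivative_eq_intros)
  ultimately have "((f \<circ> (\<lambda>t. (t, y))) has_derivative
      (\<lambda>h. fst h *\<^sub>R fx (x,y) + snd h *\<^sub>R fy (x,y)) \<circ> (\<lambda>h. (h,0))) (at x within S)"
    by (intro diff_chain_within) (auto intro: has_derivative_at_withinI)
  then show ?thesis
    by (simp add: has_vector_derivative_def o_def)
qed

lemma has_partials_y:
  assumes "has_partials \<delta> f fx fy"
  shows "((\<lambda>t. f (x, t)) has_vector_derivative fy (x, y)) (at y within S)"
proof -
  have "(f has_derivative (\<lambda>h. fst h *\<^sub>R fx (x,y) + snd h *\<^sub>R fy (x,y))) (at (x,y))"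
    using assms by (simp add: has_partials_def)
  moreover have "((\<lambda>t. (x, t)) has_derivative (\<lambda>h. (0, h))) (at y within S)"
    by (auto intro!: derivative_eq_intros)
  ultimately have "((f \<circ> (\<lambda>t. (x, t))) has_derivative
      (\<lambda>h. fst h *\<^sub>R fx (x,y) + snd h *\<^sub>R fy (x,y)) \<circ> (\<lambda>h. (0,h))) (at y within S)"
    by (intro diff_chain_within) (auto intro: has_derivative_at_withinI)
  then show ?thesis
    by (simp add: has_vector_derivative_def o_def)
qed

text \<open>The fundamental theorem of calculus over one period leaves no boundary term. Applied to
  products, this lemma and its counterpart in y are the form in which integration by parts is used
  throughout.\<close>

lemma torus_int_partial_x:
  fixes f :: "real \<times> real \<Rightarrow> 'a::banach"
  assumes "\<delta> > 0" "has_partials \<delta> f fx fy"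
  shows "torus_int \<delta> fx = 0"
proof -
  have "((\<lambda>x. fx (x, y)) has_integral (f (2*pi*\<delta>, y) - f (0, y))) {0..2*pi*\<delta>}" for y
    using assms by (intro fundamental_theorem_of_calculus has_partials_x) auto
  moreover have "f (0 + 2*pi*\<delta>, y) = f (0, y)" for y
    using assms by (simp only: has_partials_def torus_periodic_def)
  ultimately have "integral {0..2*pi*\<delta>} (\<lambda>x. fx (x, y)) = 0" for y
    by (simp add: integral_unique)
  moreover have "continuous_on UNIV fx"
    using assms by (simp add: has_partials_def)
  ultimately show ?thesis
    unfolding torus_int_iterated_swap[OF \<open>continuous_on UNIV fx\<close>] by simp
qed

lemma torus_int_partial_y:
  fixes f :: "real \<times> real \<Rightarrow> 'a::banach"
  assumes "\<delta> > 0" "has_partials \<delta> f fx fy"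
  shows "torus_int \<delta> fy = 0"
proof -
  have "((\<lambda>y. fy (x, y)) has_integral (f (x, 2*pi) - f (x, 0))) {0..2*pi}" for x
    using assms by (intro fundamental_theorem_of_calculus has_partials_y) auto
  moreover have "f (x, 0 + 2*pi) = f (x, 0)" for x
    using assms by (simp only: has_partials_def torus_periodic_def)
  ultimately have "integral {0..2*pi} (\<lambda>y. fy (x, y)) = 0" for x
    by (simp add: integral_unique)
  moreover have "continuous_on UNIV fy"
    using assms by (simp add: has_partials_def)
  ultimately show ?thesis
    unfolding torus_int_iterated[OF \<open>continuous_on UNIV fy\<close>] by simp
qed

lemma has_partials_cong:
  assumes "has_partials \<delta> f fx fy" "\<And>z. f z = g z" "\<And>z. fx z = gx z" "\<And>z. fy z = gy z"
  shows "has_partials \<delta> g gx gy"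
  using assms by (metis ext)

lemma has_partials_add:
  assumes "has_partials \<delta> f fx fy" "has_partials \<delta> g gx gy"
  shows "has_partials \<delta> (\<lambda>z. f z + g z) (\<lambda>z. fx z + gx z) (\<lambda>z. fy z + gy z)"
proof -
  have "((\<lambda>z. f z + g z) has_derivative
      (\<lambda>h. (fst h *\<^sub>R fx z + snd h *\<^sub>R fy z) + (fst h *\<^sub>R gx z + snd h *\<^sub>R gy z))) (at z)" for z
    by (intro has_derivative_add has_partialsD(4)[OF assms(1)] has_partialsD(4)[OF assms(2)])
  then have "((\<lambda>z. f z + g z) has_derivative
      (\<lambda>h. fst h *\<^sub>R (fx z + gx z) + snd h *\<^sub>R (fy z + gy z))) (at z)" for z
    by (rule has_derivative_eq_rhs) (simp add: fun_eq_iff algebra_simps)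
  then show ?thesis
    using assms unfolding has_partials_def torus_periodic_def by (simp add: continuous_on_add)
qed

lemma has_partials_mult:
  fixes f g :: "real \<times> real \<Rightarrow> 'a::real_normed_field"
  assumes f: "has_partials \<delta> f fx fy" and g: "has_partials \<delta> g gx gy"
  shows "has_partials \<delta> (\<lambda>z. f z * g z) (\<lambda>z. fx z * g z + f z * gx z) (\<lambda>z. fy z * g z + f z * gy z)"
proof -
  have "((\<lambda>z. f z * g z) has_derivative
      (\<lambda>h. fst h *\<^sub>R (fx z * g z + f z * gx z) + snd h *\<^sub>R (fy z * g z + f z * gy z))) (at z)" for z
  proof -
    have "((\<lambda>z. f z * g z) has_derivative
        (\<lambda>h. f z * (fst h *\<^sub>R gx z + snd h *\<^sub>R gy z) + (fst h *\<^sub>R fx z + snd h *\<^sub>R fy z) * g z)) (at z)"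
      by (intro has_derivative_mult has_partialsD(4)[OF f] has_partialsD(4)[OF g])
    then show ?thesis
      by (rule has_derivative_eq_rhs) (simp add: fun_eq_iff algebra_simps)
  qed
  then show ?thesis
    using assms has_partials_continuous[OF f] has_partials_continuous[OF g] unfolding has_partials_def
    by (auto simp: torus_periodic_def intro!: continuous_intros)
qed

lemma has_partials_bounded_linear:
  assumes "bounded_linear T" "has_partials \<delta> f fx fy"
  shows "has_partials \<delta> (\<lambda>z. T (f z)) (\<lambda>z. T (fx z)) (\<lambda>z. T (fy z))"
proof -
  interpret bounded_linear T by fact
  have "((\<lambda>z. T (f z)) has_derivative (\<lambda>h. T (fst h *\<^sub>R fx z + snd h *\<^sub>R fy z))) (at z)" for z
    by (intro has_derivative has_partialsD(4)[OF assms(2)])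
  moreover have "continuous_on UNIV (\<lambda>z. T (fx z))" "continuous_on UNIV (\<lambda>z. T (fy z))"
    using assms(2) by (auto simp: has_partials_def intro!: continuous_on)
  ultimately show ?thesis
    using assms(2) by (simp add: has_partials_def torus_periodic_def add scaleR)
qed

lemma has_partials_fun_y:
  fixes f f' :: "real \<Rightarrow> real"
  assumes "\<And>y. (f has_real_derivative f' y) (at y)" "continuous_on UNIV f'" "\<And>y. f (y + 2*pi) = f y"
  shows "has_partials \<delta> (\<lambda>z. f (snd z)) (\<lambda>z. 0) (\<lambda>z. f' (snd z))"
proof -
  have "((\<lambda>z. f (snd z)) has_derivative (\<lambda>h. snd h *\<^sub>R f' (snd z))) (at z)" for z :: "real \<times> real"
  proof -
    have "((f \<circ> snd) has_derivative ((*) (f' (snd z)) \<circ> snd)) (at z)"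
      using assms(1)[of "snd z"]
      by (intro diff_chain_at has_derivative_snd[OF has_derivative_ident, simplified])
        (simp_all add: has_field_derivative_def)
    then show ?thesis by (simp add: o_def mult.commute)
  qed
  moreover have "continuous_on UNIV (\<lambda>z::real \<times> real. f' (snd z))"
    by (intro continuous_on_compose2[OF assms(2)] continuous_intros) auto
  ultimately show ?thesis
    using assms(3) by (auto simp: has_partials_def torus_periodic_def)
qed

text \<open>Ladyzhenskaya's argument: the square of \<open>f\<close> is bounded by a function of \<open>y\<close> only, that of
  \<open>g\<close> by a function of \<open>x\<close> only, so that the integral of their product factorizes.\<close>

lemma periodic_square_bound:
  fixes f f' :: "real \<Rightarrow> real"
  assumes L: "L > 0" and d: "\<And>x. (f has_real_derivative f' x) (at x)" and c: "continuous_on UNIV f'"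
    and x: "x \<in> {0..L}"
  shows "(f x)\<^sup>2 \<le> (1 + 1 / L) * integral {0..L} (\<lambda>t. (f t)\<^sup>2 + (f' t)\<^sup>2)"
proof -
  have cf: "continuous_on S f" for S
    using d by (meson DERIV_continuous_on has_field_derivative_at_within)
  have cf': "continuous_on S f'" for S
    using c continuous_on_subset by blast
  define J where "J = integral {0..L} (\<lambda>t. (f t)\<^sup>2 + (f' t)\<^sup>2)"
  have int: "(\<lambda>t. (f t)\<^sup>2 + (f' t)\<^sup>2) integrable_on {a..b}" for a b
    by (intro integrable_continuous_real continuous_intros cf cf')
  \<comment> \<open>The oscillation of f^2 is at most J, because |2 f f'| \<le> f^2 + f'^2.\<close>
  have step: "\<bar>(f v)\<^sup>2 - (f u)\<^sup>2\<bar> \<le> J" if "0 \<le> u" "u \<le> v" "v \<le> L" for u v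
  proof -
    have hi: "((\<lambda>t. 2 * f t * f' t) has_integral ((f v)\<^sup>2 - (f u)\<^sup>2)) {u..v}"
    proof (rule fundamental_theorem_of_calculus[OF that(2)])
      fix t
      have "((\<lambda>t. (f t)\<^sup>2) has_real_derivative 2 * f t * f' t) (at t within {u..v})"
        using has_field_derivative_at_within[OF d[of t]] by (auto intro!: derivative_eq_intros)
      then show "((\<lambda>t. (f t)\<^sup>2) has_vector_derivative 2 * f t * f' t) (at t within {u..v})"
        by (simp add: has_real_derivative_iff_has_vector_derivative)
    qed
    have "norm (integral {u..v} (\<lambda>t. 2 * f t * f' t)) \<le> integral {u..v} (\<lambda>t. (f t)\<^sup>2 + (f' t)\<^sup>2)"
    proof (rule integral_norm_bound_integral[OF _ int])
      show "(\<lambda>t. 2 * f t * f' t) integrable_on {u..v}" using hi by blast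
      fix t
      have "0 \<le> (f t - f' t)\<^sup>2" "0 \<le> (f t + f' t)\<^sup>2" by simp_all
      then show "norm (2 * f t * f' t) \<le> (f t)\<^sup>2 + (f' t)\<^sup>2"
        by (simp only: power2_sum power2_diff real_norm_def abs_le_iff) (auto simp: algebra_simps)
    qed
    also have "\<dots> \<le> J"
      unfolding J_def using that by (intro integral_subset_le int) auto
    finally show ?thesis using integral_unique[OF hi] by simp
  qed
  have pt: "(f x)\<^sup>2 - J \<le> (f t)\<^sup>2" if "t \<in> {0..L}" for t
    using step[of t x] step[of x t] x that by (cases "t \<le> x") auto
  \<comment> \<open>Averaging the pointwise bound over t replaces the unknown value f(t)^2 by its
    integral; this is where 1 + 1 / L comes from.\<close>
  have "integral {0..L} (\<lambda>t. (f x)\<^sup>2 - J) \<le> integral {0..L} (\<lambda>t. (f t)\<^sup>2 + (f' t)\<^sup>2)"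
    by (intro integral_le int) (use pt in \<open>auto intro: order_trans[OF pt]\<close>)
  then have "L * ((f x)\<^sup>2 - J) \<le> J"
    using L by (simp add: J_def)
  then show ?thesis
    using L unfolding J_def[symmetric] by (simp add: field_simps)
qed

lemma torus_int_mult_square_le:
  fixes f g :: "real \<times> real \<Rightarrow> real"
  assumes \<delta>: "\<delta> > 0" and f: "has_partials \<delta> f fx fy" and g: "has_partials \<delta> g gx gy"
  shows "torus_int \<delta> (\<lambda>z. (f z)\<^sup>2 * (g z)\<^sup>2) \<le> (1 + 1 / (2 * pi * \<delta>)) * (1 + 1 / (2 * pi)) *
    (torus_int \<delta> (\<lambda>z. (f z)\<^sup>2 + (fx z)\<^sup>2) * torus_int \<delta> (\<lambda>z. (g z)\<^sup>2 + (gy z)\<^sup>2))"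
proof -
  define F where "F = (\<lambda>z. (f z)\<^sup>2 + (fx z)\<^sup>2)"
  define G where "G = (\<lambda>z. (g z)\<^sup>2 + (gy z)\<^sup>2)"
  define A where "A = (\<lambda>y. (1 + 1 / (2 * pi * \<delta>)) * integral {0..2*pi*\<delta>} (\<lambda>x. F (x, y)))"
  define B where "B = (\<lambda>x. (1 + 1 / (2 * pi)) * integral {0..2*pi} (\<lambda>y. G (x, y)))"
  have cF: "continuous_on UNIV F" and cG: "continuous_on UNIV G"
    unfolding F_def G_def
    by (intro continuous_intros has_partials_continuous[OF f] has_partials_continuous[OF g]
        has_partialsD(2)[OF f] has_partialsD(3)[OF g])+
  have cA: "continuous_on UNIV A"
  proof -
    have "continuous_on (UNIV \<times> cbox 0 (2*pi*\<delta>)) (\<lambda>(y, x). F (x, y))"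
      unfolding case_prod_beta
      by (intro continuous_on_compose2[OF cF] continuous_intros) auto
    from integral_continuous_on_param[OF this] show ?thesis
      unfolding A_def cbox_interval by (rule continuous_on_mult_left)
  qed
  have cB: "continuous_on UNIV B"
  proof -
    have "continuous_on (UNIV \<times> cbox 0 (2*pi)) (\<lambda>(x, y). G (x, y))"
      using continuous_on_subset[OF cG] by (simp add: case_prod_beta)
    from integral_continuous_on_param[OF this] show ?thesis
      unfolding B_def cbox_interval by (rule continuous_on_mult_left)
  qed
  have cfx: "continuous_on UNIV fx" and cgy: "continuous_on UNIV gy"
    using f g by (simp_all add: has_partials_def)
  have cx: "continuous_on UNIV (\<lambda>t. fx (t, y))" for y
    by (intro continuous_on_compose2[OF cfx] continuous_intros) auto
  have cy: "continuous_on UNIV (\<lambda>t. gy (x, t))" for x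
    by (intro continuous_on_compose2[OF cgy] continuous_intros) auto
  have f_le: "(f (x, y))\<^sup>2 \<le> A y" if "x \<in> {0..2*pi*\<delta>}" for x y
    unfolding A_def F_def using \<delta> that has_partials_x[OF f]
    by (intro periodic_square_bound[of _ "\<lambda>t. f (t, y)" "\<lambda>t. fx (t, y)"] cx)
      (auto simp: has_real_derivative_iff_has_vector_derivative)
  have g_le: "(g (x, y))\<^sup>2 \<le> B x" if "y \<in> {0..2*pi}" for x y
    unfolding B_def G_def using that has_partials_y[OF g]
    by (intro periodic_square_bound[of _ "\<lambda>t. g (x, t)" "\<lambda>t. gy (x, t)"] cy)
      (auto simp: has_real_derivative_iff_has_vector_derivative)
  have cAB: "continuous_on UNIV (\<lambda>z. A (snd z) * B (fst z))"
    by (intro continuous_intros continuous_on_compose2[OF cA] continuous_on_compose2[OF cB]) auto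
  have cfg: "continuous_on UNIV (\<lambda>z. (f z)\<^sup>2 * (g z)\<^sup>2)"
    by (intro continuous_intros has_partials_continuous[OF f] has_partials_continuous[OF g])
  have "torus_int \<delta> (\<lambda>z. (f z)\<^sup>2 * (g z)\<^sup>2) \<le> torus_int \<delta> (\<lambda>z. A (snd z) * B (fst z))"
    unfolding torus_int_def
  proof (intro integral_le torus_integrable cAB cfg)
    fix z assume "z \<in> torus_cell \<delta>"
    then have "(f z)\<^sup>2 \<le> A (snd z)" "(g z)\<^sup>2 \<le> B (fst z)"
      using f_le[of "fst z" "snd z"] g_le[of "snd z" "fst z"] by (auto simp: torus_cell_def mem_Times_iff)
    then show "(f z)\<^sup>2 * (g z)\<^sup>2 \<le> A (snd z) * B (fst z)"
      by (meson mult_mono order_trans zero_le_power2)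
  qed
  also have "\<dots> = integral {0..2*pi} A * integral {0..2*pi*\<delta>} B"
    unfolding torus_int_iterated[OF cAB] by simp
  also have "\<dots> = (1 + 1 / (2 * pi * \<delta>)) * (1 + 1 / (2 * pi)) * (torus_int \<delta> F * torus_int \<delta> G)"
    unfolding A_def B_def
    unfolding torus_int_iterated[OF cG] torus_int_iterated_swap[OF cF] by simp
  finally show ?thesis unfolding F_def G_def .
qed

section \<open>Absolutely convergent Fourier series\<close>

definition freq_x :: "real \<Rightarrow> int \<times> int \<Rightarrow> real" where
  "freq_x \<delta> m = of_int (fst m) / \<delta>"

definition freq_y :: "int \<times> int \<Rightarrow> real" where
  "freq_y m = of_int (snd m)"

definition mode :: "real \<Rightarrow> int \<times> int \<Rightarrow> real \<times> real \<Rightarrow> complex" where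
  "mode \<delta> m z = cis (freq_x \<delta> m * fst z + freq_y m * snd z)"

definition fseries :: "real \<Rightarrow> (int \<times> int) set \<Rightarrow> (int \<times> int \<Rightarrow> complex) \<Rightarrow> real \<times> real \<Rightarrow> complex" where
  "fseries \<delta> K c z = (\<Sum>\<^sub>\<infinity>m\<in>K. c m * mode \<delta> m z)"

text \<open>Squares exhaust the lattice and are symmetric under negation, so that truncations of
  real functions stay real.\<close>

definition freq_box :: "nat \<Rightarrow> (int \<times> int) set" where
  "freq_box N = {- int N..int N} \<times> {- int N..int N}"

lemma finite_freq_box [simp]: "finite (freq_box N)"
  by (simp add: freq_box_def)

text \<open>Turns unconditional sums into limits of sequences. A square of size the sum of all |k| +
  |l| over a given finite set contains that set.\<close>

lemma filterlim_box: "filterlim freq_box (finite_subsets_at_top UNIV) sequentially"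
  unfolding filterlim_finite_subsets_at_top
proof safe
  fix X :: "(int \<times> int) set" assume "finite X"
  define M where "M = nat (\<Sum>m\<in>X. \<bar>fst m\<bar> + \<bar>snd m\<bar>)"
  have "X \<subseteq> freq_box N" if "N \<ge> M" for N
  proof
    fix m assume "m \<in> X"
    then have "\<bar>fst m\<bar> + \<bar>snd m\<bar> \<le> (\<Sum>m\<in>X. \<bar>fst m\<bar> + \<bar>snd m\<bar>)"
      using \<open>finite X\<close> by (intro member_le_sum) auto
    then have "\<bar>fst m\<bar> + \<bar>snd m\<bar> \<le> int N"
      using that by (simp add: M_def)
    then show "m \<in> freq_box N"
      by (cases m) (auto simp: freq_box_def)
  qed
  then have "\<forall>\<^sub>F N in sequentially. X \<subseteq> freq_box N"
    by (auto simp: eventually_sequentially)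
  then show "\<forall>\<^sub>F N in sequentially. finite (freq_box N) \<and> X \<subseteq> freq_box N \<and> freq_box N \<subseteq> UNIV"
    by simp
qed

lemma sum_box_tendsto:
  fixes f :: "int \<times> int \<Rightarrow> 'a::{comm_monoid_add, t2_space}"
  assumes "f summable_on UNIV"
  shows "(\<lambda>N. sum f (freq_box N)) \<longlonglongrightarrow> infsum f UNIV"
  using filterlim_compose[OF infsum_tendsto[OF assms] filterlim_box] by (simp add: o_def)

lemma infsum_box_compl:
  fixes f :: "int \<times> int \<Rightarrow> real"
  assumes "f summable_on UNIV"
  shows "infsum f (- freq_box N) = infsum f UNIV - sum f (freq_box N)"
  using infsum_Diff[OF assms, of "freq_box N"] by (simp add: Compl_eq_Diff_UNIV)

lemma infsum_box_compl_tendsto: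
  fixes f :: "int \<times> int \<Rightarrow> real"
  assumes "f summable_on UNIV"
  shows "(\<lambda>N. infsum f (- freq_box N)) \<longlonglongrightarrow> 0"
  using tendsto_diff[OF tendsto_const[of "infsum f UNIV"] sum_box_tendsto[OF assms]]
  by (simp add: infsum_box_compl[OF assms])

lemma norm_mode [simp]: "norm (mode \<delta> m z) = 1"
  by (simp add: mode_def)

lemma mode_mult: "mode \<delta> m z * mode \<delta> n z = mode \<delta> (m + n) z"
  by (simp add: mode_def cis_mult freq_x_def freq_y_def add_divide_distrib algebra_simps)

lemma mode_uminus: "mode \<delta> (- m) z = cnj (mode \<delta> m z)"
  by (simp add: mode_def cis_cnj freq_x_def freq_y_def)

lemma has_partials_mode:
  assumes "\<delta> > 0"
  shows "has_partials \<delta> (mode \<delta> m) (\<lambda>z. \<i> * freq_x \<delta> m * mode \<delta> m z) (\<lambda>z. \<i> * freq_y m * mode \<delta> m z)"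
proof -
  have "cis (freq_x \<delta> m * (x + 2 * pi * \<delta>) + freq_y m * y) = cis (freq_x \<delta> m * x + freq_y m * y)" for x y
  proof -
    have "freq_x \<delta> m * (x + 2 * pi * \<delta>) + freq_y m * y =
        (freq_x \<delta> m * x + freq_y m * y) + 2 * pi * of_int (fst m)"
      using assms by (simp add: freq_x_def algebra_simps)
    then show ?thesis
      by (simp only: cis_mult[symmetric]) (simp add: cis_multiple_2pi)
  qed
  moreover have "cis (freq_x \<delta> m * x + freq_y m * (y + 2 * pi)) = cis (freq_x \<delta> m * x + freq_y m * y)" for x y
  proof -
    have "freq_x \<delta> m * x + freq_y m * (y + 2 * pi) =
        (freq_x \<delta> m * x + freq_y m * y) + 2 * pi * of_int (snd m)"
      by (simp add: freq_y_def algebra_simps)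
    then show ?thesis
      by (simp only: cis_mult[symmetric]) (simp add: cis_multiple_2pi)
  qed
  ultimately have per: "torus_periodic \<delta> (mode \<delta> m)"
    by (simp add: torus_periodic_def mode_def)
  have cont: "continuous_on UNIV (mode \<delta> m)"
    unfolding mode_def by (intro continuous_intros)
  have "((\<lambda>z. cis (freq_x \<delta> m * fst z + freq_y m * snd z)) has_derivative
      (\<lambda>h. (freq_x \<delta> m * fst h + freq_y m * snd h) *\<^sub>R (\<i> * mode \<delta> m z))) (at z)" for z
  proof -
    have "((cis \<circ> (\<lambda>z. freq_x \<delta> m * fst z + freq_y m * snd z)) has_derivative
      ((\<lambda>t. t *\<^sub>R (\<i> * mode \<delta> m z)) \<circ> (\<lambda>h. freq_x \<delta> m * fst h + freq_y m * snd h))) (at z)"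
    proof (rule diff_chain_at)
      show "((\<lambda>z. freq_x \<delta> m * fst z + freq_y m * snd z) has_derivative
          (\<lambda>h. freq_x \<delta> m * fst h + freq_y m * snd h)) (at z)"
        by (auto intro!: derivative_eq_intros)
      have "(cis has_vector_derivative (\<i> * mode \<delta> m z)) (at (freq_x \<delta> m * fst z + freq_y m * snd z))"
        unfolding mode_def has_vector_derivative_complex_iff
        by (auto intro!: derivative_eq_intros simp: cis.code)
      then show "(cis has_derivative (\<lambda>t. t *\<^sub>R (\<i> * mode \<delta> m z)))
          (at (freq_x \<delta> m * fst z + freq_y m * snd z))"
        by (simp add: has_vector_derivative_def)
    qed
    then show ?thesis by (simp add: o_def)
  qed
  then have "(mode \<delta> m has_derivative
      (\<lambda>h. (freq_x \<delta> m * fst h + freq_y m * snd h) *\<^sub>R (\<i> * mode \<delta> m z))) (at z)" for z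
    by (simp only: mode_def[abs_def])
  then have "(mode \<delta> m has_derivative
      (\<lambda>h. fst h *\<^sub>R (\<i> * freq_x \<delta> m * mode \<delta> m z) + snd h *\<^sub>R (\<i> * freq_y m * mode \<delta> m z))) (at z)" for z
    by (rule has_derivative_eq_rhs) (simp add: fun_eq_iff scaleR_conv_of_real algebra_simps)
  moreover have "continuous_on UNIV (\<lambda>z. \<i> * freq_x \<delta> m * mode \<delta> m z)"
      "continuous_on UNIV (\<lambda>z. \<i> * freq_y m * mode \<delta> m z)"
    by (intro continuous_intros cont)+
  ultimately show ?thesis
    using per unfolding has_partials_def by blast
qed

lemma continuous_mode: "continuous_on S (mode \<delta> m)"
  unfolding mode_def by (intro continuous_intros)

text \<open>A nonconstant mode is, up to a nonzero factor, its own derivative in x or in y, and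
  derivatives of periodic functions integrate to zero.\<close>

lemma torus_int_mode:
  assumes "\<delta> > 0"
  shows "torus_int \<delta> (mode \<delta> m) = (if m = 0 then 4 * pi\<^sup>2 * \<delta> else 0)"
proof (cases "m = 0")
  case True
  then have "mode \<delta> m = (\<lambda>z. 1)"
    by (simp add: mode_def freq_x_def freq_y_def fun_eq_iff)
  then show ?thesis
    using True torus_int_const[OF assms, of "1::complex"] by (simp add: scaleR_conv_of_real)
next
  case False
  then consider "freq_x \<delta> m \<noteq> 0" | "freq_y m \<noteq> 0"
    using assms by (cases m) (auto simp: freq_x_def freq_y_def zero_prod_def)
  then show ?thesis
  proof cases
    case 1
    have "(\<i> * freq_x \<delta> m) * torus_int \<delta> (mode \<delta> m) = 0"
      using torus_int_partial_x[OF assms has_partials_mode[OF assms, of m]]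
      by (simp add: torus_int_cmult)
    then show ?thesis using 1 False by simp
  next
    case 2
    have "(\<i> * freq_y m) * torus_int \<delta> (mode \<delta> m) = 0"
      using torus_int_partial_y[OF assms has_partials_mode[OF assms, of m]]
      by (simp add: torus_int_cmult)
    then show ?thesis using 2 False by simp
  qed
qed

lemma fseries_finite: "finite K \<Longrightarrow> fseries \<delta> K c z = (\<Sum>m\<in>K. c m * mode \<delta> m z)"
  by (simp add: fseries_def)

lemma fseries_summable:
  assumes "(\<lambda>m. norm (c m)) summable_on K"
  shows "(\<lambda>m. norm (c m * mode \<delta> m z)) summable_on K" "(\<lambda>m. c m * mode \<delta> m z) summable_on K"
proof -
  show *: "(\<lambda>m. norm (c m * mode \<delta> m z)) summable_on K"
    using assms by (simp add: norm_mult)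
  show "(\<lambda>m. c m * mode \<delta> m z) summable_on K"
    using abs_summable_summable[OF *] .
qed

lemma norm_fseries_le:
  assumes "(\<lambda>m. norm (c m)) summable_on K"
  shows "norm (fseries \<delta> K c z) \<le> (\<Sum>\<^sub>\<infinity>m\<in>K. norm (c m))"
  unfolding fseries_def using norm_infsum_bound[OF fseries_summable(1)[OF assms]] by (simp add: norm_mult)

lemma fseries_split:
  assumes "(\<lambda>m. norm (c m)) summable_on UNIV"
  shows "fseries \<delta> UNIV c z - fseries \<delta> K c z = fseries \<delta> (- K) c z"
proof -
  have "fseries \<delta> (UNIV - K) c z = fseries \<delta> UNIV c z - fseries \<delta> K c z"
    unfolding fseries_def
    by (intro infsum_Diff fseries_summable summable_on_subset[OF assms] assms) auto
  then show ?thesis by (simp add: Compl_eq_Diff_UNIV)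
qed

lemma norm_fseries_tail:
  assumes "(\<lambda>m. norm (c m)) summable_on UNIV"
  shows "norm (fseries \<delta> UNIV c z - fseries \<delta> K c z) \<le> (\<Sum>\<^sub>\<infinity>m\<in>-K. norm (c m))"
  unfolding fseries_split[OF assms]
  by (rule norm_fseries_le) (use assms summable_on_subset in blast)

text \<open>Weierstrass test: the tail of the norms bounds the error independently of the
  point.\<close>

lemma uniform_limit_fseries:
  assumes "(\<lambda>m. norm (c m)) summable_on UNIV"
  shows "uniform_limit S (\<lambda>N. fseries \<delta> (freq_box N) c) (fseries \<delta> UNIV c) sequentially"
proof (rule uniform_limitI)
  fix e :: real assume "e > 0"
  from tendstoD[OF infsum_box_compl_tendsto[OF assms] this]
  have ev: "\<forall>\<^sub>F N in sequentially. (\<Sum>\<^sub>\<infinity>m\<in>-freq_box N. norm (c m)) < e"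
    by eventually_elim (simp add: dist_real_def)
  then show "\<forall>\<^sub>F N in sequentially. \<forall>z\<in>S. dist (fseries \<delta> (freq_box N) c z) (fseries \<delta> UNIV c z) < e"
  proof eventually_elim
    case (elim N)
    show ?case
    proof
      fix z
      have "norm (fseries \<delta> UNIV c z - fseries \<delta> (freq_box N) c z) < e"
        using le_less_trans[OF norm_fseries_tail[OF assms] elim] .
      then show "dist (fseries \<delta> (freq_box N) c z) (fseries \<delta> UNIV c z) < e"
        by (simp add: dist_norm norm_minus_commute)
    qed
  qed
qed

lemma continuous_fseries_finite: "finite K \<Longrightarrow> continuous_on S (fseries \<delta> K c)"
  by (simp add: fseries_finite cong: continuous_on_cong) (intro continuous_intros continuous_mode)

lemma continuous_fseries:
  assumes "(\<lambda>m. norm (c m)) summable_on UNIV"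
  shows "continuous_on S (fseries \<delta> UNIV c)"
  by (rule uniform_limit_theorem[OF _ uniform_limit_fseries[OF assms]])
    (auto intro!: always_eventually continuous_fseries_finite)

lemma has_partials_sum:
  assumes "\<And>i. i \<in> I \<Longrightarrow> has_partials \<delta> (f i) (fx i) (fy i)"
  shows "has_partials \<delta> (\<lambda>z. \<Sum>i\<in>I. f i z) (\<lambda>z. \<Sum>i\<in>I. fx i z) (\<lambda>z. \<Sum>i\<in>I. fy i z)"
  using assms
proof (induction I rule: infinite_finite_induct)
  case (insert i I)
  then show ?case
    using has_partials_add[of \<delta> "f i" "fx i" "fy i"] by simp
qed (simp_all add: has_partials_def torus_periodic_def)

definition fdx :: "real \<Rightarrow> (int \<times> int \<Rightarrow> complex) \<Rightarrow> int \<times> int \<Rightarrow> complex" where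
  "fdx \<delta> c = (\<lambda>m. \<i> * freq_x \<delta> m * c m)"

definition fdy :: "(int \<times> int \<Rightarrow> complex) \<Rightarrow> int \<times> int \<Rightarrow> complex" where
  "fdy c = (\<lambda>m. \<i> * freq_y m * c m)"

lemma fdx_fdy: "fdx \<delta> (fdy c) = fdy (fdx \<delta> c)"
  by (simp add: fdx_def fdy_def fun_eq_iff)

lemma norm_fdx: "norm (fdx \<delta> c m) = \<bar>freq_x \<delta> m\<bar> * norm (c m)"
  and norm_fdy: "norm (fdy c m) = \<bar>freq_y m\<bar> * norm (c m)"
  by (simp_all add: fdx_def fdy_def norm_mult)

lemma has_partials_fseries_finite:
  assumes "\<delta> > 0" "finite K"
  shows "has_partials \<delta> (fseries \<delta> K c) (fseries \<delta> K (fdx \<delta> c)) (fseries \<delta> K (fdy c))"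
proof (rule has_partials_cong)
  show "has_partials \<delta> (\<lambda>z. \<Sum>m\<in>K. c m * mode \<delta> m z)
     (\<lambda>z. \<Sum>m\<in>K. c m * (\<i> * freq_x \<delta> m * mode \<delta> m z)) (\<lambda>z. \<Sum>m\<in>K. c m * (\<i> * freq_y m * mode \<delta> m z))"
    by (rule has_partials_sum) (rule has_partials_bounded_linear[OF bounded_linear_mult_right has_partials_mode[OF assms(1)]])
qed (simp_all add: fseries_finite[OF assms(2)] fdx_def fdy_def algebra_simps)

text \<open>Termwise differentiation: summability of the differentiated coefficients makes the
  derivatives of the truncations converge uniformly.\<close>

lemma has_partials_fseries:
  assumes \<delta>: "\<delta> > 0" and c: "(\<lambda>m. norm (c m)) summable_on UNIV"
    and cx: "(\<lambda>m. norm (fdx \<delta> c m)) summable_on UNIV"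
    and cy: "(\<lambda>m. norm (fdy c m)) summable_on UNIV"
  shows "has_partials \<delta> (fseries \<delta> UNIV c) (fseries \<delta> UNIV (fdx \<delta> c)) (fseries \<delta> UNIV (fdy c))"
proof -
  define D where "D = (\<lambda>K z (h :: real \<times> real). fst h *\<^sub>R fseries \<delta> K (fdx \<delta> c) z + snd h *\<^sub>R fseries \<delta> K (fdy c) z)"
  have lim: "(\<lambda>N. fseries \<delta> (freq_box N) c z) \<longlonglongrightarrow> fseries \<delta> UNIV c z" for z
    using tendsto_uniform_limitI[OF uniform_limit_fseries[OF c, where S = UNIV]] by simp
  have "\<exists>g. \<forall>z\<in>UNIV. (\<lambda>N. fseries \<delta> (freq_box N) c z) \<longlonglongrightarrow> g z \<and> (g has_derivative D UNIV z) (at z within UNIV)"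
  proof (rule has_derivative_sequence[OF convex_UNIV, where f' = "\<lambda>N. D (freq_box N)"])
    show "(fseries \<delta> (freq_box N) c has_derivative D (freq_box N) z) (at z)" for N z
      unfolding D_def by (rule has_partialsD(4)[OF has_partials_fseries_finite[OF \<delta> finite_freq_box]])
    show "(\<lambda>N. fseries \<delta> (freq_box N) c 0) \<longlonglongrightarrow> fseries \<delta> UNIV c 0"
      by (rule lim)
    fix e :: real assume "e > 0"
    then have "e / 2 > 0" by simp
    from uniform_limitD[OF uniform_limit_fseries[OF cx, where S = UNIV and \<delta> = \<delta>] this]
      uniform_limitD[OF uniform_limit_fseries[OF cy, where S = UNIV and \<delta> = \<delta>] this]
    show "\<forall>\<^sub>F N in sequentially. \<forall>z\<in>UNIV. \<forall>h. norm (D (freq_box N) z h - D UNIV z h) \<le> e * norm h"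
    proof eventually_elim
      case (elim N)
      show ?case
      proof safe
        fix x y :: real and h :: "real \<times> real"
        let ?z = "(x, y)"
        have "norm (D (freq_box N) ?z h - D UNIV ?z h) =
          norm (fst h *\<^sub>R (fseries \<delta> (freq_box N) (fdx \<delta> c) ?z - fseries \<delta> UNIV (fdx \<delta> c) ?z)
             + snd h *\<^sub>R (fseries \<delta> (freq_box N) (fdy c) ?z - fseries \<delta> UNIV (fdy c) ?z))"
          by (simp add: D_def algebra_simps)
        also have "\<dots> \<le> \<bar>fst h\<bar> * (e / 2) + \<bar>snd h\<bar> * (e / 2)"
        proof (intro norm_triangle_le add_mono)
          have "norm (fseries \<delta> (freq_box N) (fdx \<delta> c) ?z - fseries \<delta> UNIV (fdx \<delta> c) ?z) \<le> e / 2"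
            "norm (fseries \<delta> (freq_box N) (fdy c) ?z - fseries \<delta> UNIV (fdy c) ?z) \<le> e / 2"
            using elim by (auto simp: dist_norm intro: less_imp_le)
          then show "norm (fst h *\<^sub>R (fseries \<delta> (freq_box N) (fdx \<delta> c) ?z - fseries \<delta> UNIV (fdx \<delta> c) ?z)) \<le> \<bar>fst h\<bar> * (e / 2)"
            "norm (snd h *\<^sub>R (fseries \<delta> (freq_box N) (fdy c) ?z - fseries \<delta> UNIV (fdy c) ?z)) \<le> \<bar>snd h\<bar> * (e / 2)"
            unfolding norm_scaleR by (simp_all only: mult_left_mono abs_ge_zero)
        qed
        also have "\<dots> \<le> norm h * (e / 2) + norm h * (e / 2)"
          using \<open>e > 0\<close> norm_fst_le[of "fst h" "snd h"] norm_snd_le[of "snd h" "fst h"]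
          by (intro add_mono mult_right_mono) auto
        finally show "norm (D (freq_box N) ?z h - D UNIV ?z h) \<le> e * norm h"
          by (simp add: mult.commute)
      qed
    qed
  qed simp
  then obtain g where g: "\<And>z. (\<lambda>N. fseries \<delta> (freq_box N) c z) \<longlonglongrightarrow> g z" "\<And>z. (g has_derivative D UNIV z) (at z)"
    by auto
  have "g = fseries \<delta> UNIV c"
    using LIMSEQ_unique[OF g(1) lim] by auto
  moreover have "torus_periodic \<delta> (fseries \<delta> UNIV c)"
    using has_partialsD(1)[OF has_partials_mode[OF \<delta>]] by (simp add: torus_periodic_def fseries_def)
  ultimately show ?thesis
    using g(2) continuous_fseries[OF cx] continuous_fseries[OF cy] unfolding has_partials_def D_def by blast
qed

text \<open>Uniform convergence moves the limit through the integral. By orthogonality the truncated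
  integral already has its final value as soon as the box contains n.\<close>

lemma torus_int_fseries_mult_mode:
  fixes c :: "int \<times> int \<Rightarrow> complex"
  assumes \<delta>: "\<delta> > 0" and c: "(\<lambda>m. norm (c m)) summable_on UNIV"
  shows "torus_int \<delta> (\<lambda>z. fseries \<delta> UNIV c z * mode \<delta> (- n) z) = 4 * pi\<^sup>2 * \<delta> * c n"
proof -
  let ?a = "\<lambda>N. torus_int \<delta> (\<lambda>z. fseries \<delta> (freq_box N) c z * mode \<delta> (- n) z)"
  let ?b = "torus_int \<delta> (\<lambda>z. fseries \<delta> UNIV c z * mode \<delta> (- n) z)"
  have cont: "continuous_on UNIV (\<lambda>z. fseries \<delta> UNIV c z * mode \<delta> (- n) z)"
    "continuous_on UNIV (\<lambda>z. fseries \<delta> (freq_box N) c z * mode \<delta> (- n) z)" for N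
    by (intro continuous_intros continuous_fseries[OF c] continuous_fseries_finite continuous_mode finite_freq_box)+
  have "norm (?b - ?a N) \<le> 4 * pi\<^sup>2 * \<delta> * (\<Sum>\<^sub>\<infinity>m\<in>-freq_box N. norm (c m))" for N
  proof -
    have "?b - ?a N = torus_int \<delta> (\<lambda>z. fseries \<delta> UNIV c z * mode \<delta> (- n) z - fseries \<delta> (freq_box N) c z * mode \<delta> (- n) z)"
      by (rule torus_int_diff[symmetric, OF cont])
    also have "norm \<dots> \<le> 4 * pi\<^sup>2 * \<delta> * (\<Sum>\<^sub>\<infinity>m\<in>-freq_box N. norm (c m))"
    proof (intro torus_int_norm_le \<delta> continuous_on_diff cont)
      show "norm (fseries \<delta> UNIV c z * mode \<delta> (- n) z - fseries \<delta> (freq_box N) c z * mode \<delta> (- n) z)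
          \<le> (\<Sum>\<^sub>\<infinity>m\<in>-freq_box N. norm (c m))" for z
        using norm_fseries_tail[OF c, of \<delta> z "freq_box N"]
        by (simp add: left_diff_distrib[symmetric] norm_mult)
    qed
    finally show ?thesis .
  qed
  moreover have "(\<lambda>N. 4 * pi\<^sup>2 * \<delta> * (\<Sum>\<^sub>\<infinity>m\<in>-freq_box N. norm (c m))) \<longlonglongrightarrow> 0"
    using tendsto_mult_right_zero[OF infsum_box_compl_tendsto[OF c]] .
  ultimately have "(\<lambda>N. ?b - ?a N) \<longlonglongrightarrow> 0"
    by (intro Lim_null_comparison[of "\<lambda>N. ?b - ?a N"]) auto
  from tendsto_diff[OF tendsto_const[of ?b] this] have "?a \<longlonglongrightarrow> ?b"
    by simp
  moreover have "\<forall>\<^sub>F N in sequentially. ?a N = 4 * pi\<^sup>2 * \<delta> * c n"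
  proof -
    have "\<forall>\<^sub>F N in sequentially. {n} \<subseteq> freq_box N"
      using filterlim_box unfolding filterlim_finite_subsets_at_top
      by (metis (mono_tags, lifting) eventually_mono finite.emptyI finite.insertI subset_UNIV)
    then show ?thesis
    proof eventually_elim
      case (elim N)
      have "?a N = torus_int \<delta> (\<lambda>z. \<Sum>m\<in>freq_box N. c m * mode \<delta> (m - n) z)"
        by (simp add: fseries_finite sum_distrib_right mult.assoc mode_mult)
      also have "\<dots> = (\<Sum>m\<in>freq_box N. c m * torus_int \<delta> (mode \<delta> (m - n)))"
        by (subst torus_int_sum) (auto intro!: continuous_intros continuous_mode simp: torus_int_cmult)
      also have "\<dots> = (\<Sum>m\<in>freq_box N. if m = n then c m * (4 * pi\<^sup>2 * \<delta>) else 0)"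
        by (intro sum.cong) (auto simp: torus_int_mode[OF \<delta>])
      also have "\<dots> = 4 * pi\<^sup>2 * \<delta> * c n"
        using elim by (simp add: sum.delta)
      finally show ?case .
    qed
  qed
  ultimately show ?thesis
    by (intro LIMSEQ_unique[of ?a, OF _ tendsto_eventually])
qed

text \<open>Parseval's identity for trigonometric polynomials: expand the square into a double sum
  and use orthogonality of the modes.\<close>

lemma torus_int_norm_fseries_square:
  assumes \<delta>: "\<delta> > 0" and K: "finite K"
  shows "torus_int \<delta> (\<lambda>z. (norm (fseries \<delta> K c z))\<^sup>2) = 4 * pi\<^sup>2 * \<delta> * (\<Sum>m\<in>K. (norm (c m))\<^sup>2)"
proof -
  have eq: "complex_of_real ((norm (fseries \<delta> K c z))\<^sup>2) =
      (\<Sum>n\<in>K. \<Sum>m\<in>K. c m * cnj (c n) * mode \<delta> (m - n) z)" for z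
  proof -
    have "complex_of_real ((norm (fseries \<delta> K c z))\<^sup>2) = fseries \<delta> K c z * cnj (fseries \<delta> K c z)"
      by (rule complex_norm_square)
    also have "\<dots> = (\<Sum>n\<in>K. \<Sum>m\<in>K. (c m * mode \<delta> m z) * cnj (c n * mode \<delta> n z))"
      by (simp add: fseries_finite[OF K] sum_distrib_left sum_distrib_right cnj_sum)
    also have "\<dots> = (\<Sum>n\<in>K. \<Sum>m\<in>K. c m * cnj (c n) * mode \<delta> (m - n) z)"
    proof (intro sum.cong refl)
      fix m n
      have "mode \<delta> m z * cnj (mode \<delta> n z) = mode \<delta> (m - n) z"
        using mode_mult[of \<delta> m z "- n"] by (simp add: mode_uminus)
      then show "c m * mode \<delta> m z * cnj (c n * mode \<delta> n z) = c m * cnj (c n) * mode \<delta> (m - n) z"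
        by (simp add: mult_ac)
    qed
    finally show ?thesis .
  qed
  have cont: "continuous_on UNIV (\<lambda>z. (norm (fseries \<delta> K c z))\<^sup>2)"
    by (intro continuous_intros continuous_fseries_finite K)
  have "complex_of_real (torus_int \<delta> (\<lambda>z. (norm (fseries \<delta> K c z))\<^sup>2)) =
      torus_int \<delta> (\<lambda>z. \<Sum>n\<in>K. \<Sum>m\<in>K. c m * cnj (c n) * mode \<delta> (m - n) z)"
    by (simp only: torus_int_of_real[OF cont, symmetric] eq)
  also have "\<dots> = (\<Sum>n\<in>K. \<Sum>m\<in>K. c m * cnj (c n) * torus_int \<delta> (mode \<delta> (m - n)))"
    by (simp add: torus_int_sum torus_int_cmult continuous_intros continuous_mode)
  also have "\<dots> = (\<Sum>n\<in>K. \<Sum>m\<in>K. if m = n then c m * cnj (c n) * (4 * pi\<^sup>2 * \<delta>) else 0)"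
    by (intro sum.cong) (auto simp: torus_int_mode[OF \<delta>])
  also have "\<dots> = (\<Sum>n\<in>K. c n * cnj (c n) * (4 * pi\<^sup>2 * \<delta>))"
    by (simp add: sum.delta K)
  also have "\<dots> = complex_of_real (4 * pi\<^sup>2 * \<delta> * (\<Sum>m\<in>K. (norm (c m))\<^sup>2))"
    by (simp add: complex_norm_square[symmetric] sum_distrib_left mult_ac del: of_real_power)
  finally show ?thesis
    by (simp only: of_real_eq_iff)
qed

lemma torus_int_Re_fseries_square_le:
  assumes "\<delta> > 0" "finite K"
  shows "torus_int \<delta> (\<lambda>z. (Re (fseries \<delta> K c z))\<^sup>2) \<le> 4 * pi\<^sup>2 * \<delta> * (\<Sum>m\<in>K. (norm (c m))\<^sup>2)"
  unfolding torus_int_norm_fseries_square[OF assms, symmetric]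
  by (intro torus_int_mono continuous_intros continuous_fseries_finite assms)
    (simp add: cmod_power2)

lemma fseries_real:
  assumes K: "uminus ` K = K" and c: "\<And>m. c (- m) = cnj (c m)"
  shows "cnj (fseries \<delta> K c z) = fseries \<delta> K c z"
proof -
  have "cnj (fseries \<delta> K c z) = (\<Sum>\<^sub>\<infinity>m\<in>K. c (- m) * mode \<delta> (- m) z)"
    by (simp add: fseries_def infsum_cnj[symmetric] c mode_uminus del: infsum_cnj)
  also have "\<dots> = (\<Sum>\<^sub>\<infinity>m\<in>uminus ` K. c m * mode \<delta> m z)"
    by (subst infsum_reindex) (simp_all add: inj_on_def o_def)
  finally show ?thesis
    by (simp add: K fseries_def)
qed

text \<open>Upper bounds can discard the imaginary part, but the left-hand side of the energy
  estimate needs equality. The symmetry of the index set and of the coefficients makes the sum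
  real.\<close>

lemma torus_int_Re_fseries_square:
  assumes "\<delta> > 0" "finite K" "uminus ` K = K" "\<And>m. c (- m) = cnj (c m)"
  shows "torus_int \<delta> (\<lambda>z. (Re (fseries \<delta> K c z))\<^sup>2) = 4 * pi\<^sup>2 * \<delta> * (\<Sum>m\<in>K. (norm (c m))\<^sup>2)"
proof -
  have "fseries \<delta> K c z \<in> \<real>" for z
    using fseries_real[OF assms(3), of c \<delta> z] assms(4) by (simp add: Reals_cnj_iff)
  then have "(Re (fseries \<delta> K c z))\<^sup>2 = (norm (fseries \<delta> K c z))\<^sup>2" for z
    by (simp add: cmod_power2 complex_is_Real_iff)
  then show ?thesis
    using torus_int_norm_fseries_square[OF assms(1,2)] by simp
qed

lemma uminus_box: "uminus ` freq_box N = freq_box N"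
proof -
  have "- m \<in> freq_box N \<longleftrightarrow> m \<in> freq_box N" for m
    by (cases m) (auto simp: freq_box_def)
  then show ?thesis
    by (metis (no_types, lifting) image_eqI minus_minus subsetI subset_antisym image_subsetI)
qed

text \<open>Bridge between the Lebesgue integral of the Sobolev definitions and the gauge integral
  used for the calculus; for continuous integrands they agree.\<close>

lemma fourier_coeff_continuous:
  assumes "continuous_on UNIV f"
  shows "fourier_coeff \<delta> f m = torus_int \<delta> (\<lambda>z. of_real (f z) * mode \<delta> (- m) z) / (4 * pi\<^sup>2 * \<delta>)"
proof -
  have cont: "continuous_on (torus_cell \<delta>) (\<lambda>z. complex_of_real (f z) * mode \<delta> (- m) z)"
    by (intro continuous_intros continuous_mode continuous_on_subset[OF assms]) auto
  then have "integrable (lebesgue_on (torus_cell \<delta>)) (\<lambda>z. complex_of_real (f z) * mode \<delta> (- m) z)"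
    using continuous_imp_integrable[of "(0,0)" "(2 * pi * \<delta>, 2 * pi)"] by (simp add: torus_cell_cbox)
  from lebesgue_integral_eq_integral[OF this]
  have "(LINT z|lebesgue_on (torus_cell \<delta>). complex_of_real (f z) * mode \<delta> (- m) z) =
      torus_int \<delta> (\<lambda>z. of_real (f z) * mode \<delta> (- m) z)"
    by (simp add: torus_int_def torus_cell_cbox)
  moreover have "mode \<delta> (- m) = (\<lambda>z. cis (- (of_int (fst m) / \<delta> * fst z + of_int (snd m) * snd z)))"
    by (simp add: mode_def freq_x_def freq_y_def fun_eq_iff)
  ultimately show ?thesis
    unfolding fourier_coeff_def by (simp add: case_prod_beta)
qed

text \<open>\<open>dx\<close> and \<open>dy\<close> are values of the derivative at the basis
  vectors, so linearity recovers the whole derivative from them.\<close>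

lemma has_partialsI:
  assumes "torus_periodic \<delta> f" "\<And>z. f differentiable (at z)"
    and "\<And>z. dx f z = fx z" "\<And>z. dy f z = fy z" "continuous_on UNIV fx" "continuous_on UNIV fy"
  shows "has_partials \<delta> f fx fy"
proof -
  have "(f has_derivative (\<lambda>h. fst h *\<^sub>R fx z + snd h *\<^sub>R fy z)) (at z)" for z
  proof -
    have d: "(f has_derivative frechet_derivative f (at z)) (at z)"
      using assms(2) frechet_derivative_works by blast
    interpret linear "frechet_derivative f (at z)"
      using d has_derivative_linear by blast
    have "frechet_derivative f (at z) (a, b) = a *\<^sub>R fx z + b *\<^sub>R fy z" for a b
      using add[of "a *\<^sub>R (1, 0)" "b *\<^sub>R (0, 1)"] scale[of a "(1, 0)"] scale[of b "(0, 1)"] assms(3,4)[of z]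
      by (simp add: dx_def dy_def)
    then have "frechet_derivative f (at z) = (\<lambda>h. fst h *\<^sub>R fx z + snd h *\<^sub>R fy z)"
      by (simp add: fun_eq_iff)
    then show ?thesis using d by simp
  qed
  then show ?thesis
    using assms(1,5,6) unfolding has_partials_def by blast
qed

section \<open>Uniqueness of Fourier coefficients and Fourier inversion\<close>

lemma torus_periodic_reduce:
  assumes "\<delta> > 0" "torus_periodic \<delta> f"
  obtains z' where "z' \<in> torus_cell \<delta>" "f z' = f z"
proof -
  obtain x y where z: "z = (x, y)" by (cases z)
  define L where "L = 2 * pi * \<delta>"
  have L: "L > 0" using assms by (simp add: L_def)
  interpret X: periodic_fun_simple "\<lambda>t. f (t, b)" L for b
    using assms(2) by unfold_locales (simp add: torus_periodic_def L_def)
  interpret Y: periodic_fun_simple "\<lambda>t. f (a, t)" "2 * pi" for a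
    using assms(2) by unfold_locales (simp add: torus_periodic_def)
  define x' where "x' = x - of_int \<lfloor>x / L\<rfloor> * L"
  define y' where "y' = y - of_int \<lfloor>y / (2 * pi)\<rfloor> * (2 * pi)"
  have "f (x', y') = f z"
    unfolding x'_def y'_def z by (simp only: X.minus_of_int Y.minus_of_int)
  moreover have "x' = frac (x / L) * L" "y' = frac (y / (2 * pi)) * (2 * pi)"
    using L by (simp_all add: x'_def y'_def frac_def left_diff_distrib)
  then have "0 \<le> x'" "x' \<le> L" "0 \<le> y'" "y' \<le> 2 * pi"
    using L frac_lt_1[of "x / L"] frac_lt_1[of "y / (2 * pi)"]
    by (simp_all add: mult_left_le_one_le frac_ge_0 less_imp_le)
  then have "(x', y') \<in> torus_cell \<delta>"
    by (simp add: torus_cell_def L_def)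
  ultimately show ?thesis using that by blast
qed

lemma cos_eq_1_small:
  assumes "cos t = 1" "\<bar>t\<bar> < 2 * pi"
  shows "t = (0::real)"
proof -
  have "(sin (t / 2))\<^sup>2 = 0"
    using assms(1) cos_double_sin[of "t / 2"] by simp
  then have "sin (t / 2) = 0" by simp
  moreover have "- pi < t / 2" "t / 2 < pi" using assms(2) by auto
  ultimately show ?thesis
    using sin_eq_0_pi[of "t / 2"] by simp
qed

text \<open>Orthogonality to all modes is inherited by products with powers of the kernel below,
  which concentrate at \<open>a\<close> as the exponent grows.\<close>

definition peak :: "real \<Rightarrow> real \<times> real \<Rightarrow> real \<times> real \<Rightarrow> real" where
  "peak \<delta> a z = 2 + cos ((fst z - fst a) / \<delta>) + cos (snd z - snd a)"

lemma continuous_peak: "continuous_on S (peak \<delta> a)"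
  unfolding peak_def divide_inverse by (intro continuous_intros)

text \<open>Euler's formula shows the kernel to be a combination of five modes, so multiplying by it
  only shifts mode indices.\<close>

lemma peak_modes:
  "complex_of_real (peak \<delta> a z) = 2
     + cis (- fst a / \<delta>) / 2 * mode \<delta> (1, 0) z + cis (fst a / \<delta>) / 2 * mode \<delta> (- 1, 0) z
     + cis (- snd a) / 2 * mode \<delta> (0, 1) z + cis (snd a) / 2 * mode \<delta> (0, - 1) z"
proof -
  have "complex_of_real (cos t) = cis t / 2 + cis (- t) / 2" for t
    by (simp add: complex_eq_iff)
  then show ?thesis
    by (simp add: peak_def mode_def freq_x_def freq_y_def cis_mult diff_divide_distrib algebra_simps)
qed

lemma torus_int_peak_power:
  assumes f: "continuous_on UNIV f" and 0: "\<And>m. torus_int \<delta> (\<lambda>z. complex_of_real (f z) * mode \<delta> m z) = 0"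
  shows "torus_int \<delta> (\<lambda>z. f z * peak \<delta> a z ^ n) = 0"
proof -
  \<comment> \<open>The induction runs over all modes at once, because each factor of the kernel
    shifts \<open>m\<close>.\<close>
  have "torus_int \<delta> (\<lambda>z. complex_of_real (f z * peak \<delta> a z ^ n) * mode \<delta> m z) = 0" for m
  proof (induction n arbitrary: m)
    case 0
    then show ?case using assms(2) by simp
  next
    case (Suc n)
    define F where "F = (\<lambda>m z. complex_of_real (f z * peak \<delta> a z ^ n) * mode \<delta> m z)"
    have cF: "continuous_on UNIV (F m)" for m
      unfolding F_def by (intro continuous_intros f continuous_peak continuous_mode)
    have F0: "torus_int \<delta> (F m) = 0" for m
      using Suc by (simp add: F_def)
    have *: "mode \<delta> k z * mode \<delta> m z = mode \<delta> (k + m) z" for k z by (rule mode_mult)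
    have "complex_of_real (f z * peak \<delta> a z ^ Suc n) * mode \<delta> m z =
        2 * F m z + (cis (- fst a / \<delta>) / 2) * F ((1, 0) + m) z + (cis (fst a / \<delta>) / 2) * F ((- 1, 0) + m) z
         + (cis (- snd a) / 2) * F ((0, 1) + m) z + (cis (snd a) / 2) * F ((0, - 1) + m) z" for z
      unfolding F_def *[symmetric] power_Suc of_real_mult peak_modes by (simp add: algebra_simps)
    then have "torus_int \<delta> (\<lambda>z. complex_of_real (f z * peak \<delta> a z ^ Suc n) * mode \<delta> m z) =
       torus_int \<delta> (\<lambda>z. 2 * F m z + (cis (- fst a / \<delta>) / 2) * F ((1, 0) + m) z + (cis (fst a / \<delta>) / 2) * F ((- 1, 0) + m) z
         + (cis (- snd a) / 2) * F ((0, 1) + m) z + (cis (snd a) / 2) * F ((0, - 1) + m) z)"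
      by presburger
    also have "\<dots> = 0"
      by (simp only: torus_int_add torus_int_cmult F0 continuous_on_add continuous_on_mult_left cF mult_zero_right add_0)
    finally show ?case .
  qed
  from this[of 0] have "torus_int \<delta> (\<lambda>z. complex_of_real (f z * peak \<delta> a z ^ n)) = 0"
    by (simp add: mode_def freq_x_def freq_y_def)
  moreover have "continuous_on UNIV (\<lambda>z. f z * peak \<delta> a z ^ n)"
    by (intro continuous_intros f continuous_peak)
  ultimately show ?thesis
    by (metis of_real_eq_0_iff torus_int_of_real)
qed

text \<open>If f were positive somewhere, its integral against high powers of a kernel peaking there
  would be dominated by the neighbourhood of the peak and could not vanish. The one-sided form is
  applied to f and - f.\<close>

lemma fourier_unique_nonpos:
  assumes \<delta>: "\<delta> > 0" and f: "continuous_on UNIV f" "torus_periodic \<delta> f"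
    and 0: "\<And>m. torus_int \<delta> (\<lambda>z. complex_of_real (f z) * mode \<delta> m z) = 0"
  shows "f z \<le> 0"
proof (rule ccontr)
  assume "\<not> f z \<le> 0"
  define L where "L = 2 * pi * \<delta>"
  have L: "L > 0" using \<delta> by (simp add: L_def)
  let ?C = "torus_cell \<delta>"
  let ?I = "box (0, 0) (L, 2 * pi)"
  have C: "?C = cbox (0,0) (L, 2 * pi)" by (simp add: torus_cell_cbox L_def)
  obtain z' where z': "z' \<in> ?C" "f z' > 0"
    using torus_periodic_reduce[OF \<delta> f(2)] \<open>\<not> f z \<le> 0\<close> by (metis not_le)
  \<comment> \<open>The peak is moved into the open cell: for a point on the boundary the kernel
    would attain its maximum 4 also at the opposite side of the closed cell.\<close>
  have "open {z. f z > 0}"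
    using f(1) by (simp add: open_Collect_less)
  moreover have "closure ?I = ?C"
    unfolding C using L by (intro closure_box) (auto simp: box_ne_empty Basis_prod_def)
  ultimately have "{z. f z > 0} \<inter> ?I \<noteq> {}"
    using z' open_Int_closure_eq_empty[of "{z. f z > 0}" ?I] by blast
  then obtain a where a: "a \<in> ?I" "f a > 0" by blast
  let ?v = "peak \<delta> a"
  define S where "S = ?C \<inter> {z. f z \<le> f a / 2}"
  have S: "compact S"
    unfolding S_def C using f(1) by (intro compact_Int_closed compact_cbox closed_Collect_le continuous_intros)
  have v_bounds: "0 \<le> ?v z" "?v z \<le> 4" for z
    unfolding peak_def using cos_ge_minus_one[of "(fst z - fst a) / \<delta>"] cos_ge_minus_one[of "snd z - snd a"]
      cos_le_one[of "(fst z - fst a) / \<delta>"] cos_le_one[of "snd z - snd a"] by linarith+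
  have v_lt: "?v z < 4" if "z \<in> S" for z
  proof (rule ccontr)
    assume "\<not> ?v z < 4"
    then have "cos ((fst z - fst a) / \<delta>) = 1" "cos (snd z - snd a) = 1"
      unfolding peak_def using cos_le_one[of "(fst z - fst a) / \<delta>"] cos_le_one[of "snd z - snd a"] by linarith+
    moreover have "\<bar>fst z - fst a\<bar> < L" "\<bar>snd z - snd a\<bar> < 2 * pi"
      using that a(1) unfolding S_def C by (cases z; cases a; auto simp: box_prod cbox_Pair_eq)+
    moreover have "\<bar>(fst z - fst a) / \<delta>\<bar> < 2 * pi"
      using \<open>\<bar>fst z - fst a\<bar> < L\<close> \<delta> by (simp add: L_def abs_div field_simps)
    ultimately have "(fst z - fst a) / \<delta> = 0" "snd z - snd a = 0"
      using cos_eq_1_small by blast+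
    then have "z = a" using \<delta> by (simp add: prod_eq_iff)
    then show False using that a(2) by (simp add: S_def)
  qed
  \<comment> \<open>Two rates are separated: on \<open>S\<close>, where f may be small or negative,
    the kernel stays below 4 - 2 \<eta>, while near \<open>a\<close> it exceeds 4 - \<eta>. The
    bound \<eta> \<le> 1 keeps both positive.\<close>
  obtain \<eta> where \<eta>: "\<eta> > 0" "\<eta> \<le> 1" "\<And>z. z \<in> S \<Longrightarrow> ?v z \<le> 4 - 2 * \<eta>"
  proof (cases "S = {}")
    case True
    then show ?thesis using that[of 1] by simp
  next
    case False
    obtain s where s: "s \<in> S" "\<And>z. z \<in> S \<Longrightarrow> ?v z \<le> ?v s"
      using continuous_attains_sup[OF S False continuous_peak] by blast
    show ?thesis
    proof (rule that)
      show "min 1 ((4 - ?v s) / 2) > 0" "min 1 ((4 - ?v s) / 2) \<le> 1"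
        using v_lt[OF s(1)] by auto
      have "2 * min 1 ((4 - ?v s) / 2) \<le> 4 - ?v s"
        by (simp add: min_def)
      then show "?v z \<le> 4 - 2 * min 1 ((4 - ?v s) / 2)" if "z \<in> S" for z
        using s(2)[OF that] by linarith
    qed
  qed
  obtain M where M: "\<And>z. z \<in> ?C \<Longrightarrow> \<bar>f z\<bar> \<le> M" "M > 0"
  proof -
    have "bounded (f ` ?C)"
      unfolding C by (intro compact_imp_bounded compact_continuous_image compact_cbox continuous_on_subset[OF f(1)]) auto
    then show ?thesis using that by (auto simp: bounded_pos)
  qed
  have "open ({z. ?v z > 4 - \<eta>} \<inter> ?I)"
    by (intro open_Int open_box open_Collect_less continuous_intros continuous_peak)
  moreover have "a \<in> {z. ?v z > 4 - \<eta>} \<inter> ?I"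
    using a(1) \<eta>(1) by (simp add: peak_def)
  ultimately obtain p q where pq: "a \<in> box p q" "cbox p q \<subseteq> {z. ?v z > 4 - \<eta>} \<inter> ?I"
    by (meson open_contains_cbox)
  let ?Q = "cbox p q"
  have QC: "?Q \<subseteq> ?C"
    using pq(2) box_subset_cbox[of "(0,0)" "(L, 2*pi)"] C by blast
  define \<mu> where "\<mu> = measure lborel ?Q"
  have \<mu>: "\<mu> > 0"
    unfolding \<mu>_def using pq(1) by (subst content_pos_lt_eq) (auto simp: mem_box intro: less_trans)
  have main: "f a / 2 * (4 - \<eta>) ^ n * \<mu> \<le> 4 * pi\<^sup>2 * \<delta> * (M * (4 - 2 * \<eta>) ^ n)" for n
  proof -
    \<comment> \<open>The added constant compensates for negative values of f on \<open>S\<close>.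
      It makes the integrand nonnegative on the cell, so its integral over the cell dominates that
      over \<open>?Q\<close>.\<close>
    define h where "h = (\<lambda>z. f z * ?v z ^ n + M * (4 - 2 * \<eta>) ^ n)"
    have ch: "continuous_on UNIV h"
      unfolding h_def by (intro continuous_intros f continuous_peak)
    have h0: "h z \<ge> 0" if "z \<in> ?C" for z
    proof (cases "z \<in> S")
      case True
      have "\<bar>f z * ?v z ^ n\<bar> \<le> M * (4 - 2 * \<eta>) ^ n"
        unfolding abs_mult power_abs using M(1)[OF that] M(2) v_bounds[of z] \<eta>(3)[OF True]
        by (intro mult_mono power_mono) auto
      then show ?thesis by (simp add: h_def)
    next
      case False
      then have "f z > 0" using that a by (simp add: S_def)
      then show ?thesis using M v_bounds \<eta> by (simp add: h_def)
    qed
    have hQ: "f a / 2 * (4 - \<eta>) ^ n \<le> h z" if "z \<in> ?Q" for z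
    proof -
      have v: "4 - \<eta> \<le> ?v z" and "z \<in> ?C" using that pq(2) QC by auto
      have "z \<notin> S" using v \<eta>(1) \<eta>(3)[of z] by linarith
      then have "f z > f a / 2" using \<open>z \<in> ?C\<close> by (simp add: S_def)
      then have "f a / 2 * (4 - \<eta>) ^ n \<le> f z * ?v z ^ n"
        using v \<eta> a(2) by (intro mult_mono power_mono) auto
      then show ?thesis using M \<eta> by (simp add: h_def add_increasing2)
    qed
    have intQ: "h integrable_on ?Q"
      by (intro integrable_continuous continuous_on_subset[OF ch]) auto
    have "f a / 2 * (4 - \<eta>) ^ n * \<mu> = integral ?Q (\<lambda>z. f a / 2 * (4 - \<eta>) ^ n)"
      by (simp add: \<mu>_def)
    also have "\<dots> \<le> integral ?Q h"
      by (intro integral_le intQ hQ) auto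
    also have "\<dots> \<le> torus_int \<delta> h"
      unfolding torus_int_def by (intro integral_subset_le QC intQ torus_integrable ch ballI h0)
    also have "\<dots> = torus_int \<delta> (\<lambda>z. f z * ?v z ^ n) + torus_int \<delta> (\<lambda>z. M * (4 - 2 * \<eta>) ^ n)"
      unfolding h_def by (intro torus_int_add continuous_intros f continuous_peak)
    also have "\<dots> = 4 * pi\<^sup>2 * \<delta> * (M * (4 - 2 * \<eta>) ^ n)"
      by (simp add: torus_int_peak_power[OF f(1) 0] torus_int_const[OF \<delta>])
    finally show ?thesis .
  qed
  define r where "r = (4 - \<eta>) / (4 - 2 * \<eta>)"
  have r: "r > 1" using \<eta> by (simp add: r_def field_simps)
  define B where "B = 4 * pi\<^sup>2 * \<delta> * M / (f a / 2 * \<mu>)"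
  have "r ^ n \<le> B" for n
    using main[of n] \<eta> a(2) \<mu> unfolding r_def B_def power_divide by (simp add: field_simps)
  then show False
    using real_arch_pow[OF r, of B] by (meson not_le)
qed

lemma fourier_unique:
  assumes "\<delta> > 0" "continuous_on UNIV f" "torus_periodic \<delta> f"
    and 0: "\<And>m. torus_int \<delta> (\<lambda>z. complex_of_real (f z) * mode \<delta> m z) = 0"
  shows "f z = 0"
proof -
  have "torus_int \<delta> (\<lambda>z. complex_of_real (- f z) * mode \<delta> m z) = 0" for m
    using 0[of m] torus_int_cmult[of \<delta> "-1" "\<lambda>z. complex_of_real (f z) * mode \<delta> m z"] by simp
  then have "- f z \<le> 0"
    using assms by (intro fourier_unique_nonpos[where f = "\<lambda>z. - f z"])
      (auto simp: torus_periodic_def intro!: continuous_intros)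
  moreover have "f z \<le> 0"
    using assms by (intro fourier_unique_nonpos) auto
  ultimately show ?thesis by simp
qed

lemma fourier_coeff_uminus:
  assumes "continuous_on UNIV f"
  shows "fourier_coeff \<delta> f (- m) = cnj (fourier_coeff \<delta> f m)"
proof -
  have "torus_int \<delta> (\<lambda>z. of_real (f z) * mode \<delta> m z) = cnj (torus_int \<delta> (\<lambda>z. of_real (f z) * mode \<delta> (- m) z))"
  proof -
    have "continuous_on UNIV (\<lambda>z. of_real (f z) * mode \<delta> (- m) z)"
      by (intro continuous_intros assms continuous_mode)
    from integral_linear[OF torus_integrable[OF this] bounded_linear_cnj]
    show ?thesis by (simp add: torus_int_def o_def mode_uminus)
  qed
  then show ?thesis
    by (simp add: fourier_coeff_continuous[OF assms])
qed

text \<open>The difference of f and its series is continuous and orthogonal to all modes, hence zero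
  by \<open>fourier_unique\<close>.\<close>

lemma fourier_inversion:
  assumes \<delta>: "\<delta> > 0" and f: "continuous_on UNIV f" "torus_periodic \<delta> f"
    and c: "(\<lambda>m. norm (fourier_coeff \<delta> f m)) summable_on UNIV"
  shows "complex_of_real (f z) = fseries \<delta> UNIV (fourier_coeff \<delta> f) z"
proof -
  let ?F = "fseries \<delta> UNIV (fourier_coeff \<delta> f)"
  have real: "complex_of_real (Re (?F z)) = ?F z" for z
    using fseries_real[where c = "fourier_coeff \<delta> f" and K = UNIV, of \<delta> z] fourier_coeff_uminus[OF f(1)]
    by (simp add: Reals_cnj_iff of_real_Re)
  have cF: "continuous_on UNIV ?F"
    by (rule continuous_fseries[OF c])
  have "torus_periodic \<delta> ?F"
    using has_partialsD(1)[OF has_partials_mode[OF \<delta>]] by (simp add: torus_periodic_def fseries_def)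
  have "f z - Re (?F z) = 0"
  proof (rule fourier_unique[OF \<delta>])
    show "continuous_on UNIV (\<lambda>z. f z - Re (?F z))"
      by (intro continuous_intros f cF)
    show "torus_periodic \<delta> (\<lambda>z. f z - Re (?F z))"
      using f(2) \<open>torus_periodic \<delta> ?F\<close> by (simp add: torus_periodic_def)
    fix m
    have "torus_int \<delta> (\<lambda>z. complex_of_real (f z - Re (?F z)) * mode \<delta> m z) =
        torus_int \<delta> (\<lambda>z. complex_of_real (f z) * mode \<delta> m z - ?F z * mode \<delta> m z)"
      by (simp add: real left_diff_distrib)
    also have "\<dots> = torus_int \<delta> (\<lambda>z. complex_of_real (f z) * mode \<delta> m z) - torus_int \<delta> (\<lambda>z. ?F z * mode \<delta> m z)"
      by (intro torus_int_diff continuous_intros f cF continuous_mode)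
    also have "\<dots> = 0"
      using torus_int_fseries_mult_mode[OF \<delta> c, of "- m"] \<delta>
        fourier_coeff_continuous[OF f(1), of \<delta> "- m"] by simp
    finally show "torus_int \<delta> (\<lambda>z. complex_of_real (f z - Re (?F z)) * mode \<delta> m z) = 0" .
  qed
  then show ?thesis
    using real[of z] by simp
qed

text \<open>Integration by parts against the conjugate mode.\<close>

lemma fourier_coeff_partials:
  assumes \<delta>: "\<delta> > 0" and f: "has_partials \<delta> f fx fy"
  shows "fourier_coeff \<delta> fx m = \<i> * freq_x \<delta> m * fourier_coeff \<delta> f m"
    and "fourier_coeff \<delta> fy m = \<i> * freq_y m * fourier_coeff \<delta> f m"
proof -
  let ?e = "mode \<delta> (- m)"
  have cf: "continuous_on UNIV f" "continuous_on UNIV fx" "continuous_on UNIV fy"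
    using has_partials_continuous[OF f] has_partialsD[OF f] by auto
  have P: "has_partials \<delta> (\<lambda>z. complex_of_real (f z) * ?e z)
      (\<lambda>z. complex_of_real (fx z) * ?e z + complex_of_real (f z) * (\<i> * freq_x \<delta> (- m) * ?e z))
      (\<lambda>z. complex_of_real (fy z) * ?e z + complex_of_real (f z) * (\<i> * freq_y (- m) * ?e z))"
    by (intro has_partials_mult has_partials_bounded_linear[OF bounded_linear_of_real f] has_partials_mode \<delta>)
  have m: "freq_x \<delta> (- m) = - freq_x \<delta> m" "freq_y (- m) = - freq_y m"
    by (simp_all add: freq_x_def freq_y_def)
  have "torus_int \<delta> (\<lambda>z. complex_of_real (fx z) * ?e z + (\<i> * freq_x \<delta> (- m)) * (complex_of_real (f z) * ?e z)) = 0"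
    using torus_int_partial_x[OF \<delta> P] by (simp add: mult_ac)
  moreover have "torus_int \<delta> (\<lambda>z. complex_of_real (fx z) * ?e z + (\<i> * freq_x \<delta> (- m)) * (complex_of_real (f z) * ?e z)) =
      torus_int \<delta> (\<lambda>z. complex_of_real (fx z) * ?e z) + torus_int \<delta> (\<lambda>z. (\<i> * freq_x \<delta> (- m)) * (complex_of_real (f z) * ?e z))"
    by (intro torus_int_add continuous_intros cf continuous_mode)
  ultimately have "torus_int \<delta> (\<lambda>z. complex_of_real (fx z) * ?e z) =
      \<i> * freq_x \<delta> m * torus_int \<delta> (\<lambda>z. complex_of_real (f z) * ?e z)"
    unfolding torus_int_cmult m by (simp add: algebra_simps add_eq_0_iff)
  then show "fourier_coeff \<delta> fx m = \<i> * freq_x \<delta> m * fourier_coeff \<delta> f m"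
    by (simp add: fourier_coeff_continuous cf)
  have "torus_int \<delta> (\<lambda>z. complex_of_real (fy z) * ?e z + (\<i> * freq_y (- m)) * (complex_of_real (f z) * ?e z)) = 0"
    using torus_int_partial_y[OF \<delta> P] by (simp add: mult_ac)
  moreover have "torus_int \<delta> (\<lambda>z. complex_of_real (fy z) * ?e z + (\<i> * freq_y (- m)) * (complex_of_real (f z) * ?e z)) =
      torus_int \<delta> (\<lambda>z. complex_of_real (fy z) * ?e z) + torus_int \<delta> (\<lambda>z. (\<i> * freq_y (- m)) * (complex_of_real (f z) * ?e z))"
    by (intro torus_int_add continuous_intros cf continuous_mode)
  ultimately have "torus_int \<delta> (\<lambda>z. complex_of_real (fy z) * ?e z) =
      \<i> * freq_y m * torus_int \<delta> (\<lambda>z. complex_of_real (f z) * ?e z)"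
    unfolding torus_int_cmult m by (simp add: algebra_simps add_eq_0_iff)
  then show "fourier_coeff \<delta> fy m = \<i> * freq_y m * fourier_coeff \<delta> f m"
    by (simp add: fourier_coeff_continuous cf)
qed

section \<open>The Sobolev weight and absolute convergence\<close>

definition weight :: "real \<Rightarrow> int \<times> int \<Rightarrow> real" where
  "weight \<delta> m = 1 + (freq_x \<delta> m)\<^sup>2 + (freq_y m)\<^sup>2"

lemma weight_ge_1: "weight \<delta> m \<ge> 1"
  by (simp add: weight_def)

lemma summable_on_int_inverse_square:
  fixes r :: real
  assumes "r \<noteq> 0"
  shows "(\<lambda>k::int. 1 / (1 + (r * of_int k)\<^sup>2)) summable_on UNIV"
proof -
  let ?f = "\<lambda>k::int. 1 / (1 + (r * of_int k)\<^sup>2)"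
  have "summable (\<lambda>n. (1 / r\<^sup>2) * inverse (real n ^ 2))"
    by (intro summable_mult inverse_power_summable) simp
  then have "summable (\<lambda>n. ?f (int n))"
  \<comment> \<open>At n = 0 the majorant is 0, since \<open>inverse 0 = 0\<close>, while the term
    is 1; hence the comparison starts at 1.\<close>
  proof (rule summable_comparison_test'[where N = 1])
    fix n :: nat assume "n \<ge> 1"
    then have "1 / (1 + (r * real n)\<^sup>2) \<le> 1 / (r * real n)\<^sup>2"
      using assms by (intro divide_left_mono mult_pos_pos) (auto simp: add_pos_nonneg)
    then show "norm (?f (int n)) \<le> (1 / r\<^sup>2) * inverse (real n ^ 2)"
      by (simp add: power_mult_distrib field_simps)
  qed
  then have nat: "(\<lambda>n. ?f (int n)) summable_on UNIV"
    by (subst summable_on_UNIV_nonneg_real_iff) auto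
  have "?f summable_on range int"
    using nat by (subst summable_on_reindex) (auto simp: o_def)
  moreover have "?f summable_on range (\<lambda>n. - int n)"
    using nat by (subst summable_on_reindex) (auto simp: o_def inj_on_def)
  ultimately have "?f summable_on (range int \<union> range (\<lambda>n. - int n))"
    by (rule summable_on_union)
  moreover have "range int \<union> range (\<lambda>n. - int n) = UNIV"
  proof -
    have "k \<in> range int \<union> range (\<lambda>n. - int n)" for k
      by (cases k rule: int_cases2) auto
    then show ?thesis by blast
  qed
  ultimately show ?thesis by simp
qed

text \<open>Since (1 + X)(1 + Y) \<le> (1 + X + Y)^2, the double sum is dominated by a product of
  two convergent sums over the integers.\<close>

lemma summable_weight:
  assumes "\<delta> > 0"
  shows "(\<lambda>m. 1 / (weight \<delta> m)\<^sup>2) summable_on UNIV"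
proof -
  let ?a = "\<lambda>k::int. 1 / (1 + (inverse \<delta> * of_int k)\<^sup>2)" and ?b = "\<lambda>k::int. 1 / (1 + (1 * of_int k)\<^sup>2) :: real"
  have a: "?a summable_on UNIV" and b: "?b summable_on UNIV"
    using assms summable_on_int_inverse_square[of 1] summable_on_int_inverse_square[of "inverse \<delta>"] by simp_all
  have "(\<lambda>m. ?a (fst m) * ?b (snd m)) summable_on (UNIV \<times> UNIV)"
  proof (rule summable_on_SigmaI[where g = "\<lambda>k. ?a k * infsum ?b UNIV"])
    show "((\<lambda>l. ?a (fst (k, l)) * ?b (snd (k, l))) has_sum ?a k * infsum ?b UNIV) UNIV" for k
      using has_sum_cmult_right[OF has_sum_infsum[OF b], of "?a k"] by simp
    show "(\<lambda>k. ?a k * infsum ?b UNIV) summable_on UNIV"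
      by (intro summable_on_cmult_left a)
  qed auto
  then have s: "(\<lambda>m. ?a (fst m) * ?b (snd m)) summable_on UNIV" by simp
  show ?thesis
  proof (rule summable_on_comparison_test[OF s])
    fix m
    let ?x = "(freq_x \<delta> m)\<^sup>2" and ?y = "(freq_y m)\<^sup>2"
    have "(1 + ?x) * (1 + ?y) \<le> (1 + ?x + ?y)\<^sup>2"
    proof -
      have "0 \<le> ?x + ?y + ?x * ?y + ?x\<^sup>2 + ?y\<^sup>2" by simp
      then show ?thesis by (simp add: power2_eq_square algebra_simps)
    qed
    then have "1 / (weight \<delta> m)\<^sup>2 \<le> 1 / ((1 + ?x) * (1 + ?y))"
      unfolding weight_def by (intro divide_left_mono mult_pos_pos zero_less_power add_pos_nonneg) auto
    also have "\<dots> = ?a (fst m) * ?b (snd m)"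
      by (simp add: freq_x_def freq_y_def divide_inverse mult.commute)
    finally show "1 / (weight \<delta> m)\<^sup>2 \<le> ?a (fst m) * ?b (snd m)" .
  qed simp
qed

text \<open>The square of the constant in the embedding of H^2 into absolutely convergent Fourier
  series.\<close>

definition weight_const :: "real \<Rightarrow> real" where
  "weight_const \<delta> = (\<Sum>\<^sub>\<infinity>m. 1 / (weight \<delta> m)\<^sup>2)"

text \<open>Cauchy-Schwarz on finite sets, with the coefficient split as 1 / w times w |c|.\<close>

lemma summable_norm_weighted:
  assumes \<delta>: "\<delta> > 0" and c: "(\<lambda>m. (weight \<delta> m * norm (c m))\<^sup>2) summable_on UNIV"
  shows "(\<lambda>m. norm (c m)) summable_on UNIV"
    and "(\<Sum>\<^sub>\<infinity>m. norm (c m))\<^sup>2 \<le> weight_const \<delta> * (\<Sum>\<^sub>\<infinity>m. (weight \<delta> m * norm (c m))\<^sup>2)"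
proof -
  define S where "S = (\<Sum>\<^sub>\<infinity>m. (weight \<delta> m * norm (c m))\<^sup>2)"
  have nn: "0 \<le> S" "0 \<le> weight_const \<delta>"
    unfolding S_def weight_const_def by (intro infsum_nonneg; simp)+
  have fin: "sum (\<lambda>m. norm (c m)) F \<le> sqrt (weight_const \<delta> * S)" if "finite F" for F
  proof (rule real_le_rsqrt)
    have "(\<Sum>m\<in>F. norm (c m)) = (\<Sum>m\<in>F. 1 / weight \<delta> m * (weight \<delta> m * norm (c m)))"
    proof (intro sum.cong refl)
      fix m
      have "weight \<delta> m \<noteq> 0" using weight_ge_1[of \<delta> m] by linarith
      then show "norm (c m) = 1 / weight \<delta> m * (weight \<delta> m * norm (c m))" by simp
    qed
    then have "(\<Sum>m\<in>F. norm (c m))\<^sup>2 = (\<Sum>m\<in>F. 1 / weight \<delta> m * (weight \<delta> m * norm (c m)))\<^sup>2"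
      by presburger
    also have "\<dots> \<le> (\<Sum>m\<in>F. (1 / weight \<delta> m)\<^sup>2) * (\<Sum>m\<in>F. (weight \<delta> m * norm (c m))\<^sup>2)"
      by (rule Cauchy_Schwarz_ineq_sum)
    also have "\<dots> \<le> weight_const \<delta> * S"
      unfolding weight_const_def S_def using that
      by (intro mult_mono finite_sum_le_infsum c infsum_nonneg sum_nonneg)
        (auto simp: power_divide intro!: finite_sum_le_infsum summable_weight[OF \<delta>])
    finally show "(\<Sum>m\<in>F. norm (c m))\<^sup>2 \<le> weight_const \<delta> * S" .
  qed
  show s: "(\<lambda>m. norm (c m)) summable_on UNIV"
    using fin by (intro nonneg_bdd_above_summable_on bdd_aboveI2) auto
  have "(\<Sum>\<^sub>\<infinity>m. norm (c m)) \<le> sqrt (weight_const \<delta> * S)"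
    using fin by (intro infsum_le_finite_sums s) auto
  then have "(\<Sum>\<^sub>\<infinity>m. norm (c m))\<^sup>2 \<le> (sqrt (weight_const \<delta> * S))\<^sup>2"
    by (intro power_mono infsum_nonneg) auto
  then show "(\<Sum>\<^sub>\<infinity>m. norm (c m))\<^sup>2 \<le> weight_const \<delta> * (\<Sum>\<^sub>\<infinity>m. (weight \<delta> m * norm (c m))\<^sup>2)"
    using nn by (simp add: S_def)
qed

section \<open>Stationary solutions\<close>

text \<open>The momentum equation expresses the pressure gradient through the velocity and its
  derivatives; these are continuous, so the pressure is C^1.\<close>

lemma has_partials_euler:
  assumes sol: "stationary_euler \<delta> U"
    and U1: "has_partials \<delta> (\<lambda>z. fst (U z)) u1x u1y" and U2: "has_partials \<delta> (\<lambda>z. snd (U z)) u2x u2y"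
  shows "\<exists>P. has_partials \<delta> P (\<lambda>z. - (fst (U z) * u1x z + snd (U z) * u1y z))
      (\<lambda>z. - (fst (U z) * u2x z + snd (U z) * u2y z))"
proof -
  from sol obtain P where P: "euler_solution \<delta> (\<lambda>t. U) P"
    unfolding stationary_euler_def by blast
  have Ud: "U differentiable (at z)" for z
    using P unfolding euler_solution_def by blast
  have fd: "(U has_derivative frechet_derivative U (at z)) (at z)" for z
    using Ud frechet_derivative_works by blast
  have fst: "fst (frechet_derivative U (at z) h) = fst h * u1x z + snd h * u1y z" for z h
    using fun_cong[OF has_derivative_unique[OF has_derivative_fst[OF fd[of z]] has_partialsD(4)[OF U1]], of h] by simp
  have snd: "snd (frechet_derivative U (at z) h) = fst h * u2x z + snd h * u2y z" for z h
    using fun_cong[OF has_derivative_unique[OF has_derivative_snd[OF fd[of z]] has_partialsD(4)[OF U2]], of h] by simp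
  \<comment> \<open>The velocity does not depend on time, so the pressure at the arbitrary time 0
    serves.\<close>
  have "vector_derivative (\<lambda>s. U z) (at 0) + advection U U z + grad (P 0) z = 0" for z
    using P unfolding euler_solution_def by blast
  then have adv: "advection U U z + grad (P 0) z = 0" for z
    by (simp add: vector_derivative_const_at)
  have eq: "dx (P 0) z = - (fst (U z) * u1x z + snd (U z) * u1y z)"
      "dy (P 0) z = - (fst (U z) * u2x z + snd (U z) * u2y z)" for z
  proof -
    have "(fst (U z) * u1x z + snd (U z) * u1y z) + dx (P 0) z = 0"
        "(fst (U z) * u2x z + snd (U z) * u2y z) + dy (P 0) z = 0"
      using adv[of z] by (simp_all add: prod_eq_iff advection_def grad_def dx_def[of U] dy_def[of U] fst snd)
    then show "dx (P 0) z = - (fst (U z) * u1x z + snd (U z) * u1y z)"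
      "dy (P 0) z = - (fst (U z) * u2x z + snd (U z) * u2y z)" by linarith+
  qed
  have "has_partials \<delta> (P 0) (\<lambda>z. - (fst (U z) * u1x z + snd (U z) * u1y z))
      (\<lambda>z. - (fst (U z) * u2x z + snd (U z) * u2y z))"
  proof (rule has_partialsI)
    show "torus_periodic \<delta> (P 0)" "\<And>z. P 0 differentiable (at z)"
      using P unfolding euler_solution_def by blast+
  qed (use eq in \<open>simp, simp, intro continuous_intros has_partials_continuous[OF U1] has_partials_continuous[OF U2]
      has_partialsD[OF U1] has_partialsD[OF U2]\<close>)+
  then show "\<exists>P. has_partials \<delta> P (\<lambda>z. - (fst (U z) * u1x z + snd (U z) * u1y z))
      (\<lambda>z. - (fst (U z) * u2x z + snd (U z) * u2y z))" by blast
qed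

text \<open>The function \<open>P + |U|\<^sup>2 / 2 + \<Psi>\<^sup>2 / 2\<close> has gradient \<open>\<phi> \<nabla>\<Psi>\<close> with
  \<open>\<phi> = \<Omega> + \<Psi>\<close>, so \<open>U \<cdot> \<nabla>\<phi> = 0\<close> holds weakly although \<open>\<phi>\<close> is only continuous.\<close>

lemma weak_transport:
  assumes \<delta>: "\<delta> > 0" and sol: "stationary_euler \<delta> U"
    and U1: "has_partials \<delta> (\<lambda>z. fst (U z)) u1x u1y" and U2: "has_partials \<delta> (\<lambda>z. snd (U z)) u2x u2y"
    and \<Psi>: "has_partials \<delta> \<Psi> (\<lambda>z. snd (U z)) (\<lambda>z. - fst (U z))"
    and \<eta>x: "has_partials \<delta> \<eta>x \<eta>xx \<eta>xy" and \<eta>y: "has_partials \<delta> \<eta>y \<eta>xy \<eta>yy"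
  shows "torus_int \<delta> (\<lambda>z. (u2x z - u1y z + \<Psi> z) * (fst (U z) * \<eta>x z + snd (U z) * \<eta>y z)) = 0"
proof -
  obtain P where P: "has_partials \<delta> P (\<lambda>z. - (fst (U z) * u1x z + snd (U z) * u1y z))
      (\<lambda>z. - (fst (U z) * u2x z + snd (U z) * u2y z))"
    using has_partials_euler[OF sol U1 U2] by blast
  define \<phi> where "\<phi> = (\<lambda>z. u2x z - u1y z + \<Psi> z)"
  define G where "G = (\<lambda>z. P z + 1/2 * (fst (U z) * fst (U z) + snd (U z) * snd (U z) + \<Psi> z * \<Psi> z))"
  have G: "has_partials \<delta> G (\<lambda>z. \<phi> z * snd (U z)) (\<lambda>z. - (\<phi> z * fst (U z)))"
    unfolding G_def
    by (rule has_partials_cong[OF has_partials_add[OF P has_partials_bounded_linear[OF bounded_linear_mult_right[of "1/2"]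
        has_partials_add[OF has_partials_add[OF has_partials_mult[OF U1 U1] has_partials_mult[OF U2 U2]]
          has_partials_mult[OF \<Psi> \<Psi>]]]]])
      (simp_all add: \<phi>_def algebra_simps)
  note c = has_partials_continuous[OF \<eta>x] has_partials_continuous[OF \<eta>y] has_partials_continuous[OF G]
    has_partialsD(2,3)[OF \<eta>x] has_partialsD(2,3)[OF \<eta>y] has_partialsD(2,3)[OF G]
  \<comment> \<open>The integrand is the x-derivative of G \<eta>y minus the y-derivative of G
    \<eta>x. The terms with the mixed derivative cancel because \<eta>x and \<eta>y share
    it.\<close>
  have "(\<lambda>z. \<phi> z * (fst (U z) * \<eta>x z + snd (U z) * \<eta>y z)) =
      (\<lambda>z. (\<phi> z * snd (U z) * \<eta>y z + G z * \<eta>xy z) - (- (\<phi> z * fst (U z)) * \<eta>x z + G z * \<eta>xy z))"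
    by (simp add: algebra_simps)
  then have "torus_int \<delta> (\<lambda>z. \<phi> z * (fst (U z) * \<eta>x z + snd (U z) * \<eta>y z)) =
      torus_int \<delta> (\<lambda>z. (\<phi> z * snd (U z)) * \<eta>y z + G z * \<eta>xy z) - torus_int \<delta> (\<lambda>z. - (\<phi> z * fst (U z)) * \<eta>x z + G z * \<eta>xy z)"
    by (simp only:) (intro torus_int_diff continuous_on_add continuous_on_mult c)
  also have "\<dots> = 0"
    using torus_int_partial_x[OF \<delta> has_partials_mult[OF G \<eta>y]] torus_int_partial_y[OF \<delta> has_partials_mult[OF G \<eta>x]]
    by simp
  finally show ?thesis by (simp add: \<phi>_def)
qed

text \<open>
  In the application \<open>f\<close> and \<open>F\<close> are Fourier truncations of \<open>\<Omega> + \<Psi>\<close>.  The weight \<open>cos y\<close> makes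
  the left-hand side of
  \<open>\<integral> (sin y U\<^sub>1 + cos y \<partial>\<^sub>y U\<^sub>1) f\<^sub>x\<^sup>2 = 2 \<integral> cos y f\<^sub>x \<partial>\<^sub>y(U\<^sub>1 f\<^sub>x)\<close>
  coercive near the Kolmogorov flow, in spite of the zeros of \<open>U\<^sub>1\<close>.
\<close>

lemma energy_inequality:
  fixes f F :: "real \<times> real \<Rightarrow> real"
  assumes \<delta>: "\<delta> > 0"
    and U1: "has_partials \<delta> U1 u1x u1y" and U2: "has_partials \<delta> U2 u2x u2y"
    and div: "\<And>z. u1x z + u2y z = 0"
    and coercive: "\<And>z. sin (snd z) * U1 z + cos (snd z) * u1y z \<ge> 1 / 2"
    and f: "has_partials \<delta> f fx fy" and fx: "has_partials \<delta> fx fxx fxy" and fy: "has_partials \<delta> fy fxy fyy"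
    and F: "has_partials \<delta> F Fx Fy" and Fx: "has_partials \<delta> Fx Fxx Fxy" and Fy: "has_partials \<delta> Fy Fxy Fyy"
    and \<eta>: "has_partials \<delta> \<eta> \<eta>x \<eta>y" "\<And>z. \<eta> z = cos (snd z) * fxy z - sin (snd z) * fx z"
  defines "A \<equiv> \<lambda>z. u1y z * (Fx z - fx z) + U1 z * (Fxy z - fxy z) + u2y z * (Fy z - fy z) + U2 z * (Fyy z - fyy z)"
    and "B \<equiv> \<lambda>z. u2y z * fy z + U2 z * fyy z"
  shows "torus_int \<delta> (\<lambda>z. (fx z)\<^sup>2) \<le> 32 * (torus_int \<delta> (\<lambda>z. (A z)\<^sup>2) + torus_int \<delta> (\<lambda>z. (B z)\<^sup>2))
    + 8 * torus_int \<delta> (\<lambda>z. F z * (U1 z * \<eta>x z + U2 z * \<eta>y z))"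
proof -
  have cosP: "has_partials \<delta> (\<lambda>z. cos (snd z)) (\<lambda>z. 0) (\<lambda>z. - sin (snd z))"
    by (rule has_partials_fun_y) (auto intro!: derivative_eq_intros continuous_intros)
  note cont = has_partials_continuous[OF U1] has_partials_continuous[OF U2] has_partials_continuous[OF f]
    has_partials_continuous[OF fx] has_partials_continuous[OF fy] has_partials_continuous[OF F]
    has_partials_continuous[OF Fx] has_partials_continuous[OF Fy] has_partials_continuous[OF \<eta>(1)]
    has_partialsD(2,3)[OF U1] has_partialsD(2,3)[OF U2] has_partialsD(2,3)[OF fx] has_partialsD(2,3)[OF fy]
    has_partialsD(2,3)[OF Fx] has_partialsD(2,3)[OF Fy] has_partialsD(2,3)[OF \<eta>(1)]
    continuous_on_add continuous_on_diff continuous_on_mult continuous_on_minus continuous_on_power continuous_on_const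
    continuous_on_cos[OF continuous_on_snd[OF continuous_on_id]] continuous_on_sin[OF continuous_on_snd[OF continuous_on_id]]
  \<comment> \<open>\<open>D1\<close>, \<open>D2\<close>, \<open>D3\<close> have integral zero: they
    are the y-derivatives of cos y U_1 f_x^2 and of cos y f_x (U \<cdot> \<nabla>F), and the
    divergence of F \<eta> U. The function \<eta> is the y-derivative of cos y f_x.\<close>
  define D1 where "D1 = (\<lambda>z. - sin (snd z) * (U1 z * (fx z * fx z))
      + cos (snd z) * (u1y z * (fx z * fx z) + U1 z * (fxy z * fx z + fx z * fxy z)))"
  define D2 where "D2 = (\<lambda>z. \<eta> z * (U1 z * Fx z + U2 z * Fy z)
      + cos (snd z) * fx z * (u1y z * Fx z + U1 z * Fxy z + (u2y z * Fy z + U2 z * Fyy z)))"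
  define D3 where "D3 = (\<lambda>z. \<eta> z * (U1 z * Fx z + U2 z * Fy z) + F z * (U1 z * \<eta>x z + U2 z * \<eta>y z))"
  define Q where "Q = (\<lambda>z. F z * (U1 z * \<eta>x z + U2 z * \<eta>y z))"
  have 1: "torus_int \<delta> D1 = 0"
    unfolding D1_def
    by (rule torus_int_partial_y[OF \<delta> has_partials_mult[OF cosP has_partials_mult[OF U1 has_partials_mult[OF fx fx]]]])
  have "has_partials \<delta> (\<lambda>z. cos (snd z) * fx z * (U1 z * Fx z + U2 z * Fy z))
     (\<lambda>z. (0 * fx z + cos (snd z) * fxx z) * (U1 z * Fx z + U2 z * Fy z)
       + cos (snd z) * fx z * ((u1x z * Fx z + U1 z * Fxx z) + (u2x z * Fy z + U2 z * Fxy z))) D2"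
    by (rule has_partials_cong[OF has_partials_mult[OF has_partials_mult[OF cosP fx]
        has_partials_add[OF has_partials_mult[OF U1 Fx] has_partials_mult[OF U2 Fy]]]])
      (simp_all add: D2_def \<eta>(2))
  then have 2: "torus_int \<delta> D2 = 0"
    using torus_int_partial_y[OF \<delta>] by blast
  have 3: "torus_int \<delta> D3 = 0"
  proof -
    define X where "X = (\<lambda>z. u1x z * (F z * \<eta> z) + U1 z * (Fx z * \<eta> z + F z * \<eta>x z))"
    define Y where "Y = (\<lambda>z. u2y z * (F z * \<eta> z) + U2 z * (Fy z * \<eta> z + F z * \<eta>y z))"
    have "torus_int \<delta> X = 0" "torus_int \<delta> Y = 0"
      unfolding X_def Y_def
      using torus_int_partial_x[OF \<delta> has_partials_mult[OF U1 has_partials_mult[OF F \<eta>(1)]]]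
        torus_int_partial_y[OF \<delta> has_partials_mult[OF U2 has_partials_mult[OF F \<eta>(1)]]] by blast+
    moreover have "continuous_on UNIV X" "continuous_on UNIV Y"
      unfolding X_def Y_def by (intro cont)+
    moreover have "D3 = (\<lambda>z. X z + Y z)"
    proof
      fix z
      have "X z + Y z = (u1x z + u2y z) * (F z * \<eta> z) + D3 z"
        by (simp add: X_def Y_def D3_def algebra_simps)
      then show "D3 z = X z + Y z" by (simp add: div)
    qed
    ultimately show ?thesis
      using torus_int_add[of X Y \<delta>] by simp
  qed
  have cD: "continuous_on UNIV D1" "continuous_on UNIV D2" "continuous_on UNIV D3" "continuous_on UNIV Q"
    "continuous_on UNIV (\<lambda>z. (A z)\<^sup>2)" "continuous_on UNIV (\<lambda>z. (B z)\<^sup>2)" "continuous_on UNIV (\<lambda>z. (fx z)\<^sup>2)"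
    unfolding D1_def D2_def D3_def Q_def A_def B_def by (intro cont)+
  have pt: "(fx z)\<^sup>2 \<le> 32 * (A z)\<^sup>2 + 32 * (B z)\<^sup>2 + 8 * Q z + 8 * D2 z + (- 8) * D3 z + (- 4) * D1 z" for z
  proof -
    let ?c = "cos (snd z)" and ?s = "sin (snd z)"
    \<comment> \<open>Here \<open>A\<close> + \<open>B\<close> is the y-derivative of U \<cdot>
      \<nabla>F minus that of U_1 f_x. Trading one for the other, and moving U \<cdot> \<nabla> from
      F to \<eta> by \<open>D3\<close>, leaves \<open>Q\<close>.\<close>
    have "(?s * U1 z + ?c * u1y z) * (fx z)\<^sup>2 =
        2 * (?c * fx z) * (- A z - B z) + 2 * D2 z - 2 * D3 z - D1 z + 2 * Q z"
      unfolding A_def B_def D1_def D2_def D3_def Q_def \<eta>(2) by (simp add: power2_eq_square algebra_simps)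
    moreover have "1 / 2 * (fx z)\<^sup>2 \<le> (?s * U1 z + ?c * u1y z) * (fx z)\<^sup>2"
      by (intro mult_right_mono coercive) auto
    \<comment> \<open>Young's inequality, with a quarter of f_x^2 to be absorbed into the coercive
      half. Multiplying what remains by 4 gives the constants 32 and 8.\<close>
    moreover have "2 * (?c * fx z) * (- A z - B z) \<le> (fx z)\<^sup>2 / 4 + 8 * (A z)\<^sup>2 + 8 * (B z)\<^sup>2"
    proof -
      have "0 \<le> (?c * fx z / 2 + 2 * (A z + B z))\<^sup>2" "0 \<le> (A z - B z)\<^sup>2" by simp_all
      then have "2 * (?c * fx z) * (- A z - B z) \<le> (?c * fx z)\<^sup>2 / 4 + 8 * (A z)\<^sup>2 + 8 * (B z)\<^sup>2"
        by (simp add: power2_eq_square algebra_simps)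
      moreover have "(?c * fx z)\<^sup>2 \<le> (fx z)\<^sup>2"
        unfolding power_mult_distrib by (rule mult_left_le_one_le) (auto simp: abs_square_le_1)
      ultimately show ?thesis by linarith
    qed
    ultimately show ?thesis by linarith
  qed
  have "torus_int \<delta> (\<lambda>z. (fx z)\<^sup>2) \<le>
      torus_int \<delta> (\<lambda>z. 32 * (A z)\<^sup>2 + 32 * (B z)\<^sup>2 + 8 * Q z + 8 * D2 z + (- 8) * D3 z + (- 4) * D1 z)"
    by (intro torus_int_mono pt cD continuous_on_add continuous_on_mult_left)
  also have "\<dots> = 32 * torus_int \<delta> (\<lambda>z. (A z)\<^sup>2) + 32 * torus_int \<delta> (\<lambda>z. (B z)\<^sup>2) + 8 * torus_int \<delta> Q"
    by (simp only: torus_int_add torus_int_cmult cD continuous_on_add continuous_on_mult_left 1 2 3 mult_zero_right add_0_right)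
  finally show ?thesis by (simp add: Q_def)
qed

section \<open>Sobolev weights\<close>

text \<open>The Fourier multiplier of \<Delta> + 1. It will be applied to the coefficients of \<Psi>
  - cos y and still yields those of \<Omega> + \<Psi>, as cos y lies in the kernel.\<close>

definition helmholtz :: "real \<Rightarrow> (int \<times> int \<Rightarrow> complex) \<Rightarrow> int \<times> int \<Rightarrow> complex" where
  "helmholtz \<delta> c m = complex_of_real (1 - (freq_x \<delta> m)\<^sup>2 - (freq_y m)\<^sup>2) * c m"

text \<open>If \<open>c\<close> are the Fourier coefficients of a stream function, this is the density of the squared
  \<open>H\<^sup>3\<close> norm of the velocity.\<close>

definition energy_density :: "real \<Rightarrow> (int \<times> int \<Rightarrow> complex) \<Rightarrow> int \<times> int \<Rightarrow> real" where
  "energy_density \<delta> c m = weight \<delta> m ^ 3 * ((freq_x \<delta> m)\<^sup>2 + (freq_y m)\<^sup>2) * (norm (c m))\<^sup>2"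

lemma norm_helmholtz: "norm (helmholtz \<delta> c m) = \<bar>1 - (freq_x \<delta> m)\<^sup>2 - (freq_y m)\<^sup>2\<bar> * norm (c m)"
proof -
  have "helmholtz \<delta> c m = complex_of_real (1 - (freq_x \<delta> m)\<^sup>2 - (freq_y m)\<^sup>2) * c m"
    by (simp add: helmholtz_def)
  then show ?thesis
    by (simp only: norm_mult norm_of_real)
qed

lemma energy_density_nonneg: "energy_density \<delta> c m \<ge> 0"
  using weight_ge_1[of \<delta> m] by (simp add: energy_density_def)

text \<open>For the stream function \<psi> of the perturbation, the five weighted bounds place its
  first and second derivatives in H^2, hence in the uniform norm. The last four are L^2 bounds for
  \<phi>_x, \<phi>_xy, \<phi>_y, \<phi>_yy.\<close>

lemma energy_density_bounds:
  shows "(weight \<delta> m * norm (fdx \<delta> c m))\<^sup>2 \<le> energy_density \<delta> c m"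
    and "(weight \<delta> m * norm (fdy c m))\<^sup>2 \<le> energy_density \<delta> c m"
    and "(weight \<delta> m * norm (fdx \<delta> (fdx \<delta> c) m))\<^sup>2 \<le> energy_density \<delta> c m"
    and "(weight \<delta> m * norm (fdy (fdx \<delta> c) m))\<^sup>2 \<le> energy_density \<delta> c m"
    and "(weight \<delta> m * norm (fdy (fdy c) m))\<^sup>2 \<le> energy_density \<delta> c m"
    and "(norm (fdx \<delta> (helmholtz \<delta> c) m))\<^sup>2 \<le> energy_density \<delta> c m"
    and "(norm (fdy (fdx \<delta> (helmholtz \<delta> c)) m))\<^sup>2 \<le> energy_density \<delta> c m"
    and "(norm (fdy (helmholtz \<delta> c) m))\<^sup>2 \<le> energy_density \<delta> c m"
    and "(norm (fdy (fdy (helmholtz \<delta> c)) m))\<^sup>2 \<le> energy_density \<delta> c m"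
proof -
  define X where "X = (freq_x \<delta> m)\<^sup>2"
  define Y where "Y = (freq_y m)\<^sup>2"
  define n where "n = (norm (c m))\<^sup>2"
  define w where "w = weight \<delta> m"
  have w: "w = 1 + X + Y" and nn: "0 \<le> X" "0 \<le> Y" "0 \<le> n"
    by (simp_all add: w_def weight_def X_def Y_def n_def)
  have s: "energy_density \<delta> c m = w * w\<^sup>2 * (X + Y) * n"
    by (simp add: energy_density_def w_def X_def Y_def n_def power3_eq_cube power2_eq_square)
  have w1: "1 \<le> w" "X \<le> w" "Y \<le> w" using nn by (simp_all add: w)
  have H: "(1 - X - Y)\<^sup>2 \<le> w\<^sup>2"
  proof (rule power2_le_iff_abs_le[THEN iffD2])
    show "0 \<le> w" "\<bar>1 - X - Y\<bar> \<le> w" using nn unfolding w by linarith+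
  qed
  \<comment> \<open>All nine bounds compare three factors with those of the density w w^2 (X +
    Y).\<close>
  have gen: "p * q * r * n \<le> energy_density \<delta> c m" if "0 \<le> p" "p \<le> w" "0 \<le> q" "q \<le> X + Y" "0 \<le> r" "r \<le> w\<^sup>2" for p q r
  proof -
    have "p * q * r \<le> w * (X + Y) * w\<^sup>2"
      using that nn w1 by (intro mult_mono) auto
    from mult_right_mono[OF this nn(3)]
    show ?thesis by (simp add: s mult_ac)
  qed
  note sq = norm_fdx norm_fdy norm_helmholtz power_mult_distrib power2_abs X_def[symmetric] Y_def[symmetric]
    n_def[symmetric] w_def[symmetric]
  show "(weight \<delta> m * norm (fdx \<delta> c m))\<^sup>2 \<le> energy_density \<delta> c m"
    using gen[of 1 X "w\<^sup>2"] nn w1 by (simp only: sq) (simp add: mult_ac)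
  show "(weight \<delta> m * norm (fdy c m))\<^sup>2 \<le> energy_density \<delta> c m"
    using gen[of 1 Y "w\<^sup>2"] nn w1 by (simp only: sq) (simp add: mult_ac)
  show "(weight \<delta> m * norm (fdx \<delta> (fdx \<delta> c) m))\<^sup>2 \<le> energy_density \<delta> c m"
    using gen[of X X "w\<^sup>2"] nn w1 by (simp only: sq) (simp add: mult_ac)
  show "(weight \<delta> m * norm (fdy (fdx \<delta> c) m))\<^sup>2 \<le> energy_density \<delta> c m"
    using gen[of X Y "w\<^sup>2"] nn w1 by (simp only: sq) (simp add: mult_ac)
  show "(weight \<delta> m * norm (fdy (fdy c) m))\<^sup>2 \<le> energy_density \<delta> c m"
    using gen[of Y Y "w\<^sup>2"] nn w1 by (simp only: sq) (simp add: mult_ac)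
  show "(norm (fdx \<delta> (helmholtz \<delta> c) m))\<^sup>2 \<le> energy_density \<delta> c m"
    using gen[of 1 X "(1 - X - Y)\<^sup>2"] nn w1 H by (simp only: sq) (simp add: mult_ac)
  show "(norm (fdy (fdx \<delta> (helmholtz \<delta> c)) m))\<^sup>2 \<le> energy_density \<delta> c m"
    using gen[of X Y "(1 - X - Y)\<^sup>2"] nn w1 H by (simp only: sq) (simp add: mult_ac)
  show "(norm (fdy (helmholtz \<delta> c) m))\<^sup>2 \<le> energy_density \<delta> c m"
    using gen[of 1 Y "(1 - X - Y)\<^sup>2"] nn w1 H by (simp only: sq) (simp add: mult_ac)
  show "(norm (fdy (fdy (helmholtz \<delta> c)) m))\<^sup>2 \<le> energy_density \<delta> c m"
    using gen[of Y Y "(1 - X - Y)\<^sup>2"] nn w1 H by (simp only: sq) (simp add: mult_ac)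
qed

lemma dist_nat_pos:
  assumes "\<delta> > 0" "\<delta> \<notin> \<nat>"
  obtains g :: real where "g > 0" "\<And>n::int. \<bar>\<delta> - of_int n\<bar> \<ge> g"
proof -
  define g where "g = min (frac \<delta>) (1 - frac \<delta>)"
  have "\<delta> \<notin> \<int>"
    using assms by (metis Nats_altdef2 mem_Collect_eq less_imp_le)
  then have "g > 0"
    unfolding g_def using frac_gt_0_iff frac_lt_1 by auto
  moreover have "\<bar>\<delta> - of_int n\<bar> \<ge> g" for n
  proof (cases "n \<le> \<lfloor>\<delta>\<rfloor>")
    case True
    then have "of_int n \<le> (of_int \<lfloor>\<delta>\<rfloor> :: real)" by simp
    then show ?thesis unfolding g_def frac_def by linarith
  next
    case False
    then have "of_int (\<lfloor>\<delta>\<rfloor> + 1) \<le> (of_int n :: real)" by (subst of_int_le_iff) simp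
    then show ?thesis unfolding g_def frac_def by simp
  qed
  ultimately show ?thesis using that by blast
qed

text \<open>For \<open>\<delta> \<notin> \<nat>\<close> the kernel of \<open>\<Delta> + 1\<close> consists of shear flows.\<close>

lemma spectral_gap:
  assumes \<delta>: "\<delta> > 0" "\<delta> \<notin> \<nat>"
  obtains K where "K > 0" "\<And>m. fst m \<noteq> 0 \<Longrightarrow> weight \<delta> m \<le> K * \<bar>1 - (freq_x \<delta> m)\<^sup>2 - (freq_y m)\<^sup>2\<bar>"
proof -
  obtain g where g: "g > 0" "\<And>n::int. \<bar>\<delta> - of_int n\<bar> \<ge> g"
    using dist_nat_pos[OF \<delta>] by blast
  \<comment> \<open>The term 2 \<delta> / g serves the modes (k, 0), where the symbol is (\<delta> -
    n)(\<delta> + n) / \<delta>^2 with n = |k|. The term 2 \<delta>^2 serves the others, where it is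
    at most - 1 / \<delta>^2.\<close>
  define K where "K = 1 + 2 * \<delta>\<^sup>2 + 2 * \<delta> / g"
  have "K > 0" using \<delta> g by (simp add: K_def add_pos_nonneg)
  moreover have "weight \<delta> m \<le> K * \<bar>1 - (freq_x \<delta> m)\<^sup>2 - (freq_y m)\<^sup>2\<bar>" if m: "fst m \<noteq> 0" for m
  proof -
    define n where "n = real_of_int \<bar>fst m\<bar>"
    have n1: "n \<ge> 1" using m by (simp add: n_def)
    have X: "(freq_x \<delta> m)\<^sup>2 = n\<^sup>2 / \<delta>\<^sup>2"
      by (simp add: freq_x_def n_def power_divide)
    show ?thesis
    proof (cases "snd m = 0")
      case True
      define D where "D = \<bar>\<delta> - n\<bar>"
      have D: "g \<le> D" "n \<le> \<delta> + D" "0 \<le> D"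
        using g(2)[of "\<bar>fst m\<bar>"] by (simp_all add: n_def D_def)
      have "2 * \<delta> \<le> 2 * \<delta> / g * D"
        using \<delta> g(1) D by (simp add: field_simps)
      moreover have "0 \<le> 2 * \<delta>\<^sup>2 * D" using D by simp
      ultimately have "\<delta> + n \<le> K * D"
        unfolding K_def distrib_right using D by linarith
      then have "(\<delta> + n) * (\<delta> + n) \<le> K * D * (\<delta> + n)"
        using \<delta> n1 by (intro mult_right_mono) auto
      moreover have "D * (\<delta> + n) = \<bar>\<delta>\<^sup>2 - n\<^sup>2\<bar>"
        using \<delta> n1 by (simp add: D_def square_diff_square_factored power2_eq_square abs_mult)
      moreover have "\<delta>\<^sup>2 + n\<^sup>2 \<le> (\<delta> + n) * (\<delta> + n)"
        using \<delta> n1 by (simp add: power2_eq_square algebra_simps)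
      ultimately have "\<delta>\<^sup>2 + n\<^sup>2 \<le> K * \<bar>\<delta>\<^sup>2 - n\<^sup>2\<bar>" by (simp add: mult.assoc)
      then have "(\<delta>\<^sup>2 + n\<^sup>2) / \<delta>\<^sup>2 \<le> K * \<bar>\<delta>\<^sup>2 - n\<^sup>2\<bar> / \<delta>\<^sup>2"
        by (intro divide_right_mono) auto
      moreover have "\<bar>\<delta>\<^sup>2 - n\<^sup>2\<bar> / \<delta>\<^sup>2 = \<bar>1 - n\<^sup>2 / \<delta>\<^sup>2\<bar>"
      proof -
        have "1 - n\<^sup>2 / \<delta>\<^sup>2 = (\<delta>\<^sup>2 - n\<^sup>2) / \<delta>\<^sup>2"
          using \<delta> by (simp add: diff_divide_distrib)
        then show ?thesis by simp
      qed
      ultimately show ?thesis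
        using \<delta> True unfolding weight_def X times_divide_eq_right[symmetric]
        by (simp add: freq_y_def add_divide_distrib)
    next
      case False
      define t where "t = n\<^sup>2 / \<delta>\<^sup>2 + (freq_y m)\<^sup>2 - 1"
      have "1 \<le> \<bar>freq_y m\<bar>"
        using False by (simp add: freq_y_def flip: of_int_abs)
      then have "1 \<le> (freq_y m)\<^sup>2"
        using one_le_power[of "\<bar>freq_y m\<bar>" 2] by simp
      moreover have "1 / \<delta>\<^sup>2 \<le> n\<^sup>2 / \<delta>\<^sup>2"
        using n1 by (intro divide_right_mono) (auto simp: one_le_power)
      ultimately have "1 / \<delta>\<^sup>2 \<le> t" by (simp add: t_def)
      then have "2 \<le> 2 * \<delta>\<^sup>2 * t"
        using \<delta> by (simp add: field_simps)
      moreover have "t \<ge> 0"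
        using \<open>1 / \<delta>\<^sup>2 \<le> t\<close> by (meson order_trans zero_le_divide_1_iff zero_le_power2)
      then have "0 \<le> 2 * \<delta> / g * t" using \<delta> g by simp
      ultimately have "t + 2 \<le> K * t"
        unfolding K_def distrib_right by linarith
      moreover have "\<bar>1 - (freq_x \<delta> m)\<^sup>2 - (freq_y m)\<^sup>2\<bar> = t"
        using \<open>t \<ge> 0\<close> unfolding X t_def by linarith
      ultimately show ?thesis
        unfolding weight_def X by (simp add: t_def)
    qed
  qed
  ultimately show ?thesis using that by blast
qed

text \<open>Elliptic regularity: \<phi>_x in L^2 controls U_2 in H^2. The second bound keeps only
  one further x-derivative of the y-derivative of U_2, which is what the Ladyzhenskaya estimate
  consumes.\<close>

lemma gap_bounds:
  assumes gap: "\<And>m. fst m \<noteq> 0 \<Longrightarrow> weight \<delta> m \<le> K * \<bar>1 - (freq_x \<delta> m)\<^sup>2 - (freq_y m)\<^sup>2\<bar>"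
  shows "(weight \<delta> m * norm (fdx \<delta> c m))\<^sup>2 \<le> K\<^sup>2 * (norm (fdx \<delta> (helmholtz \<delta> c) m))\<^sup>2"
    and "(1 + (freq_x \<delta> m)\<^sup>2) * (norm (fdy (fdx \<delta> c) m))\<^sup>2 \<le> K\<^sup>2 * (norm (fdx \<delta> (helmholtz \<delta> c) m))\<^sup>2"
proof -
  show 1: "(weight \<delta> m * norm (fdx \<delta> c m))\<^sup>2 \<le> K\<^sup>2 * (norm (fdx \<delta> (helmholtz \<delta> c) m))\<^sup>2"
  proof (cases "fst m = 0")
    case True
    then show ?thesis by (simp add: norm_fdx freq_x_def)
  next
    case False
    have "weight \<delta> m * norm (fdx \<delta> c m) \<le> K * \<bar>1 - (freq_x \<delta> m)\<^sup>2 - (freq_y m)\<^sup>2\<bar> * norm (fdx \<delta> c m)"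
      using gap[OF False] by (rule mult_right_mono) simp
    also have "\<dots> = K * norm (fdx \<delta> (helmholtz \<delta> c) m)"
      by (simp add: norm_fdx norm_helmholtz)
    finally show ?thesis
      unfolding power_mult_distrib[symmetric] using weight_ge_1[of \<delta> m] by (intro power_mono) auto
  qed
  have "(1 + (freq_x \<delta> m)\<^sup>2) * (freq_y m)\<^sup>2 \<le> weight \<delta> m * weight \<delta> m"
    unfolding weight_def by (intro mult_mono) auto
  then have "(1 + (freq_x \<delta> m)\<^sup>2) * (freq_y m)\<^sup>2 * (norm (fdx \<delta> c m))\<^sup>2 \<le> (weight \<delta> m)\<^sup>2 * (norm (fdx \<delta> c m))\<^sup>2"
    by (intro mult_right_mono) (auto simp: power2_eq_square)
  then show "(1 + (freq_x \<delta> m)\<^sup>2) * (norm (fdy (fdx \<delta> c) m))\<^sup>2 \<le> K\<^sup>2 * (norm (fdx \<delta> (helmholtz \<delta> c) m))\<^sup>2"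
    using 1 by (simp add: norm_fdy power_mult_distrib mult.assoc)
qed

text \<open>Away from the zero mode one of the frequencies is bounded below, by 1 / \<delta> or by
  1. The mean, invisible to the gradient, is a single term.\<close>

lemma summable_norm_of_gradient:
  assumes \<delta>: "\<delta> > 0" and cx: "(\<lambda>m. norm (fdx \<delta> c m)) summable_on UNIV" and cy: "(\<lambda>m. norm (fdy c m)) summable_on UNIV"
  shows "(\<lambda>m. norm (c m)) summable_on UNIV"
proof (rule summable_on_comparison_test)
  have "(\<lambda>m. if m = 0 then norm (c 0) else 0) summable_on UNIV"
    by (rule finite_nonzero_values_imp_summable_on) (rule finite_subset[of _ "{0}"], auto)
  then show "(\<lambda>m. \<delta> * norm (fdx \<delta> c m) + norm (fdy c m) + (if m = 0 then norm (c 0) else 0)) summable_on UNIV"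
    by (intro summable_on_add summable_on_cmult_right cx cy)
  show "norm (c m) \<le> \<delta> * norm (fdx \<delta> c m) + norm (fdy c m) + (if m = 0 then norm (c 0) else 0)" for m
  proof -
    consider "fst m \<noteq> 0" | "snd m \<noteq> 0" | "m = 0" by (cases m) (auto simp: zero_prod_def)
    then show ?thesis
    proof cases
      case 1
      have "1 \<le> \<delta> * \<bar>freq_x \<delta> m\<bar>"
        using 1 \<delta> by (simp add: freq_x_def abs_div flip: of_int_abs)
      from mult_right_mono[OF this, of "norm (c m)"] have "norm (c m) \<le> \<delta> * norm (fdx \<delta> c m)"
        by (simp add: norm_fdx mult.assoc)
      then show ?thesis by (smt (verit) norm_ge_zero)
    next
      case 2
      have "1 \<le> \<bar>freq_y m\<bar>"
        using 2 by (simp add: freq_y_def flip: of_int_abs)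
      from mult_right_mono[OF this, of "norm (c m)"] have "norm (c m) \<le> norm (fdy c m)"
        by (simp add: norm_fdy)
      moreover have "0 \<le> \<delta> * norm (fdx \<delta> c m)" using \<delta> by simp
      ultimately show ?thesis by (smt (verit) norm_ge_zero)
    next
      case 3
      then show ?thesis using \<delta> by simp
    qed
  qed
qed simp

section \<open>Estimates for series and trigonometric polynomials\<close>

lemma has_partials_Re_finite:
  assumes "\<delta> > 0" "finite K"
  shows "has_partials \<delta> (\<lambda>z. Re (fseries \<delta> K c z)) (\<lambda>z. Re (fseries \<delta> K (fdx \<delta> c) z)) (\<lambda>z. Re (fseries \<delta> K (fdy c) z))"
  by (rule has_partials_bounded_linear[OF bounded_linear_Re has_partials_fseries_finite[OF assms]])

lemma has_partials_Re:
  assumes "\<delta> > 0" "(\<lambda>m. norm (c m)) summable_on UNIV"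
    "(\<lambda>m. norm (fdx \<delta> c m)) summable_on UNIV" "(\<lambda>m. norm (fdy c m)) summable_on UNIV"
  shows "has_partials \<delta> (\<lambda>z. Re (fseries \<delta> UNIV c z)) (\<lambda>z. Re (fseries \<delta> UNIV (fdx \<delta> c) z)) (\<lambda>z. Re (fseries \<delta> UNIV (fdy c) z))"
  by (rule has_partials_bounded_linear[OF bounded_linear_Re has_partials_fseries[OF assms]])

lemma Re_fseries_diff:
  assumes "finite K" "B \<subseteq> K"
  shows "Re (fseries \<delta> K c z) - Re (fseries \<delta> B c z) = Re (fseries \<delta> (K - B) c z)"
proof -
  have "finite B" using assms finite_subset by blast
  then show ?thesis
    using assms by (simp add: fseries_finite sum_diff)
qed

text \<open>The set \<open>J\<close> will be the whole lattice for global bounds and the complement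
  of a box for tails.\<close>

lemma torus_int_Re_fseries_square_le_infsum:
  assumes \<delta>: "\<delta> > 0" and K: "finite K" "K \<subseteq> J" and s: "s summable_on J" "\<And>m. (norm (c m))\<^sup>2 \<le> s m"
  shows "torus_int \<delta> (\<lambda>z. (Re (fseries \<delta> K c z))\<^sup>2) \<le> 4 * pi\<^sup>2 * \<delta> * infsum s J"
proof -
  have s0: "s m \<ge> 0" for m using s(2)[of m] by (meson order_trans zero_le_power2)
  have "(\<Sum>m\<in>K. (norm (c m))\<^sup>2) \<le> sum s K"
    by (intro sum_mono s)
  also have "\<dots> \<le> infsum s J"
    using s0 by (intro finite_sum_le_infsum K s(1)) auto
  finally have "4 * pi\<^sup>2 * \<delta> * (\<Sum>m\<in>K. (norm (c m))\<^sup>2) \<le> 4 * pi\<^sup>2 * \<delta> * infsum s J"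
    using \<delta> by (intro mult_left_mono) auto
  then show ?thesis
    using torus_int_Re_fseries_square_le[OF \<delta> K(1), of c] by linarith
qed

text \<open>Embedding of H^2 into bounded functions. The majorant \<open>s\<close> is left open,
  since both the energy density and a multiple of |\<phi>_x|^2 are used.\<close>

lemma Re_fseries_square_le:
  assumes \<delta>: "\<delta> > 0" and s: "s summable_on UNIV" "\<And>m. (weight \<delta> m * norm (c m))\<^sup>2 \<le> s m"
  shows "(\<lambda>m. norm (c m)) summable_on UNIV"
    and "(Re (fseries \<delta> UNIV c z))\<^sup>2 \<le> weight_const \<delta> * infsum s UNIV"
proof -
  have w: "(\<lambda>m. (weight \<delta> m * norm (c m))\<^sup>2) summable_on UNIV"
    by (rule summable_on_comparison_test[OF s(1)]) (use s(2) in auto)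
  note c = summable_norm_weighted[OF \<delta> w]
  show "(\<lambda>m. norm (c m)) summable_on UNIV" by (rule c(1))
  have "\<bar>Re (fseries \<delta> UNIV c z)\<bar> \<le> (\<Sum>\<^sub>\<infinity>m. norm (c m))"
    using norm_fseries_le[OF c(1)] abs_Re_le_cmod order_trans by blast
  then have "(Re (fseries \<delta> UNIV c z))\<^sup>2 \<le> (\<Sum>\<^sub>\<infinity>m. norm (c m))\<^sup>2"
    by (metis abs_ge_zero power2_abs power_mono)
  also have "\<dots> \<le> weight_const \<delta> * (\<Sum>\<^sub>\<infinity>m. (weight \<delta> m * norm (c m))\<^sup>2)"
    by (rule c(2))
  also have "\<dots> \<le> weight_const \<delta> * infsum s UNIV"
  proof (intro mult_left_mono infsum_mono w s)
    show "0 \<le> weight_const \<delta>"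
      unfolding weight_const_def by (rule infsum_nonneg) simp
  qed
  finally show "(Re (fseries \<delta> UNIV c z))\<^sup>2 \<le> weight_const \<delta> * infsum s UNIV" .
qed

text \<open>Serves the commutator \<open>A\<close>, with velocities and derivatives as coefficients.
  The constant is 4 for a square of four summands, 4 for the squared coefficients, and 4
  terms.\<close>

lemma torus_int_combination_square_le:
  fixes a1 a2 a3 a4 f1 f2 f3 f4 :: "real \<times> real \<Rightarrow> real"
  assumes c: "continuous_on UNIV a1" "continuous_on UNIV a2" "continuous_on UNIV a3" "continuous_on UNIV a4"
    "continuous_on UNIV f1" "continuous_on UNIV f2" "continuous_on UNIV f3" "continuous_on UNIV f4"
    and a: "\<And>z. \<bar>a1 z\<bar> \<le> 2" "\<And>z. \<bar>a2 z\<bar> \<le> 2" "\<And>z. \<bar>a3 z\<bar> \<le> 2" "\<And>z. \<bar>a4 z\<bar> \<le> 2"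
    and f: "torus_int \<delta> (\<lambda>z. (f1 z)\<^sup>2) \<le> b" "torus_int \<delta> (\<lambda>z. (f2 z)\<^sup>2) \<le> b"
      "torus_int \<delta> (\<lambda>z. (f3 z)\<^sup>2) \<le> b" "torus_int \<delta> (\<lambda>z. (f4 z)\<^sup>2) \<le> b"
  shows "torus_int \<delta> (\<lambda>z. (a1 z * f1 z + a2 z * f2 z + a3 z * f3 z + a4 z * f4 z)\<^sup>2) \<le> 64 * b"
proof -
  have four: "(p + q + r + s)\<^sup>2 \<le> 4 * (p\<^sup>2 + q\<^sup>2 + r\<^sup>2 + s\<^sup>2)" for p q r s :: real
  proof -
    have "0 \<le> (p - q)\<^sup>2 + (p - r)\<^sup>2 + (p - s)\<^sup>2 + (q - r)\<^sup>2 + (q - s)\<^sup>2 + (r - s)\<^sup>2" by simp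
    then show ?thesis by (simp add: power2_eq_square algebra_simps)
  qed
  have two: "(u * v)\<^sup>2 \<le> 4 * v\<^sup>2" if "\<bar>u\<bar> \<le> 2" for u v :: real
  proof -
    have "u\<^sup>2 \<le> 2\<^sup>2" using that power_mono[of "\<bar>u\<bar>" 2 2] by simp
    then show ?thesis unfolding power_mult_distrib by (intro mult_right_mono) auto
  qed
  have "torus_int \<delta> (\<lambda>z. (a1 z * f1 z + a2 z * f2 z + a3 z * f3 z + a4 z * f4 z)\<^sup>2)
      \<le> torus_int \<delta> (\<lambda>z. 16 * ((f1 z)\<^sup>2 + (f2 z)\<^sup>2 + (f3 z)\<^sup>2 + (f4 z)\<^sup>2))"
  proof (intro torus_int_mono continuous_on_mult_left continuous_on_power continuous_on_add continuous_on_mult c)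
    fix z
    show "(a1 z * f1 z + a2 z * f2 z + a3 z * f3 z + a4 z * f4 z)\<^sup>2 \<le> 16 * ((f1 z)\<^sup>2 + (f2 z)\<^sup>2 + (f3 z)\<^sup>2 + (f4 z)\<^sup>2)"
      using four[of "a1 z * f1 z" "a2 z * f2 z" "a3 z * f3 z" "a4 z * f4 z"]
        two[OF a(1)[of z], of "f1 z"] two[OF a(2)[of z], of "f2 z"] two[OF a(3)[of z], of "f3 z"] two[OF a(4)[of z], of "f4 z"]
      by argo
  qed
  also have "\<dots> = 16 * (torus_int \<delta> (\<lambda>z. (f1 z)\<^sup>2) + torus_int \<delta> (\<lambda>z. (f2 z)\<^sup>2)
      + torus_int \<delta> (\<lambda>z. (f3 z)\<^sup>2) + torus_int \<delta> (\<lambda>z. (f4 z)\<^sup>2))"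
    by (simp only: torus_int_cmult torus_int_add continuous_on_power continuous_on_add c)
  also have "\<dots> \<le> 16 * (b + b + b + b)"
    by (intro mult_left_mono add_mono f) simp
  finally show ?thesis by simp
qed

definition ladyzhenskaya_const :: "real \<Rightarrow> real" where
  "ladyzhenskaya_const \<delta> = (1 + 1 / (2 * pi * \<delta>)) * (1 + 1 / (2 * pi))"

text \<open>\<open>torus_int_mult_square_le\<close> asks for C^1 functions, which the series need
  not be, so it is applied to truncations. Splitting u^2 \<le> 2 p^2 + 2 (u - p)^2 costs the factor
  2, and the remainder is uniformly small. Only an x-derivative of the series and a y-derivative of
  g are spent.\<close>

lemma torus_int_fseries_mult_square_le:
  assumes \<delta>: "\<delta> > 0" and c: "(\<lambda>m. norm (c m)) summable_on UNIV"
    and S: "\<And>K. finite K \<Longrightarrow> (\<Sum>m\<in>K. (1 + (freq_x \<delta> m)\<^sup>2) * (norm (c m))\<^sup>2) \<le> S"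
    and g: "has_partials \<delta> g gx gy" and G: "torus_int \<delta> (\<lambda>z. (g z)\<^sup>2 + (gy z)\<^sup>2) \<le> G"
  shows "torus_int \<delta> (\<lambda>z. (Re (fseries \<delta> UNIV c z))\<^sup>2 * (g z)\<^sup>2)
    \<le> 2 * ladyzhenskaya_const \<delta> * (4 * pi\<^sup>2 * \<delta> * S) * G"
proof -
  define u where "u = (\<lambda>z. Re (fseries \<delta> UNIV c z))"
  define p where "p = (\<lambda>N z. Re (fseries \<delta> (freq_box N) c z))"
  define px where "px = (\<lambda>N z. Re (fseries \<delta> (freq_box N) (fdx \<delta> c) z))"
  define \<tau> where "\<tau> = (\<lambda>N. \<Sum>\<^sub>\<infinity>m\<in>-freq_box N. norm (c m))"
  have pP: "has_partials \<delta> (p N) (px N) (\<lambda>z. Re (fseries \<delta> (freq_box N) (fdy c) z))" for N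
    unfolding p_def px_def by (rule has_partials_Re_finite[OF \<delta> finite_freq_box])
  have cont: "continuous_on UNIV (\<lambda>z. (u z)\<^sup>2 * (g z)\<^sup>2)" "continuous_on UNIV (\<lambda>z. (p N z)\<^sup>2 * (g z)\<^sup>2)"
      "continuous_on UNIV (\<lambda>z. (g z)\<^sup>2)" "continuous_on UNIV (\<lambda>z. (p N z)\<^sup>2)" "continuous_on UNIV (\<lambda>z. (px N z)\<^sup>2)" for N
    unfolding u_def using has_partials_continuous[OF g] has_partials_continuous[OF pP] has_partialsD(2)[OF pP]
    by (intro continuous_intros continuous_fseries c; blast)+
  have L0: "ladyzhenskaya_const \<delta> \<ge> 0"
    using \<delta> by (simp add: ladyzhenskaya_const_def)
  have G0: "0 \<le> torus_int \<delta> (\<lambda>z. (g z)\<^sup>2 + (gy z)\<^sup>2)"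
    by (intro torus_int_nonneg continuous_intros has_partials_continuous[OF g] has_partialsD(3)[OF g]) simp
  have bound: "torus_int \<delta> (\<lambda>z. (u z)\<^sup>2 * (g z)\<^sup>2) \<le>
      2 * ladyzhenskaya_const \<delta> * (4 * pi\<^sup>2 * \<delta> * S) * G + 2 * (\<tau> N)\<^sup>2 * torus_int \<delta> (\<lambda>z. (g z)\<^sup>2)" for N
  proof -
    have "torus_int \<delta> (\<lambda>z. (u z)\<^sup>2 * (g z)\<^sup>2) \<le> torus_int \<delta> (\<lambda>z. 2 * ((p N z)\<^sup>2 * (g z)\<^sup>2) + 2 * (\<tau> N)\<^sup>2 * (g z)\<^sup>2)"
    proof (intro torus_int_mono continuous_on_add continuous_on_mult_left cont)
      fix z
      have "\<bar>u z - p N z\<bar> \<le> \<tau> N"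
        using norm_fseries_tail[OF c, of \<delta> z "freq_box N"] abs_Re_le_cmod[of "fseries \<delta> UNIV c z - fseries \<delta> (freq_box N) c z"]
        unfolding u_def p_def \<tau>_def by simp
      then have "(u z - p N z)\<^sup>2 \<le> (\<tau> N)\<^sup>2"
        by (metis abs_ge_zero power2_abs power_mono)
      moreover have "(u z)\<^sup>2 \<le> 2 * (p N z)\<^sup>2 + 2 * (u z - p N z)\<^sup>2"
      proof -
        have "0 \<le> (u z - 2 * p N z)\<^sup>2" by simp
        then show ?thesis by (simp add: power2_eq_square algebra_simps)
      qed
      ultimately have "(u z)\<^sup>2 \<le> 2 * (p N z)\<^sup>2 + 2 * (\<tau> N)\<^sup>2" by linarith
      from mult_right_mono[OF this, of "(g z)\<^sup>2"]
      show "(u z)\<^sup>2 * (g z)\<^sup>2 \<le> 2 * ((p N z)\<^sup>2 * (g z)\<^sup>2) + 2 * (\<tau> N)\<^sup>2 * (g z)\<^sup>2"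
        by (simp add: algebra_simps)
    qed
    also have "\<dots> = 2 * torus_int \<delta> (\<lambda>z. (p N z)\<^sup>2 * (g z)\<^sup>2) + 2 * (\<tau> N)\<^sup>2 * torus_int \<delta> (\<lambda>z. (g z)\<^sup>2)"
      by (simp only: torus_int_add torus_int_cmult continuous_on_mult_left cont)
    also have "torus_int \<delta> (\<lambda>z. (p N z)\<^sup>2 * (g z)\<^sup>2) \<le> ladyzhenskaya_const \<delta> * ((4 * pi\<^sup>2 * \<delta> * S) * G)"
    proof -
      have "torus_int \<delta> (\<lambda>z. (p N z)\<^sup>2 + (px N z)\<^sup>2) \<le> 4 * pi\<^sup>2 * \<delta> * S"
      proof -
        have "torus_int \<delta> (\<lambda>z. (p N z)\<^sup>2 + (px N z)\<^sup>2) = torus_int \<delta> (\<lambda>z. (p N z)\<^sup>2) + torus_int \<delta> (\<lambda>z. (px N z)\<^sup>2)"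
          by (intro torus_int_add cont)
        also have "\<dots> \<le> 4 * pi\<^sup>2 * \<delta> * (\<Sum>m\<in>freq_box N. (norm (c m))\<^sup>2) + 4 * pi\<^sup>2 * \<delta> * (\<Sum>m\<in>freq_box N. (norm (fdx \<delta> c m))\<^sup>2)"
          unfolding p_def px_def by (intro add_mono torus_int_Re_fseries_square_le \<delta> finite_freq_box)
        also have "\<dots> = 4 * pi\<^sup>2 * \<delta> * (\<Sum>m\<in>freq_box N. (1 + (freq_x \<delta> m)\<^sup>2) * (norm (c m))\<^sup>2)"
          by (simp add: norm_fdx power_mult_distrib distrib_right sum.distrib distrib_left)
        also have "\<dots> \<le> 4 * pi\<^sup>2 * \<delta> * S"
          using \<delta> by (intro mult_left_mono S) auto
        finally show ?thesis .
      qed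
      moreover have "0 \<le> torus_int \<delta> (\<lambda>z. (p N z)\<^sup>2 + (px N z)\<^sup>2)"
        by (intro torus_int_nonneg continuous_on_add cont) simp
      ultimately have "torus_int \<delta> (\<lambda>z. (p N z)\<^sup>2 + (px N z)\<^sup>2) * torus_int \<delta> (\<lambda>z. (g z)\<^sup>2 + (gy z)\<^sup>2) \<le> (4 * pi\<^sup>2 * \<delta> * S) * G"
        using G G0 by (intro mult_mono order_trans[OF _ \<open>_ \<le> 4 * pi\<^sup>2 * \<delta> * S\<close>]) auto
      then have "ladyzhenskaya_const \<delta> * (torus_int \<delta> (\<lambda>z. (p N z)\<^sup>2 + (px N z)\<^sup>2) * torus_int \<delta> (\<lambda>z. (g z)\<^sup>2 + (gy z)\<^sup>2))
          \<le> ladyzhenskaya_const \<delta> * ((4 * pi\<^sup>2 * \<delta> * S) * G)"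
        using L0 by (rule mult_left_mono)
      then show ?thesis
        using torus_int_mult_square_le[OF \<delta> pP[of N] g] unfolding ladyzhenskaya_const_def by linarith
    qed
    finally show ?thesis by (simp add: mult_ac)
  qed
  have "\<tau> \<longlonglongrightarrow> 0"
    unfolding \<tau>_def by (rule infsum_box_compl_tendsto[OF c])
  then have "(\<lambda>N. 2 * ladyzhenskaya_const \<delta> * (4 * pi\<^sup>2 * \<delta> * S) * G + 2 * (\<tau> N)\<^sup>2 * torus_int \<delta> (\<lambda>z. (g z)\<^sup>2)) \<longlonglongrightarrow>
      2 * ladyzhenskaya_const \<delta> * (4 * pi\<^sup>2 * \<delta> * S) * G + 2 * 0\<^sup>2 * torus_int \<delta> (\<lambda>z. (g z)\<^sup>2)"
    by (intro tendsto_intros)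
  then have "torus_int \<delta> (\<lambda>z. (u z)\<^sup>2 * (g z)\<^sup>2) \<le>
      2 * ladyzhenskaya_const \<delta> * (4 * pi\<^sup>2 * \<delta> * S) * G + 2 * 0\<^sup>2 * torus_int \<delta> (\<lambda>z. (g z)\<^sup>2)"
    by (rule LIMSEQ_le_const) (use bound in blast)
  then show ?thesis by (simp add: u_def)
qed

text \<open>With c the coefficients of f_x, this is \<eta> from the energy inequality. Its two first
  derivatives are differentiated with one common mixed derivative, as \<open>weak_transport\<close>
  demands.\<close>

lemma test_function:
  assumes \<delta>: "\<delta> > 0" and K: "finite K"
  obtains \<eta>x \<eta>y \<eta>xx \<eta>xy \<eta>yy where
    "has_partials \<delta> (\<lambda>z. cos (snd z) * Re (fseries \<delta> K (fdy c) z) - sin (snd z) * Re (fseries \<delta> K c z)) \<eta>x \<eta>y"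
    "has_partials \<delta> \<eta>x \<eta>xx \<eta>xy" "has_partials \<delta> \<eta>y \<eta>xy \<eta>yy"
proof -
  note T = has_partials_Re_finite[OF \<delta> K]
  have C: "has_partials \<delta> (\<lambda>z. cos (snd z)) (\<lambda>z. 0) (\<lambda>z. - sin (snd z))"
    and S: "has_partials \<delta> (\<lambda>z. - sin (snd z)) (\<lambda>z. 0) (\<lambda>z. - cos (snd z))"
    by (rule has_partials_fun_y; auto intro!: derivative_eq_intros continuous_intros)+
  let ?t = "\<lambda>c z. Re (fseries \<delta> K c z)"
  have 1: "has_partials \<delta> (\<lambda>z. cos (snd z) * ?t (fdy c) z - sin (snd z) * ?t c z)
    (\<lambda>z. cos (snd z) * ?t (fdy (fdx \<delta> c)) z + - sin (snd z) * ?t (fdx \<delta> c) z)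
    (\<lambda>z. cos (snd z) * ?t (fdy (fdy c)) z + (2 * (- sin (snd z) * ?t (fdy c) z) + (- 1) * (cos (snd z) * ?t c z)))"
    by (rule has_partials_cong[OF has_partials_add[OF has_partials_mult[OF C T[of "fdy c"]] has_partials_mult[OF S T[of c]]]])
      (auto simp: fdx_fdy algebra_simps)
  have 2: "has_partials \<delta> (\<lambda>z. cos (snd z) * ?t (fdy (fdx \<delta> c)) z + - sin (snd z) * ?t (fdx \<delta> c) z)
    (\<lambda>z. cos (snd z) * ?t (fdx \<delta> (fdy (fdx \<delta> c))) z + - sin (snd z) * ?t (fdx \<delta> (fdx \<delta> c)) z)
    (\<lambda>z. cos (snd z) * ?t (fdy (fdy (fdx \<delta> c))) z - 2 * sin (snd z) * ?t (fdy (fdx \<delta> c)) z - cos (snd z) * ?t (fdx \<delta> c) z)"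
    by (rule has_partials_cong[OF has_partials_add[OF has_partials_mult[OF C T[of "fdy (fdx \<delta> c)"]] has_partials_mult[OF S T[of "fdx \<delta> c"]]]])
      (auto simp: algebra_simps)
  have 3: "has_partials \<delta> (\<lambda>z. cos (snd z) * ?t (fdy (fdy c)) z + (2 * (- sin (snd z) * ?t (fdy c) z) + (- 1) * (cos (snd z) * ?t c z)))
    (\<lambda>z. cos (snd z) * ?t (fdy (fdy (fdx \<delta> c))) z - 2 * sin (snd z) * ?t (fdy (fdx \<delta> c)) z - cos (snd z) * ?t (fdx \<delta> c) z)
    (\<lambda>z. (- sin (snd z) * ?t (fdy (fdy c)) z + cos (snd z) * ?t (fdy (fdy (fdy c))) z)
      + (2 * (- cos (snd z) * ?t (fdy c) z + - sin (snd z) * ?t (fdy (fdy c)) z)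
      + (- 1) * (- sin (snd z) * ?t c z + cos (snd z) * ?t (fdy c) z)))"
    by (rule has_partials_cong[OF has_partials_add[OF has_partials_mult[OF C T[of "fdy (fdy c)"]]
        has_partials_add[OF has_partials_bounded_linear[OF bounded_linear_mult_right[of 2] has_partials_mult[OF S T[of "fdy c"]]]
          has_partials_bounded_linear[OF bounded_linear_mult_right[of "- 1"] has_partials_mult[OF C T[of c]]]]]])
      (auto simp: fdx_fdy algebra_simps)
  show ?thesis by (rule that[OF 1 2 3])
qed

section \<open>Rigidity\<close>

lemma torus_int_abs_le:
  fixes f g :: "real \<times> real \<Rightarrow> real"
  assumes "continuous_on UNIV f" "continuous_on UNIV g" "\<And>z. \<bar>f z\<bar> \<le> g z"
  shows "\<bar>torus_int \<delta> f\<bar> \<le> torus_int \<delta> g"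
proof -
  have "norm (integral (torus_cell \<delta>) f) \<le> integral (torus_cell \<delta>) g"
    using assms(3) by (intro integral_norm_bound_integral torus_integrable assms) simp
  then show ?thesis by (simp add: torus_int_def)
qed

lemma fseries_add:
  assumes "(\<lambda>m. norm (a m)) summable_on UNIV" "(\<lambda>m. norm (b m)) summable_on UNIV"
  shows "fseries \<delta> UNIV (\<lambda>m. a m + b m) z = fseries \<delta> UNIV a z + fseries \<delta> UNIV b z"
  unfolding fseries_def distrib_right by (intro infsum_add fseries_summable assms)

text \<open>The 32 is that of \<open>energy_inequality\<close>, and K that of the spectral gap. The
  bracket adds the two halves of the y-derivative of U_2 \<phi>_y: the Ladyzhenskaya product and the
  uniform bound on U_2.\<close>

definition rigidity_const :: "real \<Rightarrow> real \<Rightarrow> real" where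
  "rigidity_const \<delta> K = 32 * K\<^sup>2 * (8 * ladyzhenskaya_const \<delta> * (4 * pi\<^sup>2 * \<delta>) + 2 * weight_const \<delta>)"

context
  fixes \<delta> K :: real and U :: "real \<times> real \<Rightarrow> real \<times> real" and \<Psi> :: "real \<times> real \<Rightarrow> real"
    and c :: "int \<times> int \<Rightarrow> complex"
  assumes \<delta>: "\<delta> > 0"
    and gap: "\<And>m. fst m \<noteq> 0 \<Longrightarrow> weight \<delta> m \<le> K * \<bar>1 - (freq_x \<delta> m)\<^sup>2 - (freq_y m)\<^sup>2\<bar>"
    and sol: "stationary_euler \<delta> U"
    and summable: "energy_density \<delta> c summable_on UNIV"
    and real: "\<And>m. c (- m) = cnj (c m)"
    and U1: "\<And>z. fst (U z) = sin (snd z) - Re (fseries \<delta> UNIV (fdy c) z)"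
    and U2: "\<And>z. snd (U z) = Re (fseries \<delta> UNIV (fdx \<delta> c) z)"
    and \<Psi>: "\<And>z. \<Psi> z = cos (snd z) + Re (fseries \<delta> UNIV c z)"
    and small: "weight_const \<delta> * infsum (energy_density \<delta> c) UNIV \<le> 1 / 16"
begin

private abbreviation (input) "full a z \<equiv> Re (fseries \<delta> UNIV a z)"
private abbreviation (input) "E \<equiv> infsum (energy_density \<delta> c) UNIV"
private abbreviation (input) "area \<equiv> 4 * pi\<^sup>2 * \<delta>"
private abbreviation (input) "d \<equiv> helmholtz \<delta> c"

private lemma summable_norms:
  "(\<lambda>m. norm (fdx \<delta> c m)) summable_on UNIV" "(\<lambda>m. norm (fdy c m)) summable_on UNIV"
  "(\<lambda>m. norm (fdx \<delta> (fdx \<delta> c) m)) summable_on UNIV" "(\<lambda>m. norm (fdy (fdx \<delta> c) m)) summable_on UNIV"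
  "(\<lambda>m. norm (fdy (fdy c) m)) summable_on UNIV" "(\<lambda>m. norm (c m)) summable_on UNIV"
  "(\<lambda>m. norm (d m)) summable_on UNIV"
proof -
  show *: "(\<lambda>m. norm (fdx \<delta> c m)) summable_on UNIV" "(\<lambda>m. norm (fdy c m)) summable_on UNIV"
    "(\<lambda>m. norm (fdx \<delta> (fdx \<delta> c) m)) summable_on UNIV" "(\<lambda>m. norm (fdy (fdx \<delta> c) m)) summable_on UNIV"
    "(\<lambda>m. norm (fdy (fdy c) m)) summable_on UNIV"
    by (rule Re_fseries_square_le(1)[OF \<delta> summable], rule energy_density_bounds)+
  show **: "(\<lambda>m. norm (c m)) summable_on UNIV"
    by (rule summable_norm_of_gradient[OF \<delta> *(1,2)])
  show "(\<lambda>m. norm (d m)) summable_on UNIV"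
  proof (rule summable_on_comparison_test)
    show "(\<lambda>m. norm (c m) + norm (fdx \<delta> (fdx \<delta> c) m) + norm (fdy (fdy c) m)) summable_on UNIV"
      by (intro summable_on_add * **)
    show "norm (d m) \<le> norm (c m) + norm (fdx \<delta> (fdx \<delta> c) m) + norm (fdy (fdy c) m)" for m
    proof -
      have "\<bar>1 - (freq_x \<delta> m)\<^sup>2 - (freq_y m)\<^sup>2\<bar> \<le> 1 + (freq_x \<delta> m)\<^sup>2 + (freq_y m)\<^sup>2"
        using zero_le_power2[of "freq_x \<delta> m"] zero_le_power2[of "freq_y m"] by linarith
      from mult_right_mono[OF this, of "norm (c m)"] show ?thesis
        by (simp add: norm_helmholtz norm_fdx norm_fdy power2_eq_square algebra_simps flip: abs_mult)
    qed
  qed simp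
qed

text \<open>The smallness threshold 1/16 is (1/4)^2: two perturbations of size 1/4 leave the
  coercive weight at least 1 - 1/4 - 1/4 = 1/2.\<close>

private lemma full_le:
  "\<bar>full (fdx \<delta> c) z\<bar> \<le> 1 / 4" "\<bar>full (fdy c) z\<bar> \<le> 1 / 4"
  "\<bar>full (fdy (fdx \<delta> c)) z\<bar> \<le> 1 / 4" "\<bar>full (fdy (fdy c)) z\<bar> \<le> 1 / 4"
proof -
  have *: "\<bar>full a z\<bar> \<le> 1 / 4" if "\<And>m. (weight \<delta> m * norm (a m))\<^sup>2 \<le> energy_density \<delta> c m" for a
  proof (rule power2_le_iff_abs_le[THEN iffD1])
    show "(full a z)\<^sup>2 \<le> (1 / 4)\<^sup>2"
      using Re_fseries_square_le(2)[OF \<delta> summable that, of z] small by (simp add: power2_eq_square)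
  qed simp
  show "\<bar>full (fdx \<delta> c) z\<bar> \<le> 1 / 4" "\<bar>full (fdy c) z\<bar> \<le> 1 / 4"
    "\<bar>full (fdy (fdx \<delta> c)) z\<bar> \<le> 1 / 4" "\<bar>full (fdy (fdy c)) z\<bar> \<le> 1 / 4"
    by (rule *, rule energy_density_bounds)+
qed

private lemma has_partials_U1:
  "has_partials \<delta> (\<lambda>z. fst (U z)) (\<lambda>z. - full (fdy (fdx \<delta> c)) z) (\<lambda>z. cos (snd z) - full (fdy (fdy c)) z)"
proof -
  have S: "has_partials \<delta> (\<lambda>z. sin (snd z)) (\<lambda>z. 0) (\<lambda>z. cos (snd z))"
    by (rule has_partials_fun_y) (auto intro!: derivative_eq_intros continuous_intros)
  have "has_partials \<delta> (full (fdy c)) (full (fdx \<delta> (fdy c))) (full (fdy (fdy c)))"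
    by (rule has_partials_Re) (use \<delta> summable_norms in \<open>simp_all add: fdx_fdy\<close>)
  from has_partials_add[OF S has_partials_bounded_linear[OF bounded_linear_mult_right[of "- 1"] this]]
  show ?thesis by (rule has_partials_cong) (simp_all add: U1 fdx_fdy)
qed

private lemma has_partials_U2:
  "has_partials \<delta> (\<lambda>z. snd (U z)) (full (fdx \<delta> (fdx \<delta> c))) (full (fdy (fdx \<delta> c)))"
  unfolding U2 by (rule has_partials_Re) (use \<delta> summable_norms in simp_all)

private lemma has_partials_\<Psi>: "has_partials \<delta> \<Psi> (\<lambda>z. snd (U z)) (\<lambda>z. - fst (U z))"
proof -
  have C: "has_partials \<delta> (\<lambda>z. cos (snd z)) (\<lambda>z. 0) (\<lambda>z. - sin (snd z))"
    by (rule has_partials_fun_y) (auto intro!: derivative_eq_intros continuous_intros)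
  have "has_partials \<delta> (full c) (full (fdx \<delta> c)) (full (fdy c))"
    by (rule has_partials_Re) (use \<delta> summable_norms in simp_all)
  from has_partials_add[OF C this] show ?thesis
    by (rule has_partials_cong) (simp_all add: \<Psi> U1 U2)
qed

text \<open>The Kolmogorov parts - cos y of the vorticity and cos y of the stream function cancel,
  so \<phi> is linear in the perturbation.\<close>

private lemma vorticity_plus_stream:
  "full (fdx \<delta> (fdx \<delta> c)) z - (cos (snd z) - full (fdy (fdy c)) z) + \<Psi> z = full d z"
proof -
  have "d m = c m + (fdx \<delta> (fdx \<delta> c) m + fdy (fdy c) m)" for m
    by (simp add: helmholtz_def fdx_def fdy_def complex_eq_iff power2_eq_square algebra_simps)
  then have "d = (\<lambda>m. c m + (fdx \<delta> (fdx \<delta> c) m + fdy (fdy c) m))"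
    by (rule ext)
  moreover have "(\<lambda>m. norm (fdx \<delta> (fdx \<delta> c) m + fdy (fdy c) m)) summable_on UNIV"
    by (rule summable_on_comparison_test[OF summable_on_add[OF summable_norms(3,5)]])
      (auto intro: norm_triangle_ineq)
  ultimately show ?thesis
    by (simp add: \<Psi> fseries_add summable_norms)
qed

text \<open>The tail comes from the commutator of the two truncations; the other term, from
  differentiating U_2 \<phi>_y, carries both \<open>R\<close> and the small energy.\<close>

private lemma truncated_estimate:
  fixes N :: nat
  defines "R \<equiv> \<Sum>\<^sub>\<infinity>m. (norm (fdx \<delta> d m))\<^sup>2"
  shows "area * (\<Sum>m\<in>freq_box N. (norm (fdx \<delta> d m))\<^sup>2) \<le>
    32 * (64 * (area * infsum (energy_density \<delta> c) (- freq_box N))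
      + area * K\<^sup>2 * R * E * (8 * ladyzhenskaya_const \<delta> * area + 2 * weight_const \<delta>))"
proof -
  define T where "T = (\<lambda>N a z. Re (fseries \<delta> (freq_box N) a z))"
  have TP: "has_partials \<delta> (T M a) (T M (fdx \<delta> a)) (T M (fdy a))" for M a
    unfolding T_def by (rule has_partials_Re_finite[OF \<delta> finite_freq_box])
  have cT: "continuous_on UNIV (T M a)" for M a
    by (rule has_partials_continuous[OF TP])
  have area: "0 < area" using \<delta> by simp
  have sumR: "(\<lambda>m. (norm (fdx \<delta> d m))\<^sup>2) summable_on UNIV"
    by (rule summable_on_comparison_test[OF summable energy_density_bounds(6)]) simp
  have R0: "0 \<le> R" unfolding R_def by (rule infsum_nonneg) simp
  have KR: "K\<^sup>2 * R = (\<Sum>\<^sub>\<infinity>m. K\<^sup>2 * (norm (fdx \<delta> d m))\<^sup>2)"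
    unfolding R_def by (rule infsum_cmult_right'[symmetric])
  have sumKR: "(\<lambda>m. K\<^sup>2 * (norm (fdx \<delta> d m))\<^sup>2) summable_on UNIV"
    by (rule summable_on_cmult_right[OF sumR])
  \<comment> \<open>The bound is by \<open>R\<close>, not merely by the energy: this factor is what
    permits absorption at the end.\<close>
  have U2_le: "(snd (U z))\<^sup>2 \<le> weight_const \<delta> * (K\<^sup>2 * R)" for z
    unfolding U2 KR by (rule Re_fseries_square_le(2)[OF \<delta> sumKR gap_bounds(1)[OF gap]])
  have T_le: "torus_int \<delta> (\<lambda>z. (T M a z)\<^sup>2) \<le> area * E"
    if "\<And>m. (norm (a m))\<^sup>2 \<le> energy_density \<delta> c m" for M a
    unfolding T_def by (rule torus_int_Re_fseries_square_le_infsum[OF \<delta> finite_freq_box _ summable that]) simp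
  note cU = has_partials_continuous[OF has_partials_U1] has_partials_continuous[OF has_partials_U2]
    has_partialsD(3)[OF has_partials_U1] has_partialsD(3)[OF has_partials_U2]
  define fy where "fy = T N (fdy d)"
  define fyy where "fyy = T N (fdy (fdy d))"
  have fy: "has_partials \<delta> fy (T N (fdy (fdx \<delta> d))) fyy"
    unfolding fy_def fyy_def using TP[of N "fdy d"] by (simp add: fdx_fdy)
  define B where "B = (\<lambda>z. full (fdy (fdx \<delta> c)) z * fy z + snd (U z) * fyy z)"
  have cfy: "continuous_on UNIV fy" "continuous_on UNIV fyy"
    unfolding fy_def fyy_def by (rule cT)+
  have B_le: "torus_int \<delta> (\<lambda>z. (B z)\<^sup>2) \<le> area * K\<^sup>2 * R * E * (8 * ladyzhenskaya_const \<delta> * area + 2 * weight_const \<delta>)"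
  proof -
    have "torus_int \<delta> (\<lambda>z. (B z)\<^sup>2) \<le> torus_int \<delta> (\<lambda>z. 2 * ((full (fdy (fdx \<delta> c)) z)\<^sup>2 * (fy z)\<^sup>2)
        + 2 * (weight_const \<delta> * (K\<^sup>2 * R)) * (fyy z)\<^sup>2)"
      unfolding B_def
    proof (intro torus_int_mono continuous_on_add continuous_on_mult_left continuous_on_power continuous_on_mult cU cfy)
      fix z
      have "(p + q)\<^sup>2 \<le> 2 * p\<^sup>2 + 2 * q\<^sup>2" for p q :: real
      proof -
        have "0 \<le> (p - q)\<^sup>2" by simp
        then show ?thesis by (simp add: power2_eq_square algebra_simps)
      qed
      from this[of "full (fdy (fdx \<delta> c)) z * fy z" "snd (U z) * fyy z"]
        mult_right_mono[OF U2_le[of z], of "(fyy z)\<^sup>2"]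
      show "(full (fdy (fdx \<delta> c)) z * fy z + snd (U z) * fyy z)\<^sup>2 \<le>
        2 * ((full (fdy (fdx \<delta> c)) z)\<^sup>2 * (fy z)\<^sup>2) + 2 * (weight_const \<delta> * (K\<^sup>2 * R)) * (fyy z)\<^sup>2"
        by (simp add: power_mult_distrib)
    qed
    also have "\<dots> = 2 * torus_int \<delta> (\<lambda>z. (full (fdy (fdx \<delta> c)) z)\<^sup>2 * (fy z)\<^sup>2)
        + 2 * (weight_const \<delta> * (K\<^sup>2 * R)) * torus_int \<delta> (\<lambda>z. (fyy z)\<^sup>2)"
      by (simp only: torus_int_add torus_int_cmult continuous_on_mult_left continuous_on_power continuous_on_mult cU cfy)
    also have "\<dots> \<le> 2 * (2 * ladyzhenskaya_const \<delta> * (area * (K\<^sup>2 * R)) * (2 * (area * E)))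
        + 2 * (weight_const \<delta> * (K\<^sup>2 * R)) * (area * E)"
    proof (intro add_mono mult_left_mono)
      have G: "torus_int \<delta> (\<lambda>z. (fy z)\<^sup>2 + (fyy z)\<^sup>2) \<le> 2 * (area * E)"
      proof -
        have "torus_int \<delta> (\<lambda>z. (fy z)\<^sup>2 + (fyy z)\<^sup>2) = torus_int \<delta> (\<lambda>z. (fy z)\<^sup>2) + torus_int \<delta> (\<lambda>z. (fyy z)\<^sup>2)"
          by (intro torus_int_add continuous_on_power cfy)
        then show ?thesis
          using T_le[OF energy_density_bounds(8), of N] T_le[OF energy_density_bounds(9), of N]
          by (simp add: fy_def fyy_def)
      qed
      have S: "(\<Sum>m\<in>F. (1 + (freq_x \<delta> m)\<^sup>2) * (norm (fdy (fdx \<delta> c) m))\<^sup>2) \<le> K\<^sup>2 * R" if "finite F" for F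
      proof -
        have "(\<Sum>m\<in>F. (1 + (freq_x \<delta> m)\<^sup>2) * (norm (fdy (fdx \<delta> c) m))\<^sup>2) \<le> (\<Sum>m\<in>F. K\<^sup>2 * (norm (fdx \<delta> d m))\<^sup>2)"
          by (intro sum_mono gap_bounds(2)[OF gap])
        also have "\<dots> \<le> K\<^sup>2 * R"
          unfolding KR by (rule finite_sum_le_infsum[OF sumKR that]) auto
        finally show ?thesis .
      qed
      show "torus_int \<delta> (\<lambda>z. (full (fdy (fdx \<delta> c)) z)\<^sup>2 * (fy z)\<^sup>2) \<le>
          2 * ladyzhenskaya_const \<delta> * (area * (K\<^sup>2 * R)) * (2 * (area * E))"
        by (rule torus_int_fseries_mult_square_le[OF \<delta> summable_norms(4) S fy G])
      show "torus_int \<delta> (\<lambda>z. (fyy z)\<^sup>2) \<le> area * E"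
        unfolding fyy_def by (rule T_le[OF energy_density_bounds(9)])
      show "0 \<le> 2 * (weight_const \<delta> * (K\<^sup>2 * R))"
        using R0 by (simp add: weight_const_def infsum_nonneg)
    qed simp
    also have "\<dots> = area * K\<^sup>2 * R * E * (8 * ladyzhenskaya_const \<delta> * area + 2 * weight_const \<delta>)"
      by (simp add: algebra_simps)
    finally show ?thesis .
  qed
  obtain \<eta>x \<eta>y \<eta>xx \<eta>xy \<eta>yy where
    \<eta>: "has_partials \<delta> (\<lambda>z. cos (snd z) * T N (fdy (fdx \<delta> d)) z - sin (snd z) * T N (fdx \<delta> d) z) \<eta>x \<eta>y"
    and \<eta>x: "has_partials \<delta> \<eta>x \<eta>xx \<eta>xy" and \<eta>y: "has_partials \<delta> \<eta>y \<eta>xy \<eta>yy"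
    using test_function[OF \<delta> finite_freq_box, of N "fdx \<delta> d"] unfolding T_def by blast
  define Q where "Q = (\<lambda>z. fst (U z) * \<eta>x z + snd (U z) * \<eta>y z)"
  have cQ: "continuous_on UNIV Q"
    unfolding Q_def by (intro continuous_on_add continuous_on_mult cU has_partials_continuous[OF \<eta>x] has_partials_continuous[OF \<eta>y])
  \<comment> \<open>The truncations of \<phi> converge uniformly, so the integrals tend to that of
    the weak equation, which vanishes.\<close>
  have lim: "(\<lambda>M. torus_int \<delta> (\<lambda>z. T M d z * Q z)) \<longlonglongrightarrow> 0"
  proof (rule Lim_null_comparison)
    have cf: "continuous_on UNIV (full d)"
      by (intro continuous_on_Re continuous_fseries summable_norms)
    have 0: "torus_int \<delta> (\<lambda>z. full d z * Q z) = 0"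
      using weak_transport[OF \<delta> sol has_partials_U1 has_partials_U2 has_partials_\<Psi> \<eta>x \<eta>y]
      unfolding Q_def vorticity_plus_stream .
    show "(\<lambda>M. (\<Sum>\<^sub>\<infinity>m\<in>-freq_box M. norm (d m)) * torus_int \<delta> (\<lambda>z. \<bar>Q z\<bar>)) \<longlonglongrightarrow> 0"
      by (rule tendsto_mult_left_zero[OF infsum_box_compl_tendsto[OF summable_norms(7)]])
    show "\<forall>\<^sub>F M in sequentially. norm (torus_int \<delta> (\<lambda>z. T M d z * Q z))
        \<le> (\<Sum>\<^sub>\<infinity>m\<in>-freq_box M. norm (d m)) * torus_int \<delta> (\<lambda>z. \<bar>Q z\<bar>)"
    proof (rule always_eventually, rule allI)
      fix M
      have "torus_int \<delta> (\<lambda>z. T M d z * Q z) = torus_int \<delta> (\<lambda>z. T M d z * Q z - full d z * Q z)"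
        using torus_int_diff[OF continuous_on_mult[OF cT cQ] continuous_on_mult[OF cf cQ]] 0 by simp
      also have "\<bar>\<dots>\<bar> \<le> torus_int \<delta> (\<lambda>z. (\<Sum>\<^sub>\<infinity>m\<in>-freq_box M. norm (d m)) * \<bar>Q z\<bar>)"
      proof (intro torus_int_abs_le continuous_on_diff continuous_on_mult continuous_on_const continuous_on_rabs cT cQ cf)
        fix z
        have "\<bar>T M d z - full d z\<bar> \<le> (\<Sum>\<^sub>\<infinity>m\<in>-freq_box M. norm (d m))"
          using norm_fseries_tail[OF summable_norms(7), of \<delta> z "freq_box M"]
            abs_Re_le_cmod[of "fseries \<delta> UNIV d z - fseries \<delta> (freq_box M) d z"]
          unfolding T_def by simp
        from mult_right_mono[OF this, of "\<bar>Q z\<bar>"]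
        show "\<bar>T M d z * Q z - full d z * Q z\<bar> \<le> (\<Sum>\<^sub>\<infinity>m\<in>-freq_box M. norm (d m)) * \<bar>Q z\<bar>"
          by (simp add: abs_mult flip: left_diff_distrib)
      qed
      finally show "norm (torus_int \<delta> (\<lambda>z. T M d z * Q z)) \<le> (\<Sum>\<^sub>\<infinity>m\<in>-freq_box M. norm (d m)) * torus_int \<delta> (\<lambda>z. \<bar>Q z\<bar>)"
        by (simp add: torus_int_cmult)
    qed
  qed
  have energy: "area * (\<Sum>m\<in>freq_box N. (norm (fdx \<delta> d m))\<^sup>2) \<le>
    32 * (64 * (area * infsum (energy_density \<delta> c) (- freq_box N))
      + area * K\<^sup>2 * R * E * (8 * ladyzhenskaya_const \<delta> * area + 2 * weight_const \<delta>))
    + 8 * torus_int \<delta> (\<lambda>z. T M d z * Q z)" if "N \<le> M" for M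
  proof -
    \<comment> \<open>Each difference contains only modes between the boxes N and M, so its L^2 norm
      is bounded by the tail beyond N for every M.\<close>
    define A where "A = (\<lambda>z. (cos (snd z) - full (fdy (fdy c)) z) * (T M (fdx \<delta> d) z - T N (fdx \<delta> d) z)
      + fst (U z) * (T M (fdy (fdx \<delta> d)) z - T N (fdy (fdx \<delta> d)) z)
      + full (fdy (fdx \<delta> c)) z * (T M (fdy d) z - fy z) + snd (U z) * (T M (fdy (fdy d)) z - fyy z))"
    have coercive: "1 / 2 \<le> sin (snd z) * fst (U z) + cos (snd z) * (cos (snd z) - full (fdy (fdy c)) z)" for z
    proof -
      have *: "\<bar>p * q\<bar> \<le> 1 / 4" if "\<bar>p\<bar> \<le> 1" "\<bar>q\<bar> \<le> 1 / 4" for p q :: real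
        using mult_mono[OF that] by (simp add: abs_mult)
      have "sin (snd z) * fst (U z) + cos (snd z) * (cos (snd z) - full (fdy (fdy c)) z) =
          ((sin (snd z))\<^sup>2 + (cos (snd z))\<^sup>2) - sin (snd z) * full (fdy c) z - cos (snd z) * full (fdy (fdy c)) z"
        by (simp add: U1 power2_eq_square algebra_simps)
      moreover have "\<bar>sin (snd z) * full (fdy c) z\<bar> \<le> 1 / 4" "\<bar>cos (snd z) * full (fdy (fdy c)) z\<bar> \<le> 1 / 4"
        by (intro * full_le abs_sin_le_one abs_cos_le_one)+
      ultimately show ?thesis unfolding sin_cos_squared_add by linarith
    qed
    have main: "torus_int \<delta> (\<lambda>z. (T N (fdx \<delta> d) z)\<^sup>2) \<le>
        32 * (torus_int \<delta> (\<lambda>z. (A z)\<^sup>2) + torus_int \<delta> (\<lambda>z. (B z)\<^sup>2)) + 8 * torus_int \<delta> (\<lambda>z. T M d z * Q z)"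
      unfolding A_def B_def Q_def
      by (rule energy_inequality[OF \<delta> has_partials_U1 has_partials_U2 _ coercive, where f = "T N d" and Fx = "T M (fdx \<delta> d)"
            and fxx = "T N (fdx \<delta> (fdx \<delta> d))" and Fxx = "T M (fdx \<delta> (fdx \<delta> d))"])
        (use TP[of N] TP[of M] TP[of N "fdy d"] TP[of M "fdy d"] fy \<eta> in \<open>simp_all add: fdx_fdy fy_def fyy_def\<close>)
    have A_le: "torus_int \<delta> (\<lambda>z. (A z)\<^sup>2) \<le> 64 * (area * infsum (energy_density \<delta> c) (- freq_box N))"
      unfolding A_def
    proof (rule torus_int_combination_square_le)
      have diff: "torus_int \<delta> (\<lambda>z. (T M a z - T N a z)\<^sup>2) \<le> area * infsum (energy_density \<delta> c) (- freq_box N)"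
        if "\<And>m. (norm (a m))\<^sup>2 \<le> energy_density \<delta> c m" for a
      proof -
        have "freq_box N \<subseteq> freq_box M" using \<open>N \<le> M\<close> by (auto simp: freq_box_def)
        then have "T M a z - T N a z = Re (fseries \<delta> (freq_box M - freq_box N) a z)" for z
          unfolding T_def by (intro Re_fseries_diff finite_freq_box)
        moreover have "torus_int \<delta> (\<lambda>z. (Re (fseries \<delta> (freq_box M - freq_box N) a z))\<^sup>2)
            \<le> area * infsum (energy_density \<delta> c) (- freq_box N)"
          by (intro torus_int_Re_fseries_square_le_infsum \<delta> that summable_on_subset[OF summable]) auto
        ultimately show ?thesis by simp
      qed
      show "torus_int \<delta> (\<lambda>z. (T M (fdx \<delta> d) z - T N (fdx \<delta> d) z)\<^sup>2) \<le> area * infsum (energy_density \<delta> c) (- freq_box N)"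
        "torus_int \<delta> (\<lambda>z. (T M (fdy (fdx \<delta> d)) z - T N (fdy (fdx \<delta> d)) z)\<^sup>2) \<le> area * infsum (energy_density \<delta> c) (- freq_box N)"
        "torus_int \<delta> (\<lambda>z. (T M (fdy d) z - fy z)\<^sup>2) \<le> area * infsum (energy_density \<delta> c) (- freq_box N)"
        "torus_int \<delta> (\<lambda>z. (T M (fdy (fdy d)) z - fyy z)\<^sup>2) \<le> area * infsum (energy_density \<delta> c) (- freq_box N)"
        unfolding fy_def fyy_def by (rule diff, rule energy_density_bounds)+
      fix z
      show "\<bar>cos (snd z) - full (fdy (fdy c)) z\<bar> \<le> 2"
        using full_le(4)[of z] abs_cos_le_one[of "snd z"] by linarith
      show "\<bar>fst (U z)\<bar> \<le> 2"
        using full_le(2)[of z] abs_sin_le_one[of "snd z"] unfolding U1 by linarith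
      show "\<bar>full (fdy (fdx \<delta> c)) z\<bar> \<le> 2"
        using full_le(3)[of z] by linarith
      show "\<bar>snd (U z)\<bar> \<le> 2"
        using full_le(1)[of z] unfolding U2 by linarith
    qed (intro cU continuous_on_diff cT cfy)+
    \<comment> \<open>Equality, not just an upper bound, is needed here; it rests on the conjugate
      symmetry of the coefficients.\<close>
    have "area * (\<Sum>m\<in>freq_box N. (norm (fdx \<delta> d m))\<^sup>2) = torus_int \<delta> (\<lambda>z. (T N (fdx \<delta> d) z)\<^sup>2)"
      unfolding T_def
      by (rule torus_int_Re_fseries_square[OF \<delta> finite_freq_box uminus_box, symmetric])
        (simp add: fdx_def helmholtz_def freq_x_def freq_y_def real)
    also have "\<dots> \<le> 32 * (torus_int \<delta> (\<lambda>z. (A z)\<^sup>2) + torus_int \<delta> (\<lambda>z. (B z)\<^sup>2)) + 8 * torus_int \<delta> (\<lambda>z. T M d z * Q z)"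
      by (rule main)
    also have "\<dots> \<le> 32 * (64 * (area * infsum (energy_density \<delta> c) (- freq_box N))
        + area * K\<^sup>2 * R * E * (8 * ladyzhenskaya_const \<delta> * area + 2 * weight_const \<delta>))
      + 8 * torus_int \<delta> (\<lambda>z. T M d z * Q z)"
      by (intro add_mono mult_left_mono A_le B_le order_refl) simp
    finally show ?thesis .
  qed
  let ?rhs = "32 * (64 * (area * infsum (energy_density \<delta> c) (- freq_box N))
      + area * K\<^sup>2 * R * E * (8 * ladyzhenskaya_const \<delta> * area + 2 * weight_const \<delta>))"
  \<comment> \<open>Only the transport term depends on M, and it tends to zero while N stays
    fixed.\<close>
  have "(\<lambda>M. ?rhs + 8 * torus_int \<delta> (\<lambda>z. T M d z * Q z)) \<longlonglongrightarrow> ?rhs + 8 * 0"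
    by (intro tendsto_intros lim)
  then have "area * (\<Sum>m\<in>freq_box N. (norm (fdx \<delta> d m))\<^sup>2) \<le> ?rhs + 8 * 0"
    by (rule LIMSEQ_le_const) (use energy in blast)
  then show ?thesis by simp
qed

text \<open>As N grows the tail of the convergent energy vanishes, and the truncated sums on the
  left tend to \<open>R\<close>.\<close>

lemma rigidity_estimate:
  defines "R \<equiv> \<Sum>\<^sub>\<infinity>m. (norm (fdx \<delta> (helmholtz \<delta> c) m))\<^sup>2"
  shows "R \<le> rigidity_const \<delta> K * infsum (energy_density \<delta> c) UNIV * R"
proof -
  have sumR: "(\<lambda>m. (norm (fdx \<delta> d m))\<^sup>2) summable_on UNIV"
    by (rule summable_on_comparison_test[OF summable energy_density_bounds(6)]) simp
  let ?b = "area * K\<^sup>2 * R * E * (8 * ladyzhenskaya_const \<delta> * area + 2 * weight_const \<delta>)"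
  have "(\<lambda>N. area * (\<Sum>m\<in>freq_box N. (norm (fdx \<delta> d m))\<^sup>2)) \<longlonglongrightarrow> area * R"
    unfolding R_def by (intro tendsto_mult_left sum_box_tendsto sumR)
  moreover have "(\<lambda>N. 32 * (64 * (area * infsum (energy_density \<delta> c) (- freq_box N)) + ?b)) \<longlonglongrightarrow> 32 * (64 * (area * 0) + ?b)"
    by (intro tendsto_intros infsum_box_compl_tendsto summable)
  ultimately have "area * R \<le> 32 * (64 * (area * 0) + ?b)"
    by (rule LIMSEQ_le) (use truncated_estimate in \<open>unfold R_def, blast\<close>)
  then have "area * R \<le> area * (rigidity_const \<delta> K * E * R)"
    by (simp add: rigidity_const_def algebra_simps)
  then show ?thesis
    using \<delta> by simp
qed

text \<open>A factor below 1 forces \<open>R\<close> = 0, so \<phi>_x vanishes mode by mode; the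
  spectral gap transfers this to all coefficients with nonzero x-frequency.\<close>

lemma shear_flow_of_small_energy:
  assumes "rigidity_const \<delta> K * infsum (energy_density \<delta> c) UNIV < 1"
  shows "shear_flow U"
proof -
  let ?r = "\<lambda>m. (norm (fdx \<delta> d m))\<^sup>2"
  have sumR: "?r summable_on UNIV"
    by (rule summable_on_comparison_test[OF summable energy_density_bounds(6)]) simp
  define R where "R = infsum ?r UNIV"
  have "R \<ge> 0" unfolding R_def by (rule infsum_nonneg) simp
  moreover have "R \<le> rigidity_const \<delta> K * E * R"
    unfolding R_def by (rule rigidity_estimate)
  ultimately have "R = 0"
    using assms mult_strict_right_mono[of "rigidity_const \<delta> K * E" 1 R] by (cases "R = 0") auto
  have "fdx \<delta> d m = 0" for m
  proof -
    have "sum ?r {m} \<le> R"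
      unfolding R_def by (rule finite_sum_le_infsum[OF sumR]) auto
    then show ?thesis using \<open>R = 0\<close> by simp
  qed
  have c0: "c m = 0" if "fst m \<noteq> 0" for m
  proof -
    \<comment> \<open>If the symbol vanished, the gap would give a weight at most 0, whereas weights
      are at least 1.\<close>
    have "1 - (freq_x \<delta> m)\<^sup>2 - (freq_y m)\<^sup>2 \<noteq> 0"
      using gap[OF that] weight_ge_1[of \<delta> m] by auto
    moreover have "norm (fdx \<delta> d m) = 0" using \<open>fdx \<delta> d m = 0\<close> by simp
    ultimately show ?thesis
      using that \<delta> by (simp add: norm_fdx norm_helmholtz freq_x_def)
  qed
  have "fdx \<delta> c = (\<lambda>m. 0)"
    using c0 by (auto simp: fun_eq_iff fdx_def freq_x_def)
  then have "snd (U z) = 0" for z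
    by (simp add: U2 fseries_def)
  \<comment> \<open>The surviving modes do not depend on x, so the profile can be read off at x =
    0.\<close>
  moreover have "fst (U (x, y)) = sin y - full (fdy c) (0, y)" for x y
  proof -
    have "fdy c m * mode \<delta> m (x, y) = fdy c m * mode \<delta> m (0, y)" for m
      using c0[of m] by (cases "fst m = 0") (simp_all add: fdy_def mode_def freq_x_def)
    then have "(\<lambda>m. fdy c m * mode \<delta> m (x, y)) = (\<lambda>m. fdy c m * mode \<delta> m (0, y))"
      by (rule ext)
    then show ?thesis by (simp only: U1 fseries_def snd_conv)
  qed
  ultimately show ?thesis
    unfolding shear_flow_def by (intro exI[of _ "\<lambda>y. sin y - full (fdy c) (0, y)"]) (simp add: prod_eq_iff)
qed

end

text \<open>Since V is the perpendicular gradient of \<psi>, its coefficients are those of \<psi>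
  times the frequencies. Their squares add up to the factor in \<open>energy_density\<close>, and
  the sign of the first component is lost in the norm.\<close>

lemma sobolev_velocity_eq:
  assumes \<delta>: "\<delta> > 0" and \<psi>: "has_partials \<delta> \<psi> (\<lambda>z. snd (V z)) (\<lambda>z. - fst (V z))"
    and V: "in_sobolev_vec \<delta> 3 V"
  defines "s \<equiv> energy_density \<delta> (fourier_coeff \<delta> \<psi>)"
  shows "s summable_on UNIV" and "(sobolev_norm_vec \<delta> 3 V)\<^sup>2 = 4 * pi\<^sup>2 * \<delta> * infsum s UNIV"
proof -
  let ?c = "fourier_coeff \<delta> \<psi>"
  have c2: "fourier_coeff \<delta> (snd \<circ> V) m = fdx \<delta> ?c m" for m
    using fourier_coeff_partials(1)[OF \<delta> \<psi>, of m] by (simp add: fdx_def o_def)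
  have c1: "fourier_coeff \<delta> (fst \<circ> V) m = - fdy ?c m" for m
  proof -
    have cont: "continuous_on UNIV (\<lambda>z. - fst (V z))"
      by (rule has_partialsD(3)[OF \<psi>])
    then have "continuous_on UNIV (\<lambda>z. - (- fst (V z)))"
      by (rule continuous_on_minus)
    then have cont': "continuous_on UNIV (fst \<circ> V)" by (simp add: o_def)
    have "fourier_coeff \<delta> (fst \<circ> V) m = - fourier_coeff \<delta> (\<lambda>z. - fst (V z)) m"
      unfolding fourier_coeff_continuous[OF cont] fourier_coeff_continuous[OF cont']
      using torus_int_cmult[of \<delta> "- 1" "\<lambda>z. complex_of_real (fst (V z)) * mode \<delta> (- m) z"] by simp
    then show ?thesis
      using fourier_coeff_partials(2)[OF \<delta> \<psi>, of m] by (simp add: fdy_def)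
  qed
  have s: "s m = sobolev_term \<delta> 3 (fst \<circ> V) m + sobolev_term \<delta> 3 (snd \<circ> V) m" for m
  proof -
    have st: "sobolev_term \<delta> 3 f m = weight \<delta> m ^ 3 * (norm (fourier_coeff \<delta> f m))\<^sup>2" for f
      by (simp add: sobolev_term_def weight_def freq_x_def freq_y_def case_prod_beta)
    show ?thesis
      unfolding st c1 c2 s_def energy_density_def
      by (simp add: norm_fdx norm_fdy power_mult_distrib algebra_simps)
  qed
  have sum: "sobolev_term \<delta> 3 (fst \<circ> V) summable_on UNIV" "sobolev_term \<delta> 3 (snd \<circ> V) summable_on UNIV"
    using V by (simp_all add: in_sobolev_vec_def in_sobolev_def)
  show "s summable_on UNIV"
    using summable_on_add[OF sum] by (simp add: s[abs_def])
  have nonneg: "0 \<le> infsum (sobolev_term \<delta> 3 f) UNIV" for f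
    by (rule infsum_nonneg) (simp add: sobolev_term_def case_prod_beta)
  have "(sobolev_norm \<delta> 3 f)\<^sup>2 = 4 * pi\<^sup>2 * \<delta> * infsum (sobolev_term \<delta> 3 f) UNIV" for f
    unfolding sobolev_norm_def using nonneg[of f] \<delta> by simp
  moreover have "infsum s UNIV = infsum (sobolev_term \<delta> 3 (fst \<circ> V)) UNIV + infsum (sobolev_term \<delta> 3 (snd \<circ> V)) UNIV"
    unfolding s[abs_def] by (rule infsum_add[OF sum])
  ultimately show "(sobolev_norm_vec \<delta> 3 V)\<^sup>2 = 4 * pi\<^sup>2 * \<delta> * infsum s UNIV"
    unfolding sobolev_norm_vec_def using nonneg \<delta> by (simp add: distrib_left)
qed

text \<open>The partial derivatives of \<Psi> are velocity components, and a classical solution is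
  differentiable, hence continuous.\<close>

lemma stream_function_has_partials:
  assumes "stationary_euler \<delta> U" "stream_function \<delta> \<Psi> U"
  shows "has_partials \<delta> \<Psi> (\<lambda>z. snd (U z)) (\<lambda>z. - fst (U z))"
proof (rule has_partialsI)
  from assms(1) obtain P where "euler_solution \<delta> (\<lambda>t. U) P"
    unfolding stationary_euler_def by blast
  then have "U differentiable (at z)" for z
    unfolding euler_solution_def by blast
  then have "continuous_on UNIV U"
    by (simp add: differentiable_imp_continuous_on differentiable_on_def differentiable_at_withinI)
  then show "continuous_on UNIV (\<lambda>z. snd (U z))" "continuous_on UNIV (\<lambda>z. - fst (U z))"
    by (intro continuous_intros; assumption)+
  have *: "torus_periodic \<delta> \<Psi>" "\<And>z. \<Psi> differentiable (at z)" "U = perp_grad \<Psi>"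
    using assms(2) unfolding stream_function_def by blast+
  show "torus_periodic \<delta> \<Psi>" "\<And>z. \<Psi> differentiable (at z)" by (fact *)+
  show "dx \<Psi> z = snd (U z)" "dy \<Psi> z = - fst (U z)" for z
    by (simp_all add: *(3) perp_grad_def)
qed

theorem theorem2:
  fixes \<delta> :: real
  assumes "\<delta> > 0" and "\<delta> \<notin> \<nat>"
  shows "\<exists>\<epsilon>\<^sub>0>0. \<forall>U :: real \<times> real \<Rightarrow> real \<times> real.
    stationary_euler \<delta> U \<longrightarrow>
    (\<exists>\<Psi>. stream_function \<delta> \<Psi> U) \<longrightarrow>
    in_sobolev_vec \<delta> 3 (\<lambda>z. U z - kolmogorov_flow z) \<longrightarrow>
    sobolev_norm_vec \<delta> 3 (\<lambda>z. U z - kolmogorov_flow z) \<le> \<epsilon>\<^sub>0 \<longrightarrow>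
    shear_flow U"
proof -
  obtain K where gap: "\<And>m. fst m \<noteq> 0 \<Longrightarrow> weight \<delta> m \<le> K * \<bar>1 - (freq_x \<delta> m)\<^sup>2 - (freq_y m)\<^sup>2\<bar>"
    using spectral_gap[OF assms] by blast
  \<comment> \<open>One constant for both smallness conditions: with \<epsilon>^2 = area / (2 k) the
    energy satisfies k E \<le> 1/2, which bounds 16 \<open>weight_const\<close> E and the rigidity
    factor separately. The summand 1 keeps k positive.\<close>
  define k where "k = 1 + 16 * weight_const \<delta> + \<bar>rigidity_const \<delta> K\<bar>"
  have W: "0 \<le> weight_const \<delta>"
    unfolding weight_const_def by (rule infsum_nonneg) simp
  then have k: "k \<ge> 1" by (simp add: k_def)
  define \<epsilon> where "\<epsilon> = sqrt (4 * pi\<^sup>2 * \<delta> / (2 * k))"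
  have "\<epsilon> > 0" using assms k by (simp add: \<epsilon>_def)
  moreover have "shear_flow U" if sol: "stationary_euler \<delta> U" and str: "stream_function \<delta> \<Psi> U"
    and sob: "in_sobolev_vec \<delta> 3 (\<lambda>z. U z - kolmogorov_flow z)"
    and le: "sobolev_norm_vec \<delta> 3 (\<lambda>z. U z - kolmogorov_flow z) \<le> \<epsilon>" for U \<Psi>
  proof -
    define V where "V = (\<lambda>z. U z - kolmogorov_flow z)"
    have fV: "fst (V z) = fst (U z) - sin (snd z)" and sV: "snd (V z) = snd (U z)" for z
      by (simp_all add: V_def kolmogorov_flow_def case_prod_beta)
    \<comment> \<open>The stream function of the perturbation: cos y is that of the Kolmogorov
      flow.\<close>
    define \<psi> where "\<psi> = (\<lambda>z. \<Psi> z + (- cos (snd z)))"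
    have "has_partials \<delta> (\<lambda>z. - cos (snd z)) (\<lambda>z. 0) (\<lambda>z. sin (snd z))"
      by (rule has_partials_fun_y) (auto intro!: derivative_eq_intros continuous_intros)
    from has_partials_add[OF stream_function_has_partials[OF sol str] this]
    have \<psi>: "has_partials \<delta> \<psi> (\<lambda>z. snd (V z)) (\<lambda>z. - fst (V z))"
      by (rule has_partials_cong) (simp_all add: \<psi>_def fV sV)
    define c where "c = fourier_coeff \<delta> \<psi>"
    define E where "E = infsum (energy_density \<delta> c) UNIV"
    have sum: "energy_density \<delta> c summable_on UNIV"
      and norm: "(sobolev_norm_vec \<delta> 3 V)\<^sup>2 = 4 * pi\<^sup>2 * \<delta> * E"
      using sobolev_velocity_eq[OF assms(1) \<psi>] sob by (simp_all add: c_def E_def V_def)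
    have E0: "0 \<le> E"
      unfolding E_def by (rule infsum_nonneg) (rule energy_density_nonneg)
    have "0 \<le> sobolev_norm_vec \<delta> 3 V"
      by (simp add: sobolev_norm_vec_def)
    then have "4 * pi\<^sup>2 * \<delta> * E \<le> \<epsilon>\<^sup>2"
      using le power_mono[of "sobolev_norm_vec \<delta> 3 V" \<epsilon> 2] unfolding norm[symmetric] by (simp add: V_def)
    also have "\<dots> = 4 * pi\<^sup>2 * \<delta> * (1 / (2 * k))"
      using assms k by (simp add: \<epsilon>_def)
    finally have "E \<le> 1 / (2 * k)"
      by (rule mult_left_le_imp_le) (use assms in simp)
    then have kE: "k * E \<le> 1 / 2"
      using k by (simp add: field_simps)
    have kE_eq: "k * E = E + 16 * (weight_const \<delta> * E) + \<bar>rigidity_const \<delta> K\<bar> * E"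
      by (simp add: k_def algebra_simps)
    have "0 \<le> weight_const \<delta> * E" "0 \<le> \<bar>rigidity_const \<delta> K\<bar> * E"
      using W E0 by simp_all
    moreover have "rigidity_const \<delta> K * E \<le> \<bar>rigidity_const \<delta> K\<bar> * E"
      using E0 by (intro mult_right_mono) auto
    ultimately have small: "weight_const \<delta> * E \<le> 1 / 16" "rigidity_const \<delta> K * E < 1"
      using kE kE_eq E0 by linarith+
    have cont: "continuous_on UNIV \<psi>" by (rule has_partials_continuous[OF \<psi>])
    have abs: "(\<lambda>m. norm (fdx \<delta> c m)) summable_on UNIV" "(\<lambda>m. norm (fdy c m)) summable_on UNIV"
      by (rule Re_fseries_square_le(1)[OF assms(1) sum], rule energy_density_bounds)+
    have absc: "(\<lambda>m. norm (c m)) summable_on UNIV"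
      by (rule summable_norm_of_gradient[OF assms(1) abs])
    \<comment> \<open>The Sobolev hypothesis speaks only of Fourier coefficients; inversion turns it
      into a pointwise representation.\<close>
    have \<psi>_eq: "\<psi> = (\<lambda>z. Re (fseries \<delta> UNIV c z))"
    proof
      fix z
      have "complex_of_real (\<psi> z) = fseries \<delta> UNIV c z"
        using fourier_inversion[OF assms(1) cont has_partialsD(1)[OF \<psi>]] absc by (simp add: c_def)
      then show "\<psi> z = Re (fseries \<delta> UNIV c z)" by (metis Re_complex_of_real)
    qed
    \<comment> \<open>The partial derivatives of \<psi> are now known both as velocity components
      and as series; uniqueness of the derivative identifies them.\<close>
    have P: "has_partials \<delta> \<psi> (\<lambda>z. Re (fseries \<delta> UNIV (fdx \<delta> c) z)) (\<lambda>z. Re (fseries \<delta> UNIV (fdy c) z))"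
      unfolding \<psi>_eq by (rule has_partials_Re[OF assms(1) absc abs])
    have "snd (U z) = Re (fseries \<delta> UNIV (fdx \<delta> c) z)" for z
      using has_partials_dx[OF P] has_partials_dx[OF \<psi>] by (simp add: sV)
    moreover have "fst (U z) = sin (snd z) - Re (fseries \<delta> UNIV (fdy c) z)" for z
      using has_partials_dy[OF P, of z] has_partials_dy[OF \<psi>, of z] fV[of z] by simp
    moreover have "\<Psi> z = cos (snd z) + Re (fseries \<delta> UNIV c z)" for z
      using fun_cong[OF \<psi>_eq, of z] by (simp add: \<psi>_def)
    moreover have "c (- m) = cnj (c m)" for m
      unfolding c_def by (rule fourier_coeff_uminus[OF cont])
    ultimately show ?thesis
      using small unfolding E_def
      by (intro shear_flow_of_small_energy[OF assms(1) gap sol sum]) auto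
  qed
  ultimately show ?thesis by blast
qed

end
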